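(* Let $\lambda,\mu\in M$ and let $\{\lambda_m\},\{\mu_n\}\subset M$ be sequences with $\lambda_m\to\lambda$ and $\mu_n\to\mu$ in the complete metric space $(M,d)$. Assume there are positive constants $\bar C, L_F$ with $L_F>\bar C$ and, for each $\lambda'\in M$, positive constants $K_{b_{\lambda'}},K_{\sigma_{\lambda'}},K_{\sigma_{1\lambda'}},K_{G_{\lambda'}},L_{b_{\lambda'}},L_{\sigma_{\lambda'}},L_{\sigma_{1\lambda'}},L_{G_{\lambda'}}$, such that for all $\lambda'\in M$, $t\in[0,T]$, $x,x_1,x_2,u,u_1,u_2\in\mathbb{R}^p$ and $\tilde x,\tilde x_1,\tilde x_2,\tilde u_1,\tilde u_2\in H[0,T]$: (i) $\|h(t,x,u)\|^2\le K_h(1+\|x\|^2+\|u\|^2)$ for $h\in\{b_{\lambda'},\sigma_{\lambda'},\sigma_{1\lambda'}\}$, and $\int_{\|y\|<c}\|G_{\lambda'}(t,x,u,y)\|^2v(dy)\le K_{G_{\lambda'}}(1+\|x\|^2+\|u\|^2)$; (ii) $\|h(t,x_1,u_1)-h(t,x_2,u_2)\|^2\le L_h(\|x_1-x_2\|^2+\|u_1-u_2\|^2)$ for $h\in\{b_{\lambda'},\sigma_{\lambda'},\sigma_{1\lambda'}\}$, and $\int_{\|y\|<c}\|G_{\lambda'}(t,x_1,u_1,y)-G_{\lambda'}(t,x_2,u_2,y)\|^2v(dy)\le L_{G_{\lambda'}}(\|x_1-x_2\|^2+\|u_1-u_2\|^2)$; (iii) $\|\tilde F_{\lambda'}(\tilde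 x_1,\tilde u_1)-\tilde F_{\lambda'}(\tilde x_2,\tilde u_2)\|_{H[0,T]}\le L_F(\|\tilde x_1-\tilde x_2\|_{H[0,T]}+\|\tilde u_1-\tilde u_2\|_{H[0,T]})$ and $\langle\tilde F_{\lambda'}(\tilde x,\tilde u_1)-\tilde F_{\lambda'}(\tilde x,\tilde u_2),\tilde u_1-\tilde u_2\rangle_{H[0,T]}\ge\bar C\|\tilde u_1-\tilde u_2\|_{H[0,T]}^2$; (iv) $b_{\lambda'},\sigma_{\lambda'},\sigma_{1\lambda'},G_{\lambda'},F_{\lambda'}$ are uniformly continuous with respect to $\lambda'$, uniformly in their remaining arguments ($G_{\lambda'}(t,x,u,\cdot)$ being measured in $L^2(\{\|y\|<c\},v)$). Suppose also $K_{\mu_n}\overset{M}{\rightarrow}K_\mu$ (Mosco convergence in $\mathbb{R}^p$). Let $(x_{\lambda,\mu},u_{\lambda,\mu})$ be the unique solution of $\mathbf{MAS}(\lambda,\mu)$ and $(x_{\lambda_m,\mu_n},u_{\lambda_m,\mu_n})$ the unique solution of $\mathbf{MAS}(\lambda_m,\mu_n)$. Then, as $\lambda_m\to\lambda$ and $\mu_n\to\mu$, $x_{\lambda_m,\mu_n}\to x_{\lambda,\mu}$ and $u_{\lambda_m,\mu_n}\to u_{\lambda,\mu}$ in $\mathcal{L}^2_{ad}([0,T]\times\Omega,\mathbb{R}^p)$.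
   Context: $(\Omega,\mathcal{F},\{\mathcal{F}_t\}_{t\ge0},\mathbb{P})$ is a complete filtered probability space, $T>0$, $\alpha\in(\tfrac12,1)$, $c\ge0$. $B$ is an $l$-dimensional $\mathcal{F}_t$-adapted Brownian motion, $N$ an $\mathcal{F}_t$-adapted Poisson random measure on $\mathbb{R}^+\times(\mathbb{R}^p\setminus\{0\})$ independent of $B$ with intensity measure $v$ satisfying $\int\frac{\|y\|^2}{1+\|y\|^2}v(dy)<\infty$, and $\tilde N(dt,dy)=N(dt,dy)-v(dy)dt$. $p_0$ is an $\mathbb{R}^p$-valued random variable with $\mathbb{E}\|p_0\|^2<\infty$. $H[0,T]=\mathcal{L}^2_{ad}([0,T]\times\Omega,\mathbb{R}^p)$ is the Hilbert space of $\mathbb{R}^p$-valued $\mathcal{F}_t$-adapted processes $f$ with $\int_0^T\mathbb{E}\|f\|^2dt<\infty$, with inner product $\int_0^T\mathbb{E}\langle u,v\rangle dt$. For $\mu$ in the complete metric space $(M,d)$, $K_\mu\subset\mathbb{R}^p$ is closed, convex, with $0\in K_\mu$, and $U_\mu[0,T]=\{u\in H[0,T]:u(t,\omega)\in K_\mu\text{ a.e. }t,\text{ a.s. }\omega\}$. For each $\lambda\in M$ the measurable adapted functions are $b_\lambda,\sigma_{1\lambda}:[0,T]\times\mathbb{R}^p\times\mathbb{R}^p\to\mathbb{R}^p$, $\sigma_\lambda:[0,T]\times\mathbb{R}^p\times\mathbb{R}^p\to\mathbb{R}^{p\times l}$, $G_\lambda:[0,T]\times\mathbb{R}^p\times\mathbb{R}^p\times\mathbb{R}^p\to\mathbb{R}^p$,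 $F_\lambda:[0,T]\times\Omega\times\mathbb{R}^p\times\mathbb{R}^p\to\mathbb{R}^p$, with $\sigma_{1\lambda}$ continuous in $t$ and the jump integrals square integrable martingales; $\tilde F_\lambda(x,u)(s,\omega)=F_\lambda(s,\omega,x(s,\omega),u(s,\omega))$, with $\tilde F_\lambda(x,u)\in H[0,T]$. (These are a parametrization of the data of the variational inequality characterizing the Nash equilibrium of a $p$-agent stochastic fractional differential game, where the $i$th component of $\tilde F$ is the gradient $\nabla_{u^i}\theta^i$ of agent $i$'s cost, the $i$th components of the coefficients drive agent $i$'s state, and the constraint set is the product of the agents' constraint sets.) System $\mathbf{MAS}(\lambda,\mu)$: find $(x,u)\in\mathcal{L}^2_{ad}([0,T]\times\Omega,\mathbb{R}^p)\times U_\mu[0,T]$ with $$dx(t)=b_\lambda(t,x(t-),u(t-))dt+\sigma_{1\lambda}(t,x(t-),u(t-))(dt)^\alpha+\sigma_\lambda(t,x(t-),u(t-))dB(t)+\int_{\|y\|<c}G_\lambda(t,x(t-),u(t-),y)\tilde N(dt,dy),\quad x(0)=p_0,$$ $$\langle F_\lambda(t,\omega,x(t,\omega),u(t,\omega)),w-u(t,\omega)\rangle\ge0\quad\forall w\in K_\mu,\ \text{a.e. }t\in[0,T],\ \text{a.s. }\omega\in\Omega,$$ the equation being understood in integral form with $\int_0^t f(s)(ds)^\alpha:=\alpha\int_0^t(t-s)^{\alpha-1}f(s)ds$. Uniqueness is in the almost-everywhere sense. Mosco convergence: for closed convex subsets $C_n,C_0$ of a Hilbert space, $C_n\overset{M}{\rightarrow}C_0$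 means: every $x\in C_0$ is the strong limit of some $x_n\in C_n$, and whenever $x_{n_i}\in C_{n_i}$ along a subsequence with $x_{n_i}\rightharpoonup x$ weakly, then $x\in C_0$. *)

theory Defs
  imports "HOL-Probability.Probability"
begin

section \<open>The stochastic basis\<close>

text \<open>
  Time is of type \<open>real\<close>; a filtration is only ever used at nonnegative times. A filtered
  probability space is complete if every null set of the complete measure \<open>P\<close> is already an
  event at time \<open>0\<close>. Right-continuity is not required.
\<close>

definition complete_filtered_prob_space :: "'w measure \<Rightarrow> (real \<Rightarrow> 'w measure) \<Rightarrow> bool" where
  "complete_filtered_prob_space P \<F> \<longleftrightarrow>
     prob_space P \<and> complete_measure P \<and>
     (\<forall>t\<ge>0. subalgebra P (\<F> t)) \<and>
     filtration (space P) (\<lambda>t. \<F> (max 0 t)) \<and>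
     null_sets P \<subseteq> sets (\<F> 0)"

text \<open>
  A Brownian motion (or Poisson random measure) is adapted to a filtration in the sense usual in
  stochastic calculus: it is adapted as a process, and its increments after time \<open>s\<close> are
  independent of the events at time \<open>s\<close>.
\<close>

definition brownian_motion ::
    "'w measure \<Rightarrow> (real \<Rightarrow> 'w measure) \<Rightarrow> (real \<Rightarrow> 'w \<Rightarrow> real^'l) \<Rightarrow> bool" where
  "brownian_motion P \<F> B \<longleftrightarrow>
     (\<forall>t\<ge>0. B t \<in> borel_measurable (\<F> t)) \<and>
     (AE \<omega> in P. B 0 \<omega> = 0) \<and>
     (AE \<omega> in P. continuous_on {0..} (\<lambda>t. B t \<omega>)) \<and>
     (\<forall>s t. 0 \<le> s \<and> s < t \<longrightarrow>
        prob_space.indep_set P (sets (\<F> s))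
          (sets (vimage_algebra (space P) (\<lambda>\<omega>. B t \<omega> - B s \<omega>) borel)) \<and>
        prob_space.indep_vars P (\<lambda>_. borel) (\<lambda>i \<omega>. (B t \<omega> - B s \<omega>) $ i) UNIV \<and>
        (\<forall>i. distributed P lborel (\<lambda>\<omega>. (B t \<omega> - B s \<omega>) $ i)
               (normal_density 0 (sqrt (t - s)))))"

text \<open>
  The intensity \<open>v\<close> on the punctured space is encoded as a Borel measure on the whole space
  without mass at \<open>0\<close>, and likewise a random measure on \<open>{0..} \<times> (- {0})\<close> as one on the
  whole product without mass outside this set.
\<close>

definition intensity_measure :: "(real^'p) measure \<Rightarrow> bool" where
  "intensity_measure v \<longleftrightarrow>
     sets v = sets borel \<and> emeasure v {0} = 0 \<and>
     (\<integral>\<^sup>+ y. ennreal ((norm y)\<^sup>2 / (1 + (norm y)\<^sup>2)) \<partial>v) < \<infinity>"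

definition random_measure_events ::
    "'w measure \<Rightarrow> ('w \<Rightarrow> (real \<times> (real^'p)) measure) \<Rightarrow> (real \<times> (real^'p)) set \<Rightarrow> 'w set set" where
  "random_measure_events P N D =
     sigma_sets (space P)
       {(\<lambda>\<omega>. emeasure (N \<omega>) A) -` S \<inter> space P | A S.
          A \<in> sets borel \<and> A \<subseteq> D \<and> S \<in> sets borel}"

definition poisson_random_measure ::
    "'w measure \<Rightarrow> (real \<Rightarrow> 'w measure) \<Rightarrow> (real^'p) measure
      \<Rightarrow> ('w \<Rightarrow> (real \<times> (real^'p)) measure) \<Rightarrow> bool" where
  "poisson_random_measure P \<F> v N \<longleftrightarrow>
     (\<forall>\<omega>\<in>space P. sets (N \<omega>) = sets borel \<and> emeasure (N \<omega>) (- ({0..} \<times> (- {0}))) = 0) \<and>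
     (\<forall>A\<in>sets borel. A \<subseteq> {0..} \<times> (- {0}) \<longrightarrow>
        (\<lambda>\<omega>. emeasure (N \<omega>) A) \<in> borel_measurable P \<and>
        (emeasure (lborel \<Otimes>\<^sub>M v) A = \<infinity> \<longrightarrow> (AE \<omega> in P. emeasure (N \<omega>) A = \<infinity>)) \<and>
        (emeasure (lborel \<Otimes>\<^sub>M v) A < \<infinity> \<longrightarrow>
           (\<forall>k. measure P {\<omega>\<in>space P. emeasure (N \<omega>) A = of_nat k} =
                (measure (lborel \<Otimes>\<^sub>M v) A) ^ k / fact k * exp (- measure (lborel \<Otimes>\<^sub>M v) A)))) \<and>
     (\<forall>A :: nat \<Rightarrow> (real \<times> (real^'p)) set.
        (\<forall>n. A n \<in> sets borel \<and> A n \<subseteq> {0..} \<times> (- {0})) \<and> disjoint_family A \<longrightarrow>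
        prob_space.indep_vars P (\<lambda>_. borel) (\<lambda>n \<omega>. emeasure (N \<omega>) (A n)) UNIV) \<and>
     (\<forall>t\<ge>0. random_measure_events P N ({0..t} \<times> (- {0})) \<subseteq> sets (\<F> t)) \<and>
     (\<forall>s\<ge>0. prob_space.indep_set P (sets (\<F> s))
               (random_measure_events P N ({s<..} \<times> (- {0}))))"

definition independent_noises ::
    "'w measure \<Rightarrow> (real \<Rightarrow> 'w \<Rightarrow> real^'l) \<Rightarrow> ('w \<Rightarrow> (real \<times> (real^'p)) measure) \<Rightarrow> bool" where
  "independent_noises P B N \<longleftrightarrow>
     prob_space.indep_set P
       (sigma_sets (space P) {B t -` S \<inter> space P | t S. 0 \<le> t \<and> S \<in> sets borel})
       (random_measure_events P N ({0..} \<times> (- {0})))"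


section \<open>The space of square integrable adapted processes\<close>

text \<open>
  Elements of the Hilbert space are represented by processes; two processes are the same element
  iff they agree for almost every \<open>t\<close>, almost surely, i.e. iff \<open>H_norm\<close> of their difference
  is \<open>0\<close>. The integrability condition is stated with the nonnegative integral, because the
  Bochner integral of a non-integrable function is \<open>0\<close>.
\<close>

definition L2ad ::
    "'w measure \<Rightarrow> (real \<Rightarrow> 'w measure) \<Rightarrow> real \<Rightarrow> (real \<Rightarrow> 'w \<Rightarrow> real^'p) set" where
  "L2ad P \<F> T =
     {f. (\<lambda>(t, \<omega>). f t \<omega>) \<in> borel_measurable (restrict_space borel {0..T} \<Otimes>\<^sub>M P) \<and>
         (\<forall>t\<in>{0..T}. f t \<in> borel_measurable (\<F> t)) \<and>
         (\<integral>\<^sup>+ t\<in>{0..T}. (\<integral>\<^sup>+ \<omega>. ennreal ((norm (f t \<omega>))\<^sup>2) \<partial>P) \<partial>lborel) < \<infinity>}"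

definition H_inner ::
    "'w measure \<Rightarrow> real \<Rightarrow> (real \<Rightarrow> 'w \<Rightarrow> real^'p) \<Rightarrow> (real \<Rightarrow> 'w \<Rightarrow> real^'p) \<Rightarrow> real" where
  "H_inner P T f g = (LINT t:{0..T}|lborel. (LINT \<omega>|P. f t \<omega> \<bullet> g t \<omega>))"

definition H_norm :: "'w measure \<Rightarrow> real \<Rightarrow> (real \<Rightarrow> 'w \<Rightarrow> real^'p) \<Rightarrow> real" where
  "H_norm P T f = sqrt (H_inner P T f f)"

abbreviation H_dist ::
    "'w measure \<Rightarrow> real \<Rightarrow> (real \<Rightarrow> 'w \<Rightarrow> real^'p) \<Rightarrow> (real \<Rightarrow> 'w \<Rightarrow> real^'p) \<Rightarrow> real" where
  "H_dist P T f g \<equiv> H_norm P T (\<lambda>t \<omega>. f t \<omega> - g t \<omega>)"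

definition constrained_L2ad ::
    "'w measure \<Rightarrow> (real \<Rightarrow> 'w measure) \<Rightarrow> real \<Rightarrow> (real^'p) set
      \<Rightarrow> (real \<Rightarrow> 'w \<Rightarrow> real^'p) set" where
  "constrained_L2ad P \<F> T K =
     {u \<in> L2ad P \<F> T. AE t in lborel. t \<in> {0..T} \<longrightarrow> (AE \<omega> in P. u t \<omega> \<in> K)}"

definition square_integrable_martingale ::
    "'w measure \<Rightarrow> (real \<Rightarrow> 'w measure) \<Rightarrow> real \<Rightarrow> (real \<Rightarrow> 'w \<Rightarrow> real^'p) \<Rightarrow> bool" where
  "square_integrable_martingale P \<F> T J \<longleftrightarrow>
     (\<forall>t\<in>{0..T}. J t \<in> borel_measurable (\<F> t) \<and>
        (\<integral>\<^sup>+ \<omega>. ennreal ((norm (J t \<omega>))\<^sup>2) \<partial>P) < \<infinity>) \<and>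
     (\<forall>s t. 0 \<le> s \<and> s \<le> t \<and> t \<le> T \<longrightarrow>
        (\<forall>i. AE \<omega> in P. real_cond_exp P (\<F> s) (\<lambda>\<omega>. J t \<omega> $ i) \<omega> = J s \<omega> $ i))"


section \<open>Stochastic integrals\<close>

text \<open>
  Both stochastic integrals are defined as usual: elementarily for simple integrands, and by
  \<open>L\<^sup>2\<close>-limits in general (well defined up to null sets by the Ito isometry). A simple integrand
  is a list of blocks: \<open>(a, b, \<xi>)\<close> stands for the process \<open>1\<^bsub>(a, b]\<^esub>(s) \<xi>(\<omega>)\<close> and
  \<open>(a, b, A, \<xi>)\<close> for \<open>1\<^bsub>(a, b]\<^esub>(s) 1\<^bsub>A\<^esub>(y) \<xi>(\<omega>)\<close>, with \<open>\<xi>\<close> bounded and known at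
  time \<open>a\<close>; the list stands for the sum, and blocks may overlap.
\<close>

definition simple_process ::
    "'w measure \<Rightarrow> (real \<Rightarrow> 'w measure) \<Rightarrow> (real \<times> real \<times> ('w \<Rightarrow> real^'l^'p)) list \<Rightarrow> bool" where
  "simple_process P \<F> \<phi> \<longleftrightarrow>
     (\<forall>(a, b, \<xi>)\<in>set \<phi>. 0 \<le> a \<and> a \<le> b \<and> \<xi> \<in> borel_measurable (\<F> a) \<and>
        bounded (\<xi> ` space P))"

definition simple_value ::
    "(real \<times> real \<times> ('w \<Rightarrow> real^'l^'p)) list \<Rightarrow> real \<Rightarrow> 'w \<Rightarrow> real^'l^'p" where
  "simple_value \<phi> s \<omega> = (\<Sum>(a, b, \<xi>)\<leftarrow>\<phi>. indicator {a<..b} s *\<^sub>R \<xi> \<omega>)"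

definition simple_ito_integral ::
    "(real \<Rightarrow> 'w \<Rightarrow> real^'l) \<Rightarrow> (real \<times> real \<times> ('w \<Rightarrow> real^'l^'p)) list
      \<Rightarrow> real \<Rightarrow> 'w \<Rightarrow> real^'p" where
  "simple_ito_integral B \<phi> t \<omega> =
     (\<Sum>(a, b, \<xi>)\<leftarrow>\<phi>. \<xi> \<omega> *v (B (min b t) \<omega> - B (min a t) \<omega>))"

text \<open>\<open>I\<close> is a version of \<open>\<integral>\<^sub>0\<^sup>t f(s) dB(s)\<close>.\<close>

definition has_ito_integral ::
    "'w measure \<Rightarrow> (real \<Rightarrow> 'w measure) \<Rightarrow> (real \<Rightarrow> 'w \<Rightarrow> real^'l)
      \<Rightarrow> (real \<Rightarrow> 'w \<Rightarrow> real^'l^'p) \<Rightarrow> real \<Rightarrow> ('w \<Rightarrow> real^'p) \<Rightarrow> bool" where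
  "has_ito_integral P \<F> B f t I \<longleftrightarrow>
     I \<in> borel_measurable P \<and>
     (\<exists>\<phi>. (\<forall>k::nat. simple_process P \<F> (\<phi> k)) \<and>
        (\<lambda>k. \<integral>\<^sup>+ s\<in>{0..t}. (\<integral>\<^sup>+ \<omega>. ennreal ((norm (f s \<omega> - simple_value (\<phi> k) s \<omega>))\<^sup>2) \<partial>P)
               \<partial>lborel) \<longlonglongrightarrow> 0 \<and>
        (\<lambda>k. \<integral>\<^sup>+ \<omega>. ennreal ((norm (I \<omega> - simple_ito_integral B (\<phi> k) t \<omega>))\<^sup>2) \<partial>P) \<longlonglongrightarrow> 0)"

definition simple_jump_process ::
    "'w measure \<Rightarrow> (real \<Rightarrow> 'w measure) \<Rightarrow> (real^'p) measure \<Rightarrow> real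
      \<Rightarrow> (real \<times> real \<times> (real^'p) set \<times> ('w \<Rightarrow> real^'p)) list \<Rightarrow> bool" where
  "simple_jump_process P \<F> v c \<phi> \<longleftrightarrow>
     (\<forall>(a, b, A, \<xi>)\<in>set \<phi>. 0 \<le> a \<and> a \<le> b \<and>
        A \<in> sets borel \<and> A \<subseteq> {y. y \<noteq> 0 \<and> norm y < c} \<and> emeasure v A < \<infinity> \<and>
        \<xi> \<in> borel_measurable (\<F> a) \<and> bounded (\<xi> ` space P))"

definition simple_jump_value ::
    "(real \<times> real \<times> (real^'p) set \<times> ('w \<Rightarrow> real^'p)) list
      \<Rightarrow> real \<Rightarrow> 'w \<Rightarrow> real^'p \<Rightarrow> real^'p" where
  "simple_jump_value \<phi> s \<omega> y =
     (\<Sum>(a, b, A, \<xi>)\<leftarrow>\<phi>. (indicator {a<..b} s * indicator A y) *\<^sub>R \<xi> \<omega>)"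

text \<open>The compensated measure of \<open>{a<..b} \<times> A\<close>, for \<open>0 \<le> a \<le> b\<close> and \<open>v A\<close> finite.\<close>

definition compensated ::
    "(real^'p) measure \<Rightarrow> ('w \<Rightarrow> (real \<times> (real^'p)) measure) \<Rightarrow> real \<Rightarrow> real \<Rightarrow> (real^'p) set
      \<Rightarrow> 'w \<Rightarrow> real" where
  "compensated v N a b A \<omega> = measure (N \<omega>) ({a<..b} \<times> A) - (b - a) * measure v A"

definition simple_jump_integral ::
    "(real^'p) measure \<Rightarrow> ('w \<Rightarrow> (real \<times> (real^'p)) measure)
      \<Rightarrow> (real \<times> real \<times> (real^'p) set \<times> ('w \<Rightarrow> real^'p)) list \<Rightarrow> real \<Rightarrow> 'w \<Rightarrow> real^'p" where
  "simple_jump_integral v N \<phi> t \<omega> =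
     (\<Sum>(a, b, A, \<xi>)\<leftarrow>\<phi>. compensated v N (min a t) (min b t) A \<omega> *\<^sub>R \<xi> \<omega>)"

text \<open>
  \<open>J\<close> is a version of the integral of \<open>g(s, y)\<close> over \<open>s \<in> (0, t]\<close>, \<open>norm y < c\<close> with respect to
  the compensated random measure.
\<close>

definition has_jump_integral ::
    "'w measure \<Rightarrow> (real \<Rightarrow> 'w measure) \<Rightarrow> (real^'p) measure
      \<Rightarrow> ('w \<Rightarrow> (real \<times> (real^'p)) measure) \<Rightarrow> real
      \<Rightarrow> (real \<Rightarrow> 'w \<Rightarrow> real^'p \<Rightarrow> real^'p) \<Rightarrow> real \<Rightarrow> ('w \<Rightarrow> real^'p) \<Rightarrow> bool" where
  "has_jump_integral P \<F> v N c g t J \<longleftrightarrow>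
     J \<in> borel_measurable P \<and>
     (\<exists>\<phi>. (\<forall>k::nat. simple_jump_process P \<F> v c (\<phi> k)) \<and>
        (\<lambda>k. \<integral>\<^sup>+ s\<in>{0..t}. (\<integral>\<^sup>+ \<omega>. (\<integral>\<^sup>+ y\<in>{y. norm y < c}.
               ennreal ((norm (g s \<omega> y - simple_jump_value (\<phi> k) s \<omega> y))\<^sup>2) \<partial>v) \<partial>P)
               \<partial>lborel) \<longlonglongrightarrow> 0 \<and>
        (\<lambda>k. \<integral>\<^sup>+ \<omega>. ennreal ((norm (J \<omega> - simple_jump_integral v N (\<phi> k) t \<omega>))\<^sup>2) \<partial>P) \<longlonglongrightarrow> 0)"

text \<open>\<open>\<integral>\<^sub>0\<^sup>t f(s) (ds)\<^sup>\<alpha>\<close>\<close>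

definition fractional_integral :: "real \<Rightarrow> (real \<Rightarrow> real^'p) \<Rightarrow> real \<Rightarrow> real^'p" where
  "fractional_integral \<alpha> f t =
     \<alpha> *\<^sub>R (LINT s:{0..t}|lborel. ((t - s) powr (\<alpha> - 1)) *\<^sub>R f s)"


section \<open>The system \<open>MAS\<close>\<close>

text \<open>
  The unknowns are elements of an \<open>L\<^sup>2\<close> space, so the control has no left limits. The coefficients
  at \<open>(t, x(t-), u(t-))\<close> are therefore taken as elements of the respective \<open>L\<^sup>2\<close> spaces, where
  they coincide with the coefficients at \<open>(t, x(t), u(t))\<close> (a path with left limits has
  \<open>x(t-) = x(t)\<close> for almost all \<open>t\<close>). All four integrals only depend on the integrand up to
  \<open>dt \<otimes> P\<close>-null sets: the two stochastic integrals by construction, since simple integrands are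
  predictable and the extension is by \<open>L\<^sup>2\<close>-continuity.
\<close>

definition mas_solution ::
    "'w measure \<Rightarrow> (real \<Rightarrow> 'w measure) \<Rightarrow> real \<Rightarrow> real \<Rightarrow> real
      \<Rightarrow> (real \<Rightarrow> 'w \<Rightarrow> real^'l) \<Rightarrow> (real^'p) measure \<Rightarrow> ('w \<Rightarrow> (real \<times> (real^'p)) measure)
      \<Rightarrow> ('w \<Rightarrow> real^'p)
      \<Rightarrow> (real \<Rightarrow> real^'p \<Rightarrow> real^'p \<Rightarrow> real^'p)
      \<Rightarrow> (real \<Rightarrow> real^'p \<Rightarrow> real^'p \<Rightarrow> real^'p)
      \<Rightarrow> (real \<Rightarrow> real^'p \<Rightarrow> real^'p \<Rightarrow> real^'l^'p)
      \<Rightarrow> (real \<Rightarrow> real^'p \<Rightarrow> real^'p \<Rightarrow> real^'p \<Rightarrow> real^'p)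
      \<Rightarrow> (real \<Rightarrow> 'w \<Rightarrow> real^'p \<Rightarrow> real^'p \<Rightarrow> real^'p)
      \<Rightarrow> (real^'p) set
      \<Rightarrow> (real \<Rightarrow> 'w \<Rightarrow> real^'p) \<Rightarrow> (real \<Rightarrow> 'w \<Rightarrow> real^'p) \<Rightarrow> bool" where
  "mas_solution P \<F> T \<alpha> c B v N p0 b \<sigma>1 \<sigma> G F K x u \<longleftrightarrow>
     x \<in> L2ad P \<F> T \<and> u \<in> constrained_L2ad P \<F> T K \<and>
     (AE \<omega> in P. x 0 \<omega> = p0 \<omega>) \<and>
     (\<exists>I J. \<forall>t\<in>{0..T}.
        has_ito_integral P \<F> B (\<lambda>s \<omega>. \<sigma> s (x s \<omega>) (u s \<omega>)) t (I t) \<and>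
        has_jump_integral P \<F> v N c (\<lambda>s \<omega> y. G s (x s \<omega>) (u s \<omega>) y) t (J t) \<and>
        (AE \<omega> in P. x t \<omega> =
             p0 \<omega>
           + (LINT s:{0..t}|lborel. b s (x s \<omega>) (u s \<omega>))
           + fractional_integral \<alpha> (\<lambda>s. \<sigma>1 s (x s \<omega>) (u s \<omega>)) t
           + I t \<omega> + J t \<omega>)) \<and>
     (AE t in lborel. t \<in> {0..T} \<longrightarrow>
        (AE \<omega> in P. \<forall>w\<in>K. F t \<omega> (x t \<omega>) (u t \<omega>) \<bullet> (w - u t \<omega>) \<ge> 0))"

definition mas_unique_solution ::
    "'w measure \<Rightarrow> (real \<Rightarrow> 'w measure) \<Rightarrow> real \<Rightarrow> real \<Rightarrow> real
      \<Rightarrow> (real \<Rightarrow> 'w \<Rightarrow> real^'l) \<Rightarrow> (real^'p) measure \<Rightarrow> ('w \<Rightarrow> (real \<times> (real^'p)) measure)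
      \<Rightarrow> ('w \<Rightarrow> real^'p)
      \<Rightarrow> (real \<Rightarrow> real^'p \<Rightarrow> real^'p \<Rightarrow> real^'p)
      \<Rightarrow> (real \<Rightarrow> real^'p \<Rightarrow> real^'p \<Rightarrow> real^'p)
      \<Rightarrow> (real \<Rightarrow> real^'p \<Rightarrow> real^'p \<Rightarrow> real^'l^'p)
      \<Rightarrow> (real \<Rightarrow> real^'p \<Rightarrow> real^'p \<Rightarrow> real^'p \<Rightarrow> real^'p)
      \<Rightarrow> (real \<Rightarrow> 'w \<Rightarrow> real^'p \<Rightarrow> real^'p \<Rightarrow> real^'p)
      \<Rightarrow> (real^'p) set
      \<Rightarrow> (real \<Rightarrow> 'w \<Rightarrow> real^'p) \<Rightarrow> (real \<Rightarrow> 'w \<Rightarrow> real^'p) \<Rightarrow> bool" where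
  "mas_unique_solution P \<F> T \<alpha> c B v N p0 b \<sigma>1 \<sigma> G F K x u \<longleftrightarrow>
     mas_solution P \<F> T \<alpha> c B v N p0 b \<sigma>1 \<sigma> G F K x u \<and>
     (\<forall>x' u'. mas_solution P \<F> T \<alpha> c B v N p0 b \<sigma>1 \<sigma> G F K x' u' \<longrightarrow>
        (AE t in lborel. t \<in> {0..T} \<longrightarrow>
           (AE \<omega> in P. x' t \<omega> = x t \<omega> \<and> u' t \<omega> = u t \<omega>)))"


section \<open>Mosco convergence\<close>

definition weakly_converges :: "(nat \<Rightarrow> 'a::real_inner) \<Rightarrow> 'a \<Rightarrow> bool" where
  "weakly_converges z z0 \<longleftrightarrow> (\<forall>w. (\<lambda>i. z i \<bullet> w) \<longlonglongrightarrow> z0 \<bullet> w)"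

text \<open>Meant for closed convex subsets.\<close>

definition mosco_converges ::
    "(nat \<Rightarrow> 'a::{real_inner, complete_space} set) \<Rightarrow> 'a set \<Rightarrow> bool" where
  "mosco_converges C C0 \<longleftrightarrow>
     (\<forall>z0\<in>C0. \<exists>z. (\<forall>n. z n \<in> C n) \<and> z \<longlonglongrightarrow> z0) \<and>
     (\<forall>r z z0. strict_mono r \<and> (\<forall>i. z i \<in> C (r i)) \<and> weakly_converges z z0 \<longrightarrow> z0 \<in> C0)"

end

theory Submission
  imports Defs
begin

text \<open>
  With \<open>\<rho> = C_bar / L_F\<^sup>2\<close>, a control solving the variational inequality is a fixed point
  \<open>u = closest_point K (u - \<rho> F(x, u))\<close> of a strict contraction. Comparing two such fixed points
  only requires the projections onto \<open>K_\<mu>\<^sub>n\<close> and \<open>K_\<mu>\<close> of the fixed process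
  \<open>z = u - \<rho> F(x, u)\<close>; Mosco convergence makes them converge pointwise, and
  \<open>0 \<in> K\<close> gives the domination \<open>norm (closest_point K z) \<le> norm z\<close>, so no weak compactness is
  needed. Hence the distance of the controls on \<open>[0, t]\<close> is controlled by that of the states on
  \<open>[0, t]\<close> up to an error tending to \<open>0\<close>. Since \<open>\<alpha> > 1/2\<close>, the kernel of the fractional integral
  is square integrable, so all four integrals in the state equation are bounded in mean square by the
  \<open>L\<^sup>2\<close> distance of the integrands on \<open>[0, t]\<close>, and Gronwall's inequality concludes. Only the Lipschitz
  constants at the limit parameter enter.
\<close>

section \<open>Isometry for orthogonal increments\<close>

text \<open>Two obstacles shape the development. The conditions on \<open>F\<close> are inequalities
  of norms over the whole of [0, T], whereas Gronwall needs the control estimate on [0, t] for every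
  t; letting a process agree with the limit process after time t makes the difference vanish there
  and so localises them. The stochastic integrals are given only as limits along some approximating
  sequence, so differences of integrals are estimated through the approximants; this rests on one
  isometry for scalar orthogonal increments, which serves the coordinates of \<open>B\<close> and
  the compensated jump measure alike.

  The value of \<rho> minimises 1 - 2 \<rho> C_bar + \<rho>^2 L_F^2, and L_F > C_bar keeps the
  minimum 1 - C_bar^2 / L_F^2 strictly between 0 and 1. Since z is built from the limit solution,
  the projection error depends on n alone, while the coefficient error depends on m alone; this
  separation lets m and n tend to infinity independently. Estimates live in \<open>ennreal\<close>,
  except where a term is absorbed into the left-hand side, which requires finiteness.\<close>

lemma (in prob_space) indep_set_mult_integral:
  fixes X Y :: "'a \<Rightarrow> real"
  assumes F: "subalgebra M F" and indep: "indep_set (sets F) G"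
    and X: "X \<in> borel_measurable F" "integrable M X"
    and Y: "integrable M Y" "sigma_sets (space M) {Y -` S \<inter> space M | S. S \<in> sets borel} \<subseteq> G"
  shows "has_bochner_integral M (\<lambda>w. X w * Y w) (expectation X * expectation Y)"
proof -
  have "{X -` S \<inter> space M | S. S \<in> sets borel} \<subseteq> sets F"
    using measurable_sets[OF X(1)] F by (auto simp: subalgebra_def)
  then have "sigma_sets (space M) {X -` S \<inter> space M | S. S \<in> sets borel} \<subseteq> sets F"
    using F sets.sigma_sets_subset[of _ F] by (simp add: subalgebra_def)
  then have "indep_set (sigma_sets (space M) {X -` S \<inter> space M | S. S \<in> sets borel})
      (sigma_sets (space M) {Y -` S \<inter> space M | S. S \<in> sets borel})"
    using indep Y(2) unfolding indep_sets2_eq by blast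
  then have "indep_var borel X borel Y"
    unfolding indep_var_eq using X Y by auto
  then show ?thesis
    using indep_var_integrable[OF _ X(2) Y(1)] indep_var_lebesgue_integral[OF _ X(2) Y(1)]
    by (simp add: has_bochner_integral_iff)
qed

text \<open>Shared by one coordinate of a Brownian motion and by the compensated Poisson measure.
  \<open>D_zero\<close> asks for integrable rather than bounded past factors because it is applied
  to a bounded variable times an earlier increment. \<open>D_add\<close> holds only almost surely:
  \<open>measure\<close> of a set of infinite mass is \<open>0\<close>, so additivity of the jump
  counts can fail on a null set. \<open>D_sq\<close> takes two mark sets so that blocks with
  overlapping mark sets can be multiplied.\<close>

locale orthogonal_increments = prob_space P for P :: "'w measure" +
  fixes F :: "real \<Rightarrow> 'w measure" and V :: "'y measure" and \<A> :: "'y set set"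
    and D :: "real \<Rightarrow> real \<Rightarrow> 'y set \<Rightarrow> 'w \<Rightarrow> real"
  assumes subalgebra_F: "0 \<le> t \<Longrightarrow> subalgebra P (F t)"
    and F_mono: "0 \<le> s \<Longrightarrow> s \<le> t \<Longrightarrow> sets (F s) \<subseteq> sets (F t)"
    and D_meas: "0 \<le> a \<Longrightarrow> a \<le> b \<Longrightarrow> A \<in> \<A> \<Longrightarrow> D a b A \<in> borel_measurable (F b)"
    and \<A>_sets: "A \<in> \<A> \<Longrightarrow> A \<in> sets V" and \<A>_finite: "A \<in> \<A> \<Longrightarrow> emeasure V A < \<infinity>"
    and D_add: "0 \<le> a \<Longrightarrow> a \<le> b \<Longrightarrow> b \<le> e \<Longrightarrow> A \<in> \<A> \<Longrightarrow>
      AE w in P. D a e A w = D a b A w + D b e A w"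
    and D_zero: "0 \<le> a \<Longrightarrow> a \<le> b \<Longrightarrow> A \<in> \<A> \<Longrightarrow> X \<in> borel_measurable (F a) \<Longrightarrow>
      integrable P X \<Longrightarrow> has_bochner_integral P (\<lambda>w. X w * D a b A w) 0"
    and D_sq: "0 \<le> a \<Longrightarrow> a \<le> b \<Longrightarrow> A \<in> \<A> \<Longrightarrow> A' \<in> \<A> \<Longrightarrow> X \<in> borel_measurable (F a) \<Longrightarrow>
      integrable P X \<Longrightarrow> has_bochner_integral P (\<lambda>w. X w * (D a b A w * D a b A' w))
        (expectation X * ((b - a) * measure V (A \<inter> A')))"
begin

lemma measurable_F: "0 \<le> t \<Longrightarrow> X \<in> borel_measurable (F t) \<Longrightarrow> X \<in> borel_measurable P"
  using measurable_from_subalg[OF subalgebra_F] .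

lemma measurable_F_mono:
  assumes "0 \<le> s" "s \<le> t" "X \<in> borel_measurable (F s)"
  shows "X \<in> borel_measurable (F t)"
proof -
  have "subalgebra (F t) (F s)"
    using F_mono[OF assms(1,2)] subalgebra_F[of s] subalgebra_F[of t] assms by (auto simp: subalgebra_def)
  then show ?thesis using measurable_from_subalg assms(3) by blast
qed

lemma bounded_integrable:
  fixes X :: "'w \<Rightarrow> real"
  assumes "X \<in> borel_measurable P" "bounded (X ` space P)"
  shows "integrable P X"
proof -
  obtain B where "\<And>w. w \<in> space P \<Longrightarrow> norm (X w) \<le> B"
    using assms(2) by (auto simp: bounded_iff)
  then show ?thesis
    by (intro integrable_const_bound[of X B]) (use assms in auto)
qed

lemma D_refl: "0 \<le> a \<Longrightarrow> A \<in> \<A> \<Longrightarrow> AE w in P. D a a A w = 0"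
  using D_add[of a a a A] by auto

lemma D_integrable: "0 \<le> a \<Longrightarrow> a \<le> b \<Longrightarrow> A \<in> \<A> \<Longrightarrow> integrable P (D a b A)"
proof -
  assume "0 \<le> a" "a \<le> b" "A \<in> \<A>"
  then have "has_bochner_integral P (\<lambda>w. 1 * D a b A w) 0"
  proof (rule D_zero)
    show "(\<lambda>w. 1) \<in> borel_measurable (F a)" by (rule borel_measurable_const)
    show "integrable P (\<lambda>w. 1 :: real)" by (rule integrable_const)
  qed
  then show ?thesis by (auto simp only: has_bochner_integral_iff mult_1)
qed

lemma bounded_mult:
  fixes X Y :: "'w \<Rightarrow> real"
  assumes "bounded (X ` space P)" "bounded (Y ` space P)"
  shows "bounded ((\<lambda>w. X w * Y w) ` space P)"
proof -
  obtain B C where "\<And>w. w \<in> space P \<Longrightarrow> \<bar>X w\<bar> \<le> B" "\<And>w. w \<in> space P \<Longrightarrow> \<bar>Y w\<bar> \<le> C"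
    using assms by (auto simp: bounded_iff)
  then show ?thesis
    by (intro boundedI[of _ "B * C"]) (auto simp: abs_mult intro!: mult_mono' )
qed

lemma integrable_bounded_mult:
  fixes X Y :: "'w \<Rightarrow> real"
  assumes "X \<in> borel_measurable P" "bounded (X ` space P)" "integrable P Y"
  shows "integrable P (\<lambda>w. X w * Y w)"
proof -
  obtain B where B: "\<And>w. w \<in> space P \<Longrightarrow> \<bar>X w\<bar> \<le> B"
    using assms by (auto simp: bounded_iff)
  have [measurable]: "Y \<in> borel_measurable P" "X \<in> borel_measurable P" using assms by auto
  show ?thesis
  proof (rule Bochner_Integration.integrable_bound)
    show "integrable P (\<lambda>w. B * Y w)" using assms by simp
    show "AE w in P. norm (X w * Y w) \<le> norm (B * Y w)"
      using B by (auto simp: abs_mult intro!: mult_right_mono order_trans[OF B abs_ge_self])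
  qed auto
qed

text \<open>The earlier increment is known at time \<open>a'\<close>, so it joins
  \<open>\<zeta>\<close> as the past factor in \<open>D_zero\<close>.\<close>

lemma D_disjoint:
  assumes "0 \<le> a" "a \<le> b" "b \<le> a'" "a' \<le> b'" and A: "A \<in> \<A>" "A' \<in> \<A>"
    and \<zeta>: "\<zeta> \<in> borel_measurable (F a')" "bounded (\<zeta> ` space P)"
  shows "has_bochner_integral P (\<lambda>w. \<zeta> w * (D a b A w * D a' b' A' w)) 0"
proof -
  have [measurable]: "D a b A \<in> borel_measurable (F a')"
    using assms D_meas[of a b A] measurable_F_mono[of b a'] by auto
  have "has_bochner_integral P (\<lambda>w. (\<zeta> w * D a b A w) * D a' b' A' w) 0"
  proof (rule D_zero)
    show "integrable P (\<lambda>w. \<zeta> w * D a b A w)"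
    proof (rule integrable_bounded_mult)
      show "\<zeta> \<in> borel_measurable P" using measurable_F[of a' \<zeta>] assms by simp
      show "integrable P (D a b A)" using D_integrable assms by simp
    qed fact
  qed (use assms in simp_all)
  then show ?thesis by (simp add: mult.assoc)
qed

text \<open>Both intervals are cut at \<open>a'\<close> and at the smaller right endpoint. Only the
  common piece pairs an interval with itself; every other product is over disjoint intervals and has
  mean zero.\<close>

lemma D_pair:
  assumes "0 \<le> a" "a \<le> a'" "a \<le> b" "a' \<le> b'" and A: "A \<in> \<A>" "A' \<in> \<A>"
    and \<zeta>: "\<zeta> \<in> borel_measurable (F a')" "bounded (\<zeta> ` space P)"
  shows "has_bochner_integral P (\<lambda>w. \<zeta> w * (D a b A w * D a' b' A' w))
    (expectation \<zeta> * (max 0 (min b b' - a') * measure V (A \<inter> A')))"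
proof (cases "b \<le> a'")
  case True
  then show ?thesis using D_disjoint[OF assms(1,3) True assms(4-)] by simp
next
  case False
  then have "a' \<le> b" by simp
  have i\<zeta>: "integrable P \<zeta>" using assms measurable_F[of a'] by (intro bounded_integrable) auto
  have m[measurable]: "\<zeta> \<in> borel_measurable P" using \<zeta> assms measurable_F[of a'] by auto
  have mD[measurable]: "D s t C \<in> borel_measurable P" if "0 \<le> s" "s \<le> t" "C \<in> \<A>" for s t C
    using D_meas[OF that] measurable_F[of t] that by auto
  have 1: "has_bochner_integral P (\<lambda>w. \<zeta> w * (D a a' A w * D a' b' A' w)) 0"
    using assms by (intro D_disjoint) auto
  define e where "e = min b b'"
  have e: "a' \<le> e" "e \<le> b" "e \<le> b'" using \<open>a' \<le> b\<close> assms by (auto simp: e_def)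
  have 2: "has_bochner_integral P (\<lambda>w. \<zeta> w * (D a' e A w * D a' e A' w))
      (expectation \<zeta> * ((e - a') * measure V (A \<inter> A')))"
    using assms e i\<zeta> by (intro D_sq) auto
  have \<zeta>e: "\<zeta> \<in> borel_measurable (F e)" using \<zeta>(1) e assms by (intro measurable_F_mono[of a' e]) auto
  have 3: "has_bochner_integral P (\<lambda>w. \<zeta> w * (D a' e A w * D e b' A' w)) 0"
    using assms e \<zeta>e by (intro D_disjoint) auto
  have 4: "has_bochner_integral P (\<lambda>w. \<zeta> w * (D a' e A' w * D e b A w)) 0"
    using assms e \<zeta>e by (intro D_disjoint) auto
  \<comment> \<open>One of the last two products vanishes almost surely, since \<open>e\<close> is
    \<open>b\<close> or \<open>b'\<close> and an increment over an empty interval is null; keeping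
    both lets the two cases share this sum.\<close>
  have sum: "has_bochner_integral P
     (\<lambda>w. \<zeta> w * (D a a' A w * D a' b' A' w) + (\<zeta> w * (D a' e A w * D a' e A' w) +
        (\<zeta> w * (D a' e A w * D e b' A' w) + \<zeta> w * (D a' e A' w * D e b A w))))
     (0 + (expectation \<zeta> * ((e - a') * measure V (A \<inter> A')) + (0 + 0)))"
    by (intro has_bochner_integral_add 1 2 3 4)
  have ae: "AE w in P. \<zeta> w * (D a a' A w * D a' b' A' w) + (\<zeta> w * (D a' e A w * D a' e A' w) +
        (\<zeta> w * (D a' e A w * D e b' A' w) + \<zeta> w * (D a' e A' w * D e b A w))) =
     \<zeta> w * (D a b A w * D a' b' A' w)"
  proof (cases "b \<le> b'")
    case True
    then have "e = b" by (simp add: e_def)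
    have "AE w in P. D b b A w = 0" using assms by (intro D_refl) auto
    moreover have "AE w in P. D a b A w = D a a' A w + D a' b A w"
      using assms \<open>a' \<le> b\<close> by (intro D_add) auto
    moreover have "AE w in P. D a' b' A' w = D a' b A' w + D b b' A' w"
      using assms \<open>a' \<le> b\<close> True by (intro D_add) auto
    ultimately show ?thesis
      by eventually_elim (simp add: \<open>e = b\<close> algebra_simps)
  next
    case False
    then have "e = b'" by (simp add: e_def)
    have "AE w in P. D b' b' A' w = 0" using assms by (intro D_refl) auto
    moreover have "AE w in P. D a b A w = D a a' A w + D a' b A w"
      using assms \<open>a' \<le> b\<close> by (intro D_add) auto
    moreover have "AE w in P. D a' b A w = D a' b' A w + D b' b A w"
      using assms \<open>a' \<le> b\<close> False by (intro D_add) auto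
    ultimately show ?thesis
      by eventually_elim (simp add: \<open>e = b'\<close> algebra_simps)
  qed
  have "max 0 (min b b' - a') = e - a'" using e by (simp add: e_def)
  moreover have "has_bochner_integral P (\<lambda>w. \<zeta> w * (D a b A w * D a' b' A' w))
     (0 + (expectation \<zeta> * ((e - a') * measure V (A \<inter> A')) + (0 + 0)))"
    using sum assms e \<open>a' \<le> b\<close>
    by (subst (asm) has_bochner_integral_cong_AE[OF _ _ ae])
       (auto intro!: borel_measurable_times borel_measurable_add mD m)
  ultimately show ?thesis by simp
qed

text \<open>The inner product in L^2[0, t] of the indicators of two time intervals. The integral
  form arises from expanding the right-hand side of the isometry, the closed form below from the
  increments.\<close>

definition overlap :: "real \<Rightarrow> real \<Rightarrow> real \<Rightarrow> real \<Rightarrow> real \<Rightarrow> real" where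
  "overlap t a b a' b' = (LINT s:{0..t}|lborel. indicator {a<..b} s * indicator {a'<..b'} s)"

lemma overlap_eq:
  assumes "0 \<le> a" "0 \<le> a'"
  shows "overlap t a b a' b' = max 0 (min (min b b') t - max a a')"
proof -
  have "overlap t a b a' b' = (LINT s|lborel. indicator {max a a'<..min (min b b') t} s)"
    unfolding overlap_def set_lebesgue_integral_def using assms
    by (intro Bochner_Integration.integral_cong) (auto split: split_indicator)
  then show ?thesis by (auto simp: max_def)
qed

text \<open>\<open>D_pair\<close> needs the product of the weights to be known when the later block
  starts, so the cases are split by which block that is. If a block starts at or after
  \<open>t\<close>, its truncated interval is empty and both sides vanish.\<close>

lemma D_pair_truncated:
  assumes "0 \<le> a" "a \<le> b" "0 \<le> a'" "a' \<le> b'" "0 \<le> t" and A: "A \<in> \<A>" "A' \<in> \<A>"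
    and \<xi>: "\<xi> \<in> borel_measurable (F a)" "bounded (\<xi> ` space P)"
    and \<xi>': "\<xi>' \<in> borel_measurable (F a')" "bounded (\<xi>' ` space P)"
  shows "has_bochner_integral P (\<lambda>w. (\<xi> w * D (min a t) (min b t) A w) *
      (\<xi>' w * D (min a' t) (min b' t) A' w))
    (expectation (\<lambda>w. \<xi> w * \<xi>' w) * (overlap t a b a' b' * measure V (A \<inter> A')))"
    (is "has_bochner_integral P ?f ?v")
proof -
  have bd: "bounded ((\<lambda>w. \<xi> w * \<xi>' w) ` space P)" using bounded_mult \<xi> \<xi>' by blast
  have [measurable]: "\<xi> \<in> borel_measurable P" "\<xi>' \<in> borel_measurable P"
    using \<xi> \<xi>' assms measurable_F[of a] measurable_F[of a'] by auto
  have mD[measurable]: "D s t C \<in> borel_measurable P" if "0 \<le> s" "s \<le> t" "C \<in> \<A>" for s t C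
    using D_meas[OF that] measurable_F[of t] that by auto
  have eq: "?f = (\<lambda>w. (\<xi> w * \<xi>' w) * (D (min a t) (min b t) A w * D (min a' t) (min b' t) A' w))"
    by (simp add: fun_eq_iff mult_ac)
  consider "max a a' \<ge> t" | "max a a' < t" "a \<le> a'" | "max a a' < t" "a' \<le> a" by linarith
  then show ?thesis
  proof cases
    case 1
    have "overlap t a b a' b' = 0" using 1 assms by (simp add: overlap_eq)
    moreover have "AE w in P. ?f w = 0"
    proof (cases "a \<ge> t")
      case True
      have "AE w in P. D t t A w = 0" using assms by (intro D_refl)
      then show ?thesis
      proof eventually_elim
        case (elim w)
        have "min a t = t" "min b t = t" using True assms by auto
        with elim show ?case by simp
      qed
    next
      case False
      then have "a' \<ge> t" using 1 by auto
      have "AE w in P. D t t A' w = 0" using assms by (intro D_refl)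
      then show ?thesis
      proof eventually_elim
        case (elim w)
        have "min a' t = t" "min b' t = t" using \<open>a' \<ge> t\<close> assms by auto
        with elim show ?case by simp
      qed
    qed
    then have "has_bochner_integral P ?f 0"
      by (subst has_bochner_integral_cong_AE[where g="\<lambda>_. 0"])
         (use assms in \<open>auto intro!: borel_measurable_times mD has_bochner_integral_zero\<close>)
    ultimately show ?thesis by simp
  next
    case 2
    have "\<xi> \<in> borel_measurable (F a')" using \<xi> assms 2 by (intro measurable_F_mono[of a a']) auto
    with \<xi>' have "(\<lambda>w. \<xi> w * \<xi>' w) \<in> borel_measurable (F (min a' t))" using 2 by (simp add: min_def)
    then have "has_bochner_integral P ?f (expectation (\<lambda>w. \<xi> w * \<xi>' w) *
        (max 0 (min (min b t) (min b' t) - min a' t) * measure V (A \<inter> A')))"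
      unfolding eq using 2 assms bd by (intro D_pair) auto
    moreover have "max 0 (min (min b t) (min b' t) - min a' t) = overlap t a b a' b'"
      using 2 assms by (auto simp: overlap_eq min.assoc min.left_commute)
    ultimately show ?thesis by simp
  next
    case 3
    have "\<xi>' \<in> borel_measurable (F a)" using \<xi>' assms 3 by (intro measurable_F_mono[of a' a]) auto
    with \<xi> have "(\<lambda>w. \<xi> w * \<xi>' w) \<in> borel_measurable (F (min a t))" using 3 by (simp add: min_def)
    then have "has_bochner_integral P
        (\<lambda>w. (\<xi> w * \<xi>' w) * (D (min a' t) (min b' t) A' w * D (min a t) (min b t) A w))
        (expectation (\<lambda>w. \<xi> w * \<xi>' w) *
        (max 0 (min (min b' t) (min b t) - min a t) * measure V (A' \<inter> A)))"
      using 3 assms bd by (intro D_pair) auto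
    moreover have "max 0 (min (min b' t) (min b t) - min a t) = overlap t a b a' b'"
      using 3 assms by (auto simp: overlap_eq min.assoc min.left_commute min.commute)
    ultimately show ?thesis unfolding eq by (simp add: Int_commute mult_ac)
  qed
qed

text \<open>Expanding the square bilinearly avoids passing to a common refinement of overlapping blocks.\<close>

lemma isometry:
  fixes a b :: "nat \<Rightarrow> real" and A :: "nat \<Rightarrow> 'y set" and \<xi> :: "nat \<Rightarrow> 'w \<Rightarrow> real"
  assumes t: "0 \<le> t"
    and ab: "\<And>k. k < n \<Longrightarrow> 0 \<le> a k" "\<And>k. k < n \<Longrightarrow> a k \<le> b k" and A: "\<And>k. k < n \<Longrightarrow> A k \<in> \<A>"
    and \<xi>: "\<And>k. k < n \<Longrightarrow> \<xi> k \<in> borel_measurable (F (a k))" "\<And>k. k < n \<Longrightarrow> bounded (\<xi> k ` space P)"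
  shows "(\<integral>\<^sup>+w. ennreal ((\<Sum>k<n. \<xi> k w * D (min (a k) t) (min (b k) t) (A k) w)\<^sup>2) \<partial>P) =
    (\<integral>\<^sup>+s\<in>{0..t}. (\<integral>\<^sup>+w. (\<integral>\<^sup>+y.
      ennreal ((\<Sum>k<n. indicator {a k<..b k} s * indicator (A k) y * \<xi> k w)\<^sup>2) \<partial>V) \<partial>P) \<partial>lborel)"
proof -
  define q where "q j k = measure V (A j \<inter> A k)" for j k
  define o' where "o' j k s = (indicator {a j<..b j} s * indicator {a k<..b k} s :: real)" for j k s
  have m: "\<xi> k \<in> borel_measurable P" if "k < n" for k
    using \<xi>(1)[OF that] ab(1)[OF that] measurable_F by auto
  have bi: "integrable P (\<lambda>w. \<xi> j w * \<xi> k w)" if "j < n" "k < n" for j k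
    using m[OF that(1)] m[OF that(2)] \<xi>(2)[OF that(1)] \<xi>(2)[OF that(2)]
    by (intro bounded_integrable bounded_mult borel_measurable_times)
  have sq: "(\<Sum>k<n. x k)\<^sup>2 = (\<Sum>j<n. \<Sum>k<n. x j * x k)" for x :: "nat \<Rightarrow> real"
    by (simp add: power2_eq_square sum_product)
  have lhs: "has_bochner_integral P (\<lambda>w. (\<Sum>k<n. \<xi> k w * D (min (a k) t) (min (b k) t) (A k) w)\<^sup>2)
    (\<Sum>j<n. \<Sum>k<n. expectation (\<lambda>w. \<xi> j w * \<xi> k w) * (overlap t (a j) (b j) (a k) (b k) * q j k))"
    unfolding sq q_def using assms
    by (intro has_bochner_integral_sum D_pair_truncated) auto
  \<comment> \<open>Single summands of these quadratic forms can be negative, so the sums are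
    evaluated as Bochner integrals. Each total is the integral of a nonnegative function, which
    allows the return to \<open>ennreal\<close> at each of the three integrations.\<close>
  have inner: "(\<integral>\<^sup>+y. ennreal ((\<Sum>k<n. indicator {a k<..b k} s * indicator (A k) y * \<xi> k w)\<^sup>2) \<partial>V) =
      ennreal (\<Sum>j<n. \<Sum>k<n. o' j k s * (\<xi> j w * \<xi> k w) * q j k)"
   and inner0: "0 \<le> (\<Sum>j<n. \<Sum>k<n. o' j k s * (\<xi> j w * \<xi> k w) * q j k)" for s w
  proof -
    have fin: "integrable V (\<lambda>y. indicator (A j) y * indicator (A k) y :: real)"
      and fin': "(LINT y|V. indicator (A j) y * indicator (A k) y :: real) = q j k" if "j < n" "k < n" for j k
    proof -
      have "A j \<inter> A k \<in> sets V" using \<A>_sets A that by blast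
      moreover have "emeasure V (A j \<inter> A k) \<le> emeasure V (A j)"
        using \<A>_sets A that by (intro emeasure_mono) auto
      then have "emeasure V (A j \<inter> A k) < \<infinity>" using \<A>_finite[OF A[OF that(1)]] by (rule le_less_trans)
      moreover have "A j \<inter> A k \<inter> space V = A j \<inter> A k"
        using sets.sets_into_space[OF \<open>A j \<inter> A k \<in> sets V\<close>] by (rule Int_absorb2)
      ultimately show "integrable V (\<lambda>y. indicator (A j) y * indicator (A k) y :: real)"
        "(LINT y|V. indicator (A j) y * indicator (A k) y :: real) = q j k"
        unfolding q_def indicator_inter_arith[symmetric]
        by (simp_all only: Bochner_Integration.integral_indicator integrable_real_indicator)
    qed
    have "has_bochner_integral V (\<lambda>y. \<Sum>j<n. \<Sum>k<n. (o' j k s * (\<xi> j w * \<xi> k w)) * (indicator (A j) y * indicator (A k) y))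
      (\<Sum>j<n. \<Sum>k<n. (o' j k s * (\<xi> j w * \<xi> k w)) * q j k)"
      using fin fin' by (intro has_bochner_integral_sum has_bochner_integral_mult_right)
        (auto simp: has_bochner_integral_iff)
    moreover have "(\<lambda>y. \<Sum>j<n. \<Sum>k<n. (o' j k s * (\<xi> j w * \<xi> k w)) * (indicator (A j) y * indicator (A k) y)) =
       (\<lambda>y. (\<Sum>k<n. indicator {a k<..b k} s * indicator (A k) y * \<xi> k w)\<^sup>2)"
      unfolding sq o'_def by (intro ext sum.cong) (auto simp: mult_ac)
    ultimately have *: "has_bochner_integral V (\<lambda>y. (\<Sum>k<n. indicator {a k<..b k} s * indicator (A k) y * \<xi> k w)\<^sup>2)
      (\<Sum>j<n. \<Sum>k<n. (o' j k s * (\<xi> j w * \<xi> k w)) * q j k)" by simp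
    show "(\<integral>\<^sup>+y. ennreal ((\<Sum>k<n. indicator {a k<..b k} s * indicator (A k) y * \<xi> k w)\<^sup>2) \<partial>V) =
      ennreal (\<Sum>j<n. \<Sum>k<n. o' j k s * (\<xi> j w * \<xi> k w) * q j k)"
      using * by (subst nn_integral_eq_integral) (auto simp: has_bochner_integral_iff)
    show "0 \<le> (\<Sum>j<n. \<Sum>k<n. o' j k s * (\<xi> j w * \<xi> k w) * q j k)"
      using * Bochner_Integration.integral_nonneg[of V "\<lambda>y. (\<Sum>k<n. indicator {a k<..b k} s * indicator (A k) y * \<xi> k w)\<^sup>2"]
      by (auto simp: has_bochner_integral_iff)
  qed
  have mid: "(\<integral>\<^sup>+w. ennreal (\<Sum>j<n. \<Sum>k<n. o' j k s * (\<xi> j w * \<xi> k w) * q j k) \<partial>P) =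
      ennreal (\<Sum>j<n. \<Sum>k<n. o' j k s * expectation (\<lambda>w. \<xi> j w * \<xi> k w) * q j k)"
   and mid0: "0 \<le> (\<Sum>j<n. \<Sum>k<n. o' j k s * expectation (\<lambda>w. \<xi> j w * \<xi> k w) * q j k)" for s
  proof -
    have *: "has_bochner_integral P (\<lambda>w. \<Sum>j<n. \<Sum>k<n. o' j k s * (\<xi> j w * \<xi> k w) * q j k)
      (\<Sum>j<n. \<Sum>k<n. o' j k s * expectation (\<lambda>w. \<xi> j w * \<xi> k w) * q j k)"
      using bi by (intro has_bochner_integral_sum has_bochner_integral_mult_right has_bochner_integral_mult_left)
        (auto simp: has_bochner_integral_iff)
    show "(\<integral>\<^sup>+w. ennreal (\<Sum>j<n. \<Sum>k<n. o' j k s * (\<xi> j w * \<xi> k w) * q j k) \<partial>P) =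
      ennreal (\<Sum>j<n. \<Sum>k<n. o' j k s * expectation (\<lambda>w. \<xi> j w * \<xi> k w) * q j k)"
      using * inner0 by (subst nn_integral_eq_integral) (auto simp: has_bochner_integral_iff)
    show "0 \<le> (\<Sum>j<n. \<Sum>k<n. o' j k s * expectation (\<lambda>w. \<xi> j w * \<xi> k w) * q j k)"
      using * inner0 Bochner_Integration.integral_nonneg[of P "\<lambda>w. \<Sum>j<n. \<Sum>k<n. o' j k s * (\<xi> j w * \<xi> k w) * q j k"]
      by (auto simp: has_bochner_integral_iff)
  qed
  have "(\<integral>\<^sup>+s\<in>{0..t}. (\<integral>\<^sup>+w. (\<integral>\<^sup>+y.
      ennreal ((\<Sum>k<n. indicator {a k<..b k} s * indicator (A k) y * \<xi> k w)\<^sup>2) \<partial>V) \<partial>P) \<partial>lborel) =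
    (\<integral>\<^sup>+s. ennreal (indicator {0..t} s * (\<Sum>j<n. \<Sum>k<n. o' j k s * expectation (\<lambda>w. \<xi> j w * \<xi> k w) * q j k)) \<partial>lborel)"
    unfolding inner mid by (intro nn_integral_cong) (auto split: split_indicator)
  also have "\<dots> = ennreal (\<Sum>j<n. \<Sum>k<n. expectation (\<lambda>w. \<xi> j w * \<xi> k w) * (overlap t (a j) (b j) (a k) (b k) * q j k))"
  proof -
    have "has_bochner_integral lborel (\<lambda>s. indicator {0..t} s * o' j k s) (overlap t (a j) (b j) (a k) (b k))" for j k
    proof -
      have "integrable lborel (\<lambda>s. indicator ({0..t} \<inter> {a j<..b j} \<inter> {a k<..b k}) s :: real)"
        using emeasure_mono[of "{0..t} \<inter> {a j<..b j} \<inter> {a k<..b k}" "{0..t}" lborel] t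
        by (intro integrable_real_indicator) (auto intro: le_less_trans[OF _ ennreal_less_top[of t]])
      moreover have "indicator ({0..t} \<inter> {a j<..b j} \<inter> {a k<..b k}) s = indicator {0..t} s * o' j k s" for s :: real
        by (auto simp: o'_def split: split_indicator)
      ultimately show ?thesis
        unfolding overlap_def set_lebesgue_integral_def has_bochner_integral_iff
        by (auto simp: o'_def mult.assoc)
    qed
    then have "has_bochner_integral lborel (\<lambda>s. \<Sum>j<n. \<Sum>k<n. expectation (\<lambda>w. \<xi> j w * \<xi> k w) * ((indicator {0..t} s * o' j k s) * q j k))
      (\<Sum>j<n. \<Sum>k<n. expectation (\<lambda>w. \<xi> j w * \<xi> k w) * (overlap t (a j) (b j) (a k) (b k) * q j k))"
      by (intro has_bochner_integral_sum has_bochner_integral_mult_right has_bochner_integral_mult_left)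
    moreover have "(\<lambda>s. \<Sum>j<n. \<Sum>k<n. expectation (\<lambda>w. \<xi> j w * \<xi> k w) * ((indicator {0..t} s * o' j k s) * q j k)) =
      (\<lambda>s. indicator {0..t} s * (\<Sum>j<n. \<Sum>k<n. o' j k s * expectation (\<lambda>w. \<xi> j w * \<xi> k w) * q j k))"
      by (simp add: sum_distrib_left mult_ac)
    ultimately show ?thesis
      using mid0 by (subst nn_integral_eq_integral) (auto simp: has_bochner_integral_iff)
  qed
  also have "\<dots> = (\<integral>\<^sup>+w. ennreal ((\<Sum>k<n. \<xi> k w * D (min (a k) t) (min (b k) t) (A k) w)\<^sup>2) \<partial>P)"
    using lhs by (subst nn_integral_eq_integral) (auto simp: has_bochner_integral_iff)
  finally show ?thesis ..
qed

end

section \<open>Brownian motion and the compensated Poisson measure\<close>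

lemma complete_filtered_prob_spaceD:
  assumes "complete_filtered_prob_space P \<F>"
  shows "prob_space P" "0 \<le> t \<Longrightarrow> subalgebra P (\<F> t)"
    "0 \<le> s \<Longrightarrow> s \<le> t \<Longrightarrow> sets (\<F> s) \<subseteq> sets (\<F> t)"
proof -
  have fl: "filtration (space P) (\<lambda>t. \<F> (max 0 t))"
    using assms by (simp add: complete_filtered_prob_space_def)
  show "prob_space P" "0 \<le> t \<Longrightarrow> subalgebra P (\<F> t)"
    using assms by (auto simp: complete_filtered_prob_space_def)
  show "sets (\<F> s) \<subseteq> sets (\<F> t)" if "0 \<le> s" "s \<le> t"
    using filtration.sets_F_mono[OF fl that(2)] that by (simp add: max_def)
qed

lemma borel_measurable_component [measurable (raw)]:
  fixes f :: "'a \<Rightarrow> 'b::euclidean_space ^ 'n"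
  assumes "f \<in> borel_measurable M"
  shows "(\<lambda>x. f x $ i) \<in> borel_measurable M"
proof -
  have "(\<lambda>x :: 'b ^ 'n. x $ i) \<in> borel_measurable borel"
    by (intro borel_measurable_continuous_onI continuous_intros)
  then show ?thesis by (rule measurable_compose[OF assms])
qed

lemma (in prob_space) normal_moments:
  assumes "0 < s" "distributed M lborel Y (normal_density 0 s)"
  shows "has_bochner_integral M Y 0" "has_bochner_integral M (\<lambda>w. (Y w)\<^sup>2) (s\<^sup>2)"
proof -
  have 1: "integrable M Y"
    using distributed_integrable[OF assms(2), of "\<lambda>x. x"] integrable_normal_moment_nz_1[OF assms(1), of 0] by simp
  then show "has_bochner_integral M Y 0"
    using normal_distributed_expectation[OF assms] by (simp add: has_bochner_integral_iff)
  have "integrable M (\<lambda>w. (Y w)\<^sup>2)"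
    using distributed_integrable[OF assms(2), of "\<lambda>x. x\<^sup>2"] integrable_normal_moment[OF assms(1), of 0 2] by simp
  then show "has_bochner_integral M (\<lambda>w. (Y w)\<^sup>2) (s\<^sup>2)"
    using normal_distributed_variance[OF assms] normal_distributed_expectation[OF assms]
    by (simp add: has_bochner_integral_iff)
qed

text \<open>A one-point mark space with counting measure turns the mark integral of the isometry
  into evaluation and \<open>measure V (A \<inter> A')\<close> into \<open>1\<close>. Fixing the
  coordinate \<open>j\<close> keeps the noise scalar.\<close>

lemma brownian_orthogonal_increments:
  fixes B :: "real \<Rightarrow> 'w \<Rightarrow> real^'l"
  assumes basis: "complete_filtered_prob_space P \<F>" and B: "brownian_motion P \<F> B"
  shows "orthogonal_increments P \<F> (count_space (UNIV :: unit set)) {UNIV}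
    (\<lambda>a b _ w. (B b w - B a w) $ j)"
proof -
  interpret prob_space P using complete_filtered_prob_spaceD(1)[OF basis] .
  note sub = complete_filtered_prob_spaceD(2)[OF basis] and mono = complete_filtered_prob_spaceD(3)[OF basis]
  have Bm: "B t \<in> borel_measurable (\<F> t)" if "0 \<le> t" for t
    using B that by (simp add: brownian_motion_def)
  have Dm: "(\<lambda>w. (B b w - B a w) $ j) \<in> borel_measurable (\<F> b)" if "0 \<le> a" "a \<le> b" for a b
  proof -
    have "subalgebra (\<F> b) (\<F> a)"
      using mono[OF that] sub[of a] sub[of b] that by (auto simp: subalgebra_def)
    then have "B a \<in> borel_measurable (\<F> b)" using measurable_from_subalg Bm that by blast
    then show ?thesis using Bm[of b] that by (intro borel_measurable_component borel_measurable_diff) auto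
  qed
  \<comment> \<open>Both moment conditions are instances: \<open>g\<close> is the identity for
    \<open>D_zero\<close> and the square for \<open>D_sq\<close>.\<close>
  have ind: "has_bochner_integral P (\<lambda>w. X w * g ((B b w - B a w) $ j)) (expectation X * m)"
    if "0 \<le> a" "a < b" "X \<in> borel_measurable (\<F> a)" "integrable P X" "g \<in> borel_measurable borel"
      "has_bochner_integral P (\<lambda>w. g ((B b w - B a w) $ j)) m" for a b X and g :: "real \<Rightarrow> real" and m
  proof -
    let ?G = "sets (vimage_algebra (space P) (\<lambda>w. B b w - B a w) borel)"
    have "indep_set (sets (\<F> a)) ?G"
      using B that by (simp add: brownian_motion_def)
    moreover have "sigma_sets (space P) {(\<lambda>w. g ((B b w - B a w) $ j)) -` S \<inter> space P | S. S \<in> sets borel} \<subseteq> ?G"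
      unfolding sets_vimage_algebra
    proof (intro sigma_sets_mono subsetI)
      fix E assume "E \<in> {(\<lambda>w. g ((B b w - B a w) $ j)) -` S \<inter> space P | S. S \<in> sets borel}"
      then obtain S where S: "S \<in> sets borel" "E = (\<lambda>w. g ((B b w - B a w) $ j)) -` S \<inter> space P" by auto
      have "(\<lambda>x::real^'l. g (x $ j)) \<in> borel_measurable borel"
        by (intro measurable_compose[OF _ that(5)] borel_measurable_component measurable_ident_sets[OF refl])
      from measurable_sets[OF this S(1)] have "(\<lambda>x::real^'l. g (x $ j)) -` S \<in> sets borel"
        by simp
      then show "E \<in> sigma_sets (space P) {(\<lambda>w. B b w - B a w) -` S \<inter> space P | S. S \<in> sets borel}"
        unfolding S by (intro sigma_sets.Basic) (auto intro!: exI[of _ "(\<lambda>x. g (x $ j)) -` S"])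
    qed
    ultimately have "has_bochner_integral P (\<lambda>w. X w * g ((B b w - B a w) $ j))
        (expectation X * expectation (\<lambda>w. g ((B b w - B a w) $ j)))"
      by (rule indep_set_mult_integral[OF sub[OF that(1)] _ that(3,4) integrable.intros[OF that(6)]])
    then show ?thesis using has_bochner_integral_integral_eq[OF that(6)] by simp
  qed
  have dist: "distributed P lborel (\<lambda>w. (B b w - B a w) $ j) (normal_density 0 (sqrt (b - a)))"
    if "0 \<le> a" "a < b" for a b
    using B that by (simp add: brownian_motion_def)
  show ?thesis
  proof (unfold_locales, goal_cases)
    \<comment> \<open>Goals 7 and 8 are \<open>D_zero\<close> and \<open>D_sq\<close>. Empty
      intervals are treated apart because the normal law is prescribed only for
      \<open>s < t\<close>.\<close>
    case (7 a b A X)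
    show ?case
    proof (cases "a = b")
      case False
      then have ab: "a < b" using 7 by simp
      then show ?thesis
        using ind[OF 7(1) ab 7(4,5), of "\<lambda>x. x" 0] normal_moments(1)[OF _ dist[OF 7(1) ab]] by simp
    qed (simp add: has_bochner_integral_zero)
  next
    case (8 a b A A' X)
    show ?case
    proof (cases "a = b")
      case False
      then have ab: "a < b" using 8 by simp
      then show ?thesis
        using ind[OF 8(1) ab 8(5,6), of "\<lambda>x. x\<^sup>2" "b - a"] normal_moments(2)[OF _ dist[OF 8(1) ab]] 8
        by (simp add: power2_eq_square measure_def emeasure_count_space)
    qed (simp add: has_bochner_integral_zero)
  qed (use Dm sub mono in auto)
qed

text \<open>Total mass, mean and second factorial moment. With \<open>p k\<close> for the weights,
  \<open>k * p k = m * p (k - 1)\<close> for positive \<open>k\<close>, so each series is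
  \<open>m\<close> times the previous one after an index shift; the dropped term at
  \<open>k = 0\<close> vanishes.\<close>

lemma poisson_sums:
  fixes m :: real
  shows "(\<lambda>k. m ^ k / fact k * exp (- m)) sums 1"
    and "(\<lambda>k. real k * (m ^ k / fact k * exp (- m))) sums m"
    and "(\<lambda>k. (real k * (real k - 1)) * (m ^ k / fact k * exp (- m))) sums m\<^sup>2"
proof -
  have e: "(\<lambda>k. m ^ k / fact k) sums exp m"
    using exp_converges[of m] by (simp add: divide_inverse mult.commute)
  show 1: "(\<lambda>k. m ^ k / fact k * exp (- m)) sums 1"
    using sums_mult2[OF e, of "exp (- m)"] by (simp add: exp_minus)
  have step: "real (Suc k) * (m ^ Suc k / fact (Suc k) * exp (- m)) = m * (m ^ k / fact k * exp (- m))" for k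
    by (simp add: field_simps del: of_nat_Suc)
  then have "(\<lambda>k. real (Suc k) * (m ^ Suc k / fact (Suc k) * exp (- m))) = (\<lambda>k. m * (m ^ k / fact k * exp (- m)))"
    by blast
  then have "(\<lambda>k. real (Suc k) * (m ^ Suc k / fact (Suc k) * exp (- m))) sums m"
    using sums_mult[OF 1, of m] by simp
  then show 2: "(\<lambda>k. real k * (m ^ k / fact k * exp (- m))) sums m"
    by (subst (asm) sums_Suc_iff) simp
  have "(\<lambda>k. (real (Suc k) * (real (Suc k) - 1)) * (m ^ Suc k / fact (Suc k) * exp (- m))) =
      (\<lambda>k. m * (real k * (m ^ k / fact k * exp (- m))))"
  proof
    fix k
    have "(real (Suc k) * (real (Suc k) - 1)) * (m ^ Suc k / fact (Suc k) * exp (- m)) =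
        real k * (real (Suc k) * (m ^ Suc k / fact (Suc k) * exp (- m)))"
      by (simp del: fact_Suc power_Suc)
    then show "(real (Suc k) * (real (Suc k) - 1)) * (m ^ Suc k / fact (Suc k) * exp (- m)) =
        m * (real k * (m ^ k / fact k * exp (- m)))"
      unfolding step by simp
  qed
  then have "(\<lambda>k. (real (Suc k) * (real (Suc k) - 1)) * (m ^ Suc k / fact (Suc k) * exp (- m))) sums m\<^sup>2"
    using sums_mult[OF 2, of m] by (simp add: power2_eq_square)
  then show "(\<lambda>k. (real k * (real k - 1)) * (m ^ k / fact k * exp (- m))) sums m\<^sup>2"
    by (subst (asm) sums_Suc_iff) simp
qed

text \<open>Only the probabilities of finite values are prescribed; as they add up to
  \<open>1\<close>, the value infinity has probability zero and the level sets \<open>E k\<close>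
  exhaust the space up to a null set. Integrating over them turns moments into the series
  above.\<close>

lemma (in prob_space) poisson_moments:
  fixes Z :: "'a \<Rightarrow> ennreal"
  assumes Z[measurable]: "Z \<in> borel_measurable M" and m: "0 \<le> m"
    and Pk: "\<And>k::nat. prob {w\<in>space M. Z w = of_nat k} = m ^ k / fact k * exp (- m)"
  shows "AE w in M. Z w < \<infinity>"
    and "has_bochner_integral M (\<lambda>w. enn2real (Z w) - m) 0"
    and "has_bochner_integral M (\<lambda>w. (enn2real (Z w) - m)\<^sup>2) m"
proof -
  define E where "E k = {w\<in>space M. Z w = of_nat k}" for k :: nat
  have [measurable]: "E k \<in> sets M" for k unfolding E_def by measurable
  have disj: "disjoint_family E" by (auto simp: disjoint_family_on_def E_def)
  have "(\<lambda>k. prob (E k)) sums prob (\<Union>k. E k)"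
    by (intro finite_measure_UNION disj) auto
  then have "prob (\<Union>k. E k) = 1"
    using poisson_sums(1)[of m] Pk by (auto simp: E_def dest: sums_unique2)
  then have AE: "AE w in M. w \<in> (\<Union>k. E k)" by (intro AE_in_set_eq_1[THEN iffD2]) auto
  then show fin: "AE w in M. Z w < \<infinity>"
    by eventually_elim (auto simp: E_def of_nat_less_top)
  have nn: "(\<integral>\<^sup>+w. ennreal (h (enn2real (Z w))) \<partial>M) = ennreal s"
    if h: "\<And>k. 0 \<le> h (real k)" "(\<lambda>k. h (real k) * (m ^ k / fact k * exp (- m))) sums s"
    and [measurable]: "h \<in> borel_measurable borel" for h s
  proof -
    have "AE w in M. ennreal (h (enn2real (Z w))) = (\<Sum>k. ennreal (h (real k)) * indicator (E k) w)"
      using AE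
    proof eventually_elim
      case (elim w)
      then obtain n where n: "w \<in> E n" by auto
      then have "w \<in> E k \<longleftrightarrow> k = n" for k using disj by (auto simp: disjoint_family_on_def)
      then have "(\<Sum>k. ennreal (h (real k)) * indicator (E k) w) = (\<Sum>k\<in>{n}. ennreal (h (real k)) * indicator (E k) w)"
        by (intro suminf_finite) auto
      moreover have "enn2real (Z w) = real n" using n by (simp add: E_def)
      ultimately show ?case using n by simp
    qed
    then have "(\<integral>\<^sup>+w. ennreal (h (enn2real (Z w))) \<partial>M) = (\<integral>\<^sup>+w. (\<Sum>k. ennreal (h (real k)) * indicator (E k) w) \<partial>M)"
      by (rule nn_integral_cong_AE)
    also have "\<dots> = (\<Sum>k. ennreal (h (real k)) * emeasure M (E k))"
      by (subst nn_integral_suminf) (auto simp: nn_integral_cmult)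
    also have "\<dots> = (\<Sum>k. ennreal (h (real k) * (m ^ k / fact k * exp (- m))))"
      using h(1) Pk by (simp add: emeasure_eq_measure E_def ennreal_mult'[symmetric])
    also have "\<dots> = ennreal s"
      using h m by (subst suminf_ennreal2) (auto simp: sums_iff intro!: mult_nonneg_nonneg divide_nonneg_nonneg)
    finally show ?thesis .
  qed
  \<comment> \<open>\<open>k^2 = k * (k - 1) + k\<close> reduces the second moment to the factorial
    one.\<close>
  have s2: "(\<lambda>k. (real k)\<^sup>2 * (m ^ k / fact k * exp (- m))) sums (m\<^sup>2 + m)"
    using sums_add[OF poisson_sums(3)[of m] poisson_sums(2)[of m]]
    by (rule sums_cong[THEN iffD1, rotated]) (simp add: power2_eq_square field_simps)
  have 1: "has_bochner_integral M (\<lambda>w. enn2real (Z w)) m"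
    using nn[of "\<lambda>x. x", OF _ poisson_sums(2)] m by (intro has_bochner_integral_nn_integral) auto
  have 2: "has_bochner_integral M (\<lambda>w. (enn2real (Z w))\<^sup>2) (m\<^sup>2 + m)"
    using nn[of "\<lambda>x. x\<^sup>2", OF _ s2] m by (intro has_bochner_integral_nn_integral) auto
  have c: "has_bochner_integral M (\<lambda>w. k) k" for k :: real
    by (simp add: has_bochner_integral_iff prob_space)
  show "has_bochner_integral M (\<lambda>w. enn2real (Z w) - m) 0"
    using has_bochner_integral_diff[OF 1 c[of m]] by simp
  have "has_bochner_integral M (\<lambda>w. (enn2real (Z w))\<^sup>2 - 2 * m * enn2real (Z w) + m\<^sup>2) (m\<^sup>2 + m - 2 * m * m + m\<^sup>2)"
    by (intro has_bochner_integral_add has_bochner_integral_diff has_bochner_integral_mult_right 1 2 c)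
  then show "has_bochner_integral M (\<lambda>w. (enn2real (Z w) - m)\<^sup>2) m"
    by (simp add: power2_eq_square algebra_simps)
qed

text \<open>The integrable weight is positive off the origin, so by Markov's inequality its
  superlevel sets exhaust the punctured space by sets of finite measure; the origin is added as a
  null set.\<close>

lemma intensity_measure_sigma_finite:
  assumes "intensity_measure (v :: (real^'p) measure)"
  shows "sigma_finite_measure v"
proof -
  have sets[measurable_cong]: "sets v = sets borel" and z: "emeasure v {0} = 0"
    and fin: "(\<integral>\<^sup>+ y. ennreal ((norm y)\<^sup>2 / (1 + (norm y)\<^sup>2)) \<partial>v) < \<infinity>"
    using assms by (auto simp: intensity_measure_def)
  define g :: "real^'p \<Rightarrow> real" where "g y = (norm y)\<^sup>2 / (1 + (norm y)\<^sup>2)" for y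
  have [measurable]: "g \<in> borel_measurable borel" unfolding g_def by measurable
  define A where "A n = (if n = 0 then {0} else {y. 1 / real n \<le> g y})" for n :: nat
  have [measurable]: "A n \<in> sets v" for n unfolding A_def sets by (cases n) auto
  have "emeasure v (A n) \<noteq> \<infinity>" for n
  proof (cases "n = 0")
    case False
    have "emeasure v (A n) = (\<integral>\<^sup>+y. indicator (A n) y \<partial>v)" by simp
    also have "\<dots> \<le> (\<integral>\<^sup>+y. of_nat n * ennreal (g y) \<partial>v)"
    proof (rule nn_integral_mono)
      fix y
      have "1 \<le> real n * g y" if "y \<in> A n" using that False by (simp add: A_def field_simps)
      then show "indicator (A n) y \<le> of_nat n * ennreal (g y)"
        by (auto simp: ennreal_mult'[symmetric] ennreal_of_nat_eq_real_of_nat split: split_indicator)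
    qed
    also have "\<dots> = of_nat n * (\<integral>\<^sup>+y. ennreal (g y) \<partial>v)"
      by (subst nn_integral_cmult) (auto simp: cong: measurable_cong_sets)
    also have "\<dots> < \<infinity>" using fin by (simp add: g_def ennreal_mult_less_top of_nat_less_top)
    finally show ?thesis by simp
  qed (simp add: A_def z)
  moreover have "(\<Union>n. A n) = space v"
  proof -
    have "y \<in> (\<Union>n. A n)" for y
    proof (cases "y = 0")
      case True then show ?thesis by (auto simp: A_def intro!: exI[of _ 0])
    next
      case False
      then have "0 < g y" by (auto simp: g_def intro!: divide_pos_pos add_pos_nonneg)
      then obtain n where "inverse (real (Suc n)) < g y" using reals_Archimedean by blast
      then show ?thesis by (auto simp: A_def inverse_eq_divide intro!: exI[of _ "Suc n"])
    qed
    then show ?thesis using sets_eq_imp_space_eq[OF sets] by auto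
  qed
  ultimately show ?thesis
    by (intro sigma_finite_measure.intro exI[of _ "range A"]) auto
qed

lemma compensated_orthogonal_increments:
  fixes N :: "'w \<Rightarrow> (real \<times> (real^'p)) measure"
  assumes basis: "complete_filtered_prob_space P \<F>" and v: "intensity_measure v"
    and N: "poisson_random_measure P \<F> v N"
  shows "orthogonal_increments P \<F> (restrict_space v {y. norm y < c})
    {A. A \<in> sets borel \<and> A \<subseteq> {y. y \<noteq> 0 \<and> norm y < c} \<and> emeasure v A < \<infinity>}
    (compensated v N)" (is "orthogonal_increments P \<F> ?V ?A _")
proof -
  interpret prob_space P using complete_filtered_prob_spaceD(1)[OF basis] .
  interpret v: sigma_finite_measure v using intensity_measure_sigma_finite[OF v] .
  note sub = complete_filtered_prob_spaceD(2)[OF basis] and mono = complete_filtered_prob_spaceD(3)[OF basis]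
  have sets_v[measurable_cong]: "sets v = sets borel" using v by (simp add: intensity_measure_def)
  define Z where "Z a b A w = emeasure (N w) ({a<..b} \<times> A)" for a b A w
  have rect: "{a<..b::real} \<times> A \<in> sets borel" if "A \<in> ?A" for a b A
    using that by (auto simp: borel_prod[symmetric])
  have rect_sub: "{a<..b} \<times> A \<subseteq> {a<..} \<times> (- {0})" "0 \<le> a \<Longrightarrow> {a<..b} \<times> A \<subseteq> {0..b} \<times> (- {0})"
    "0 \<le> a \<Longrightarrow> {a<..b} \<times> A \<subseteq> {0..} \<times> (- {0})" if "A \<in> ?A" for a b :: real and A
    using that by auto
  \<comment> \<open>Sigma-finiteness of \<open>v\<close> enters here: it gives the product formula
    on rectangles, so the Poisson parameter of a block is its length times the mass of
    \<open>A\<close>.\<close>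
  have em: "emeasure (lborel \<Otimes>\<^sub>M v) ({a<..b} \<times> A) = ennreal ((b - a) * measure v A)"
    if "A \<in> ?A" "a \<le> b" for a b A
    using that sets_v
    by (subst v.emeasure_pair_measure_Times) (auto simp: emeasure_eq_ennreal_measure ennreal_mult')
  have Zm: "Z a b A \<in> borel_measurable P"
    and Zk: "prob {w\<in>space P. Z a b A w = of_nat k} =
      ((b - a) * measure v A) ^ k / fact k * exp (- ((b - a) * measure v A))"
    if "0 \<le> a" "a \<le> b" "A \<in> ?A" for a b A and k :: nat
  proof -
    have *: "(\<lambda>w. emeasure (N w) S) \<in> borel_measurable P"
      "emeasure (lborel \<Otimes>\<^sub>M v) S < \<infinity> \<Longrightarrow>
           measure P {w\<in>space P. emeasure (N w) S = of_nat k} =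
                (measure (lborel \<Otimes>\<^sub>M v) S) ^ k / fact k * exp (- measure (lborel \<Otimes>\<^sub>M v) S)"
      if "S \<in> sets borel" "S \<subseteq> {0..} \<times> (- {0})" for S
      using N that by (auto simp: poisson_random_measure_def)
    show "Z a b A \<in> borel_measurable P"
      using *(1)[OF rect[OF that(3)] rect_sub(3)[OF that(3,1)]] unfolding Z_def .
    show "prob {w\<in>space P. Z a b A w = of_nat k} =
      ((b - a) * measure v A) ^ k / fact k * exp (- ((b - a) * measure v A))"
      using *(2)[OF rect[OF that(3)] rect_sub(3)[OF that(3,1)]] that em[OF that(3,2)]
      by (simp add: Z_def measure_def)
  qed
  note mom = poisson_moments[OF Zm _ Zk]
  have D: "compensated v N a b A w = enn2real (Z a b A w) - (b - a) * measure v A" for a b A w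
    by (simp add: compensated_def Z_def measure_def)
  have Dm: "compensated v N a b A \<in> borel_measurable (\<F> b)" if "0 \<le> a" "a \<le> b" "A \<in> ?A" for a b A
  proof -
    have "0 \<le> b" using that by simp
    have ev: "random_measure_events P N ({0..b} \<times> (- {0})) \<subseteq> sets (\<F> b)"
      using N that by (auto simp: poisson_random_measure_def)
    have "Z a b A \<in> borel_measurable (\<F> b)"
    proof (rule measurableI)
      fix S :: "ennreal set" assume "S \<in> sets borel"
      then have "Z a b A -` S \<inter> space P \<in> random_measure_events P N ({0..b} \<times> (- {0}))"
        unfolding random_measure_events_def Z_def using rect[OF that(3)] rect_sub(2)[OF that(3,1)]
        by (intro sigma_sets.Basic CollectI exI[of _ "{a<..b} \<times> A"] exI[of _ S]) auto
      then show "Z a b A -` S \<inter> space (\<F> b) \<in> sets (\<F> b)"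
        using ev sub[OF \<open>0 \<le> b\<close>] by (auto simp: subalgebra_def)
    qed simp
    then show ?thesis unfolding D[abs_def] by measurable
  qed
  have ind: "has_bochner_integral P (\<lambda>w. X w * g (Z a b A w)) (expectation X * m)"
    if "0 \<le> a" "a \<le> b" "A \<in> ?A" "X \<in> borel_measurable (\<F> a)" "integrable P X" "g \<in> borel_measurable borel"
      "has_bochner_integral P (\<lambda>w. g (Z a b A w)) m" for a b A X and g :: "ennreal \<Rightarrow> real" and m
  proof -
    let ?G = "random_measure_events P N ({a<..} \<times> (- {0}))"
    have "indep_set (sets (\<F> a)) ?G"
      using N that by (simp add: poisson_random_measure_def)
    moreover have "sigma_sets (space P) {(\<lambda>w. g (Z a b A w)) -` S \<inter> space P | S. S \<in> sets borel} \<subseteq> ?G"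
      unfolding random_measure_events_def
    proof (intro sigma_sets_mono subsetI)
      fix E assume "E \<in> {(\<lambda>w. g (Z a b A w)) -` S \<inter> space P | S. S \<in> sets borel}"
      then obtain S where S: "S \<in> sets borel" "E = Z a b A -` (g -` S) \<inter> space P" by auto
      have "g -` S \<in> sets borel" using measurable_sets[OF that(6) S(1)] by simp
      then show "E \<in> sigma_sets (space P) {(\<lambda>w. emeasure (N w) C) -` S \<inter> space P | C S.
          C \<in> sets borel \<and> C \<subseteq> {a<..} \<times> (- {0}) \<and> S \<in> sets borel}"
        unfolding S Z_def using rect[OF that(3)] rect_sub(1)[OF that(3)]
        by (intro sigma_sets.Basic CollectI exI[of _ "{a<..b} \<times> A"] exI[of _ "g -` S"]) auto
    qed
    ultimately have "has_bochner_integral P (\<lambda>w. X w * g (Z a b A w))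
        (expectation X * expectation (\<lambda>w. g (Z a b A w)))"
      by (rule indep_set_mult_integral[OF sub[OF that(1)] _ that(4,5) integrable.intros[OF that(7)]])
    then show ?thesis using has_bochner_integral_integral_eq[OF that(7)] by simp
  qed
  have zero: "has_bochner_integral P (\<lambda>w. X w * compensated v N a b A w) 0"
    if "0 \<le> a" "a \<le> b" "A \<in> ?A" "X \<in> borel_measurable (\<F> a)" "integrable P X" for a b A X
    unfolding D using ind[OF that, of "\<lambda>z. enn2real z - (b - a) * measure v A" 0] mom(2)[OF that(1,2,3) _ that(1,2,3)] that(2)
    by simp
  have sq: "has_bochner_integral P (\<lambda>w. X w * (compensated v N a b A w)\<^sup>2) (expectation X * ((b - a) * measure v A))"
    if "0 \<le> a" "a \<le> b" "A \<in> ?A" "X \<in> borel_measurable (\<F> a)" "integrable P X" for a b A X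
    unfolding D using ind[OF that, of "\<lambda>z. (enn2real z - (b - a) * measure v A)\<^sup>2"] mom(3)[OF that(1,2,3) _ that(1,2,3)] that(2)
    by simp
  have fin: "AE w in P. Z a b A w < \<infinity>" if "0 \<le> a" "a \<le> b" "A \<in> ?A" for a b A
    using mom(1)[OF that _ that] that(2) by simp
  have sN: "sets (N w) = sets borel" if "w \<in> space P" for w
    using N that by (simp add: poisson_random_measure_def)
  have add: "AE w in P. compensated v N a e A w = compensated v N a b A w + compensated v N b e A w"
    if "0 \<le> a" "a \<le> b" "b \<le> e" "A \<in> ?A" for a b e A
    using fin[OF that(1,2,4)] fin[OF order_trans[OF that(1,2)] that(3,4)] AE_space
  proof eventually_elim
    case (elim w)
    have "{a<..e} \<times> A = ({a<..b} \<times> A) \<union> ({b<..e} \<times> A)" using that by auto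
    moreover have "measure (N w) (({a<..b} \<times> A) \<union> ({b<..e} \<times> A)) = measure (N w) ({a<..b} \<times> A) + measure (N w) ({b<..e} \<times> A)"
      using elim rect[OF that(4)] sN by (intro measure_Union) (auto simp: Z_def)
    ultimately have "measure (N w) ({a<..e} \<times> A) = measure (N w) ({a<..b} \<times> A) + measure (N w) ({b<..e} \<times> A)"
      by simp
    then show ?case by (simp add: compensated_def algebra_simps)
  qed
  have addA: "AE w in P. compensated v N a b (A \<union> A') w = compensated v N a b A w + compensated v N a b A' w"
    if "0 \<le> a" "a \<le> b" "A \<in> ?A" "A' \<in> ?A" "A \<inter> A' = {}" for a b A A'
    using fin[OF that(1,2,3)] fin[OF that(1,2,4)] AE_space
  proof eventually_elim
    case (elim w)
    have "measure (N w) ({a<..b} \<times> (A \<union> A')) = measure (N w) ({a<..b} \<times> A) + measure (N w) ({a<..b} \<times> A')"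
      unfolding Sigma_Un_distrib2 using elim that rect[OF that(3)] rect[OF that(4)] sN
      by (intro measure_Union) (auto simp: Z_def)
    moreover have "measure v (A \<union> A') = measure v A + measure v A'"
      using that sets_v by (intro measure_Union) auto
    ultimately show ?case by (simp add: compensated_def algebra_simps)
  qed
  have Un: "A \<union> A' \<in> ?A" "A - A' \<in> ?A" "A \<inter> A' \<in> ?A" if "A \<in> ?A" "A' \<in> ?A" for A A'
  proof -
    have "emeasure v (A \<union> A') \<le> emeasure v A + emeasure v A'"
      using that sets_v by (intro emeasure_subadditive) auto
    also have "\<dots> < \<infinity>" using that by (simp add: ennreal_add_eq_top less_top)
    finally show 1: "A \<union> A' \<in> ?A" using that by auto
    have "emeasure v (A - A') \<le> emeasure v A" "emeasure v (A \<inter> A') \<le> emeasure v A"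
      using that sets_v by (intro emeasure_mono; auto)+
    moreover have "emeasure v A < \<infinity>" using that by simp
    ultimately show "A - A' \<in> ?A" "A \<inter> A' \<in> ?A" using that by (auto intro: le_less_trans)
  qed
  have Dm': "compensated v N a b A \<in> borel_measurable P" if "0 \<le> a" "a \<le> b" "A \<in> ?A" for a b A
    using Zm[OF that] unfolding D[abs_def] by measurable
  text \<open>By polarisation, independence of the past suffices to treat products over two sets.\<close>
  have disj: "has_bochner_integral P (\<lambda>w. X w * (compensated v N a b A w * compensated v N a b A' w)) 0"
    if "0 \<le> a" "a \<le> b" "A \<in> ?A" "A' \<in> ?A" "A \<inter> A' = {}" "X \<in> borel_measurable (\<F> a)" "integrable P X" for a b A A' X
  proof -
    have "measure v (A \<union> A') = measure v A + measure v A'"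
      using that sets_v by (intro measure_Union) auto
    moreover have "has_bochner_integral P (\<lambda>w. 1/2 * (X w * (compensated v N a b (A \<union> A') w)\<^sup>2 -
        X w * (compensated v N a b A w)\<^sup>2 - X w * (compensated v N a b A' w)\<^sup>2))
      (1/2 * (expectation X * ((b - a) * measure v (A \<union> A')) - expectation X * ((b - a) * measure v A) -
         expectation X * ((b - a) * measure v A')))"
      using that Un(1)[OF that(3,4)]
      by (intro has_bochner_integral_mult_right has_bochner_integral_diff sq)
    ultimately have "has_bochner_integral P (\<lambda>w. 1/2 * (X w * (compensated v N a b (A \<union> A') w)\<^sup>2 -
        X w * (compensated v N a b A w)\<^sup>2 - X w * (compensated v N a b A' w)\<^sup>2)) 0"
      by (simp add: algebra_simps)
    moreover have "AE w in P. 1/2 * (X w * (compensated v N a b (A \<union> A') w)\<^sup>2 -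
        X w * (compensated v N a b A w)\<^sup>2 - X w * (compensated v N a b A' w)\<^sup>2) =
        X w * (compensated v N a b A w * compensated v N a b A' w)"
      using addA[OF that(1-5)] by eventually_elim (simp add: power2_eq_square algebra_simps)
    ultimately show ?thesis
      using Dm'[OF that(1,2,3)] Dm'[OF that(1,2,4)] Dm'[OF that(1,2) Un(1)[OF that(3,4)]] that(7)
      by (subst (asm) has_bochner_integral_cong_AE) auto
  qed
  show ?thesis
  proof (unfold_locales, goal_cases)
    case (4 A)
    then show ?case using sets_v by (auto simp: sets_restrict_space_iff)
  next
    case (5 A)
    then show ?case using sets_v by (subst emeasure_restrict_space) auto
  next
    \<comment> \<open>Splitting both mark sets along their intersection leaves the squared increment
      over \<open>I\<close> as the only term whose mean can be nonzero; the other three products are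
      over disjoint mark sets.\<close>
    case (8 a b A A' X)
    define I where "I = A \<inter> A'"
    have s: "I \<in> ?A" "A - A' \<in> ?A" "A' - A \<in> ?A"
      unfolding I_def using Un(3)[OF 8(3,4)] Un(2)[OF 8(3,4)] Un(2)[OF 8(4,3)] by this+
    let ?D = "compensated v N a b"
    have "has_bochner_integral P (\<lambda>w. X w * (?D I w)\<^sup>2 + (X w * (?D I w * ?D (A' - A) w) +
        (X w * (?D (A - A') w * ?D I w) + X w * (?D (A - A') w * ?D (A' - A) w))))
        (expectation X * ((b - a) * measure v I) + (0 + (0 + 0)))"
      using 8(1,2,5,6) s by (intro has_bochner_integral_add sq disj) (auto simp: I_def)
    moreover have "A = I \<union> (A - A')" "A' = I \<union> (A' - A)" by (auto simp: I_def)
    then have "AE w in P. ?D A w = ?D I w + ?D (A - A') w" "AE w in P. ?D A' w = ?D I w + ?D (A' - A) w"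
      using addA[OF 8(1,2) s(1,2)] addA[OF 8(1,2) s(1,3)] by (auto simp: I_def)
    then have "AE w in P. X w * (?D I w)\<^sup>2 + (X w * (?D I w * ?D (A' - A) w) +
        (X w * (?D (A - A') w * ?D I w) + X w * (?D (A - A') w * ?D (A' - A) w))) =
        X w * (?D A w * ?D A' w)"
      by eventually_elim (simp add: power2_eq_square algebra_simps)
    ultimately have "has_bochner_integral P (\<lambda>w. X w * (?D A w * ?D A' w))
        (expectation X * ((b - a) * measure v I) + (0 + (0 + 0)))"
      using 8(6) Dm'[OF 8(1,2,3)] Dm'[OF 8(1,2,4)] s[THEN Dm'[OF 8(1,2)]]
      by (subst (asm) has_bochner_integral_cong_AE) auto
    moreover have "measure ?V I = measure v I"
      using s(1) sets_v by (subst measure_restrict_space) auto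
    ultimately show ?case by (simp add: I_def)
  qed (use Dm sub mono zero add in auto)
qed

section \<open>Mean square bounds for stochastic integrals\<close>

lemma norm_vec_sq: "(norm (x :: 'a::real_normed_vector ^ 'n))\<^sup>2 = (\<Sum>i\<in>UNIV. (norm (x $ i))\<^sup>2)"
  by (simp add: norm_vec_def L2_set_def sum_nonneg)

lemma norm_add_sq_le:
  fixes a b :: "'a::real_normed_vector"
  shows "(norm (a + b))\<^sup>2 \<le> 2 * (norm a)\<^sup>2 + 2 * (norm b)\<^sup>2"
proof -
  have "(norm (a + b))\<^sup>2 \<le> (norm a + norm b)\<^sup>2"
    by (intro power_mono norm_triangle_ineq) auto
  also have "\<dots> \<le> 2 * (norm a)\<^sup>2 + 2 * (norm b)\<^sup>2"
    using sum_squares_bound[of "norm a" "norm b"] by (simp add: power2_sum)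
  finally show ?thesis .
qed

lemma norm_add3_sq_le:
  fixes a b c :: "'a::real_normed_vector"
  shows "(norm (a + b + c))\<^sup>2 \<le> 3 * ((norm a)\<^sup>2 + (norm b)\<^sup>2 + (norm c)\<^sup>2)"
proof -
  have "norm (a + b + c) \<le> norm a + norm b + norm c"
    by (metis add_right_mono norm_triangle_ineq order_trans)
  then have "(norm (a + b + c))\<^sup>2 \<le> (norm a + norm b + norm c)\<^sup>2"
    by (intro power_mono) auto
  also have "\<dots> \<le> 3 * ((norm a)\<^sup>2 + (norm b)\<^sup>2 + (norm c)\<^sup>2)"
    using sum_squares_bound[of "norm a" "norm b"] sum_squares_bound[of "norm a" "norm c"]
      sum_squares_bound[of "norm b" "norm c"]
    by (simp add: power2_eq_square algebra_simps)
  finally show ?thesis .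
qed

abbreviation (input) mean_sq :: "'a measure \<Rightarrow> ('a \<Rightarrow> 'b::real_normed_vector) \<Rightarrow> ennreal" where
  "mean_sq M f \<equiv> \<integral>\<^sup>+x. ennreal ((norm (f x))\<^sup>2) \<partial>M"

text \<open>\<open>lborel\<close> replaces the \<open>borel\<close> of \<open>L2ad\<close> so that
  the product carries Lebesgue measure in time; the measurable functions are the same.\<close>

abbreviation (input) time_space :: "'w measure \<Rightarrow> real \<Rightarrow> (real \<times> 'w) measure" where
  "time_space P t \<equiv> restrict_space lborel {0..t} \<Otimes>\<^sub>M P"

lemma nn_integral_norm_add3_sq_le:
  fixes f g h :: "'a \<Rightarrow> 'b::{real_normed_vector, second_countable_topology}"
  assumes [measurable]: "f \<in> borel_measurable M" "g \<in> borel_measurable M" "h \<in> borel_measurable M"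
  shows "mean_sq M (\<lambda>x. f x + g x + h x) \<le>
    3 * (mean_sq M f + mean_sq M g + mean_sq M h)"
proof -
  have "mean_sq M (\<lambda>x. f x + g x + h x) \<le>
      (\<integral>\<^sup>+x. 3 * (ennreal ((norm (f x))\<^sup>2) + ennreal ((norm (g x))\<^sup>2) + ennreal ((norm (h x))\<^sup>2)) \<partial>M)"
  proof (rule nn_integral_mono)
    fix x
    have "ennreal ((norm (f x + g x + h x))\<^sup>2) \<le> ennreal (3 * ((norm (f x))\<^sup>2 + (norm (g x))\<^sup>2 + (norm (h x))\<^sup>2))"
      by (intro ennreal_leI norm_add3_sq_le)
    then show "ennreal ((norm (f x + g x + h x))\<^sup>2) \<le>
        3 * (ennreal ((norm (f x))\<^sup>2) + ennreal ((norm (g x))\<^sup>2) + ennreal ((norm (h x))\<^sup>2))"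
      by (simp add: ennreal_mult')
  qed
  then show ?thesis by (simp add: nn_integral_cmult nn_integral_add)
qed

text \<open>A bound up to a constant on simple integrands suffices below, so no attempt is made to keep
  the isometry constant in the limit.\<close>

lemma L2_limit_bound:
  fixes f f' :: "'a \<Rightarrow> 'b::{real_normed_vector, second_countable_topology}"
    and I I' :: "'w \<Rightarrow> 'c::{real_normed_vector, second_countable_topology}"
  assumes [measurable]: "f \<in> borel_measurable M" "f' \<in> borel_measurable M"
      "\<And>k. \<Phi> k \<in> borel_measurable M" "\<And>k. \<Psi> k \<in> borel_measurable M"
      "I \<in> borel_measurable P" "I' \<in> borel_measurable P"
      "\<And>k. S k \<in> borel_measurable P" "\<And>k. S' k \<in> borel_measurable P"
    and lim: "(\<lambda>k. \<integral>\<^sup>+x. ennreal ((norm (f x - \<Phi> k x))\<^sup>2) \<partial>M) \<longlonglongrightarrow> 0"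
      "(\<lambda>k. \<integral>\<^sup>+x. ennreal ((norm (f' x - \<Psi> k x))\<^sup>2) \<partial>M) \<longlonglongrightarrow> 0"
      "(\<lambda>k. \<integral>\<^sup>+x. ennreal ((norm (I x - S k x))\<^sup>2) \<partial>P) \<longlonglongrightarrow> 0"
      "(\<lambda>k. \<integral>\<^sup>+x. ennreal ((norm (I' x - S' k x))\<^sup>2) \<partial>P) \<longlonglongrightarrow> 0"
    and C: "\<And>k. mean_sq P (\<lambda>x. S k x - S' k x) \<le>
      ennreal C * mean_sq M (\<lambda>x. \<Phi> k x - \<Psi> k x)"
  shows "mean_sq P (\<lambda>x. I x - I' x) \<le>
    9 * ennreal C * mean_sq M (\<lambda>x. f x - f' x)"
proof -
  let ?d = "\<integral>\<^sup>+x. ennreal ((norm (f x - f' x))\<^sup>2) \<partial>M"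
  define p q r s where "p k = mean_sq M (\<lambda>x. f x - \<Phi> k x)"
    and "q k = mean_sq M (\<lambda>x. f' x - \<Psi> k x)"
    and "r k = mean_sq P (\<lambda>x. I x - S k x)"
    and "s k = mean_sq P (\<lambda>x. I' x - S' k x)" for k
  \<comment> \<open>Inserting the approximants costs a factor 3 on the side of the integrals and
    another 3 on the side of the integrands, whence the 9. Letting \<open>k\<close> tend to infinity
    leaves only the middle distance.\<close>
  have bound: "mean_sq P (\<lambda>x. I x - I' x) \<le>
      3 * (r k + ennreal C * (3 * (p k + ?d + q k)) + s k)" for k
  proof -
    have "mean_sq M (\<lambda>x. \<Phi> k x - \<Psi> k x) =
        mean_sq M (\<lambda>x. (\<Phi> k x - f x) + (f x - f' x) + (f' x - \<Psi> k x))" by simp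
    also have "\<dots> \<le> 3 * (mean_sq M (\<lambda>x. \<Phi> k x - f x) + ?d + q k)"
      unfolding q_def by (intro nn_integral_norm_add3_sq_le) measurable
    finally have 1: "mean_sq M (\<lambda>x. \<Phi> k x - \<Psi> k x) \<le> 3 * (p k + ?d + q k)"
      by (simp add: p_def norm_minus_commute)
    have "mean_sq P (\<lambda>x. I x - I' x) =
        mean_sq P (\<lambda>x. (I x - S k x) + (S k x - S' k x) + (S' k x - I' x))" by simp
    also have "\<dots> \<le> 3 * (r k + mean_sq P (\<lambda>x. S k x - S' k x) +
        mean_sq P (\<lambda>x. S' k x - I' x))"
      unfolding r_def by (intro nn_integral_norm_add3_sq_le) measurable
    also have "mean_sq P (\<lambda>x. S' k x - I' x) = s k" by (simp add: s_def norm_minus_commute)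
    also have "mean_sq P (\<lambda>x. S k x - S' k x) \<le> ennreal C * (3 * (p k + ?d + q k))"
      by (rule order_trans[OF C mult_left_mono[OF 1]]) simp
    finally show ?thesis by (simp add: mult_left_mono add_mono)
  qed
  have "(\<lambda>k. 3 * (r k + ennreal C * (3 * (p k + ?d + q k)) + s k)) \<longlonglongrightarrow>
      3 * (0 + ennreal C * (3 * (0 + ?d + 0)) + 0)"
    using lim unfolding p_def[symmetric] q_def[symmetric] r_def[symmetric] s_def[symmetric]
    by (intro ennreal_tendsto_cmult tendsto_add tendsto_const) (auto simp: less_top[symmetric])
  from LIMSEQ_le_const[OF this, of "\<integral>\<^sup>+x. ennreal ((norm (I x - I' x))\<^sup>2) \<partial>P"] bound
  have "mean_sq P (\<lambda>x. I x - I' x) \<le> 3 * (ennreal C * (3 * ?d))" by auto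
  also have "\<dots> = 3 * 3 * (ennreal C * ?d)" by (simp only: mult_ac)
  finally show ?thesis by (simp add: mult.assoc)
qed

text \<open>The isometry is exact for each entry \<open>(r, j)\<close> of the integrand against
  coordinate \<open>j\<close> of the noise. Recombining costs one factor \<open>CARD('l)\<close>
  from Cauchy-Schwarz for the sum over \<open>j\<close>; the other \<open>CARD('l)\<close> and the
  \<open>CARD('p)\<close> come from bounding every entry by the full norm and summing.\<close>

lemma simple_ito_integral_bound:
  fixes B :: "real \<Rightarrow> 'w \<Rightarrow> real^'l" and \<phi> :: "(real \<times> real \<times> ('w \<Rightarrow> real^'l^'p)) list"
  assumes basis: "complete_filtered_prob_space P \<F>" and B: "brownian_motion P \<F> B"
    and \<phi>: "simple_process P \<F> \<phi>" and t: "0 \<le> t"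
  shows "simple_ito_integral B \<phi> t \<in> borel_measurable P"
    and "(\<lambda>(s, w). simple_value \<phi> s w) \<in> borel_measurable (time_space P t)"
    and "mean_sq P (simple_ito_integral B \<phi> t) \<le>
      ennreal (real CARD('p) * (real CARD('l))\<^sup>2) *
      (\<integral>\<^sup>+s\<in>{0..t}. mean_sq P (simple_value \<phi> s) \<partial>lborel)"
proof -
  define n a b \<xi> where "n = length \<phi>" and "a k = fst (\<phi> ! k)" and "b k = fst (snd (\<phi> ! k))"
    and "\<xi> k = snd (snd (\<phi> ! k))" for k
  have ab: "0 \<le> a k" "a k \<le> b k" and \<xi>: "\<xi> k \<in> borel_measurable (\<F> (a k))" "bounded (\<xi> k ` space P)"
    if "k < n" for k
    using nth_mem[of k \<phi>] \<phi> that unfolding simple_process_def n_def a_def b_def \<xi>_def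
    by (fastforce split: prod.splits)+
  have list: "(\<Sum>(a, b, \<xi>)\<leftarrow>\<phi>. g a b \<xi>) = (\<Sum>k<n. g (a k) (b k) (\<xi> k))"
    for g :: "real \<Rightarrow> real \<Rightarrow> ('w \<Rightarrow> real^'l^'p) \<Rightarrow> 'z::comm_monoid_add"
    by (simp add: sum_list_sum_nth n_def a_def b_def \<xi>_def split_beta atLeast0LessThan)
  have subalg: "0 \<le> s \<Longrightarrow> subalgebra P (\<F> s)" for s
    using complete_filtered_prob_spaceD(2)[OF basis] .
  have \<xi>m[measurable]: "\<xi> k \<in> borel_measurable P" if "k < n" for k
    using measurable_from_subalg[OF subalg[OF ab(1)[OF that]] \<xi>(1)[OF that]] .
  have Bm[measurable]: "B s \<in> borel_measurable P" if "0 \<le> s" for s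
    using measurable_from_subalg[OF subalg[OF that]] B that unfolding brownian_motion_def by blast
  have Bm2[measurable]: "B (min (a k) t) \<in> borel_measurable P" "B (min (b k) t) \<in> borel_measurable P" if "k < n" for k
    using ab[OF that] t by (auto intro!: Bm)
  define X where "X r j w = (\<Sum>k<n. (\<xi> k w $ r $ j) * (B (min (b k) t) w - B (min (a k) t) w) $ j)" for r j w
  have comp: "simple_ito_integral B \<phi> t w $ r = (\<Sum>j\<in>UNIV. X r j w)" for w r
    unfolding simple_ito_integral_def list X_def
    by (subst sum.swap) (simp add: sum_component matrix_vector_mult_def)
  have Xm[measurable]: "X r j \<in> borel_measurable P" for r j
    unfolding X_def by (intro borel_measurable_sum borel_measurable_times borel_measurable_component
      borel_measurable_diff) (auto intro: Bm2)
  have "simple_ito_integral B \<phi> t w = (\<Sum>r\<in>UNIV. (\<Sum>j\<in>UNIV. X r j w) *\<^sub>R axis r 1)" for w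
    using basis_expansion[of "simple_ito_integral B \<phi> t w"] by (simp add: comp scalar_mult_eq_scaleR)
  then show "simple_ito_integral B \<phi> t \<in> borel_measurable P"
    by (subst measurable_cong) (auto intro!: borel_measurable_sum borel_measurable_scaleR)
  have sm: "(\<lambda>s. indicator {a<..b} s :: real) \<in> borel_measurable (restrict_space lborel {0..t})" for a b :: real
    by (intro measurable_restrict_space1) simp
  show "(\<lambda>(s, w). simple_value \<phi> s w) \<in> borel_measurable (time_space P t)"
    unfolding simple_value_def[abs_def] list split_beta
    by (intro borel_measurable_sum borel_measurable_scaleR measurable_compose[OF measurable_fst sm]
        measurable_compose[OF measurable_snd \<xi>m]) auto
  have X: "(\<integral>\<^sup>+w. ennreal ((X r j w)\<^sup>2) \<partial>P) =
      (\<integral>\<^sup>+s\<in>{0..t}. (\<integral>\<^sup>+w. ennreal ((simple_value \<phi> s w $ r $ j)\<^sup>2) \<partial>P) \<partial>lborel)" for r j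
  proof -
    interpret orthogonal_increments P \<F> "count_space (UNIV :: unit set)" "{UNIV}"
      "\<lambda>a b _ w. (B b w - B a w) $ j"
      by (rule brownian_orthogonal_increments[OF basis B])
    have "bounded ((\<lambda>w. \<xi> k w $ r $ j) ` space P)" if k: "k < n" for k
    proof -
      obtain C where "\<And>w. w \<in> space P \<Longrightarrow> norm (\<xi> k w) \<le> C" using \<xi>(2)[OF k] by (auto simp: bounded_iff)
      then show ?thesis
        by (intro boundedI[of _ C]) (auto intro: order_trans[OF Finite_Cartesian_Product.norm_nth_le]
          order_trans[OF component_le_norm_cart])
    qed
    moreover have "(\<lambda>w. \<xi> k w $ r $ j) \<in> borel_measurable (\<F> (a k))" if k: "k < n" for k
      by (intro borel_measurable_component \<xi>(1) k)
    ultimately have "(\<integral>\<^sup>+w. ennreal ((X r j w)\<^sup>2) \<partial>P) =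
      (\<integral>\<^sup>+s\<in>{0..t}. (\<integral>\<^sup>+w. (\<integral>\<^sup>+y. ennreal ((\<Sum>k<n. indicator {a k<..b k} s *
          indicator UNIV (y::unit) * (\<xi> k w $ r $ j))\<^sup>2) \<partial>count_space UNIV) \<partial>P) \<partial>lborel)"
      unfolding X_def using t ab by (intro isometry) auto
    also have "\<dots> = (\<integral>\<^sup>+s\<in>{0..t}. (\<integral>\<^sup>+w. ennreal ((simple_value \<phi> s w $ r $ j)\<^sup>2) \<partial>P) \<partial>lborel)"
      unfolding simple_value_def list
      by (simp add: nn_integral_count_space_finite UNIV_unit sum_component)
    finally show ?thesis .
  qed
  have le: "(simple_value \<phi> s w $ r $ j)\<^sup>2 \<le> (norm (simple_value \<phi> s w))\<^sup>2" for s w r j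
  proof -
    have "\<bar>simple_value \<phi> s w $ r $ j\<bar> \<le> norm (simple_value \<phi> s w)"
      by (meson order_trans component_le_norm_cart Finite_Cartesian_Product.norm_nth_le)
    then have "\<bar>simple_value \<phi> s w $ r $ j\<bar>\<^sup>2 \<le> (norm (simple_value \<phi> s w))\<^sup>2" by (intro power_mono) auto
    then show ?thesis by simp
  qed
  let ?R = "\<integral>\<^sup>+s\<in>{0..t}. mean_sq P (simple_value \<phi> s) \<partial>lborel"
  have "mean_sq P (simple_ito_integral B \<phi> t) \<le>
      (\<integral>\<^sup>+w. (\<Sum>r\<in>UNIV. (\<Sum>j\<in>UNIV. ennreal (real CARD('l)) * ennreal ((X r j w)\<^sup>2))) \<partial>P)"
  proof (rule nn_integral_mono)
    fix w
    have "(norm (simple_ito_integral B \<phi> t w))\<^sup>2 \<le> (\<Sum>r\<in>UNIV. (\<Sum>j\<in>UNIV. real CARD('l) * (X r j w)\<^sup>2))"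
      unfolding norm_vec_sq comp real_norm_def power2_abs
    proof (rule sum_mono)
      fix r
      show "(\<Sum>j\<in>UNIV. X r j w)\<^sup>2 \<le> (\<Sum>j\<in>UNIV. real CARD('l) * (X r j w)\<^sup>2)"
        using sum_squared_le_sum_of_squares[of "\<lambda>j. X r j w" UNIV]
        by (simp add: sum_distrib_left[symmetric] mult.commute)
    qed
    then show "ennreal ((norm (simple_ito_integral B \<phi> t w))\<^sup>2) \<le>
        (\<Sum>r\<in>UNIV. (\<Sum>j\<in>UNIV. ennreal (real CARD('l)) * ennreal ((X r j w)\<^sup>2)))"
      by (simp add: ennreal_mult[symmetric] sum_nonneg ennreal_leI)
  qed
  also have "\<dots> = (\<Sum>r\<in>(UNIV::'p set). (\<Sum>j\<in>(UNIV::'l set). ennreal (real CARD('l)) * (\<integral>\<^sup>+w. ennreal ((X r j w)\<^sup>2) \<partial>P)))"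
    by (simp add: nn_integral_sum nn_integral_cmult)
  also have "\<dots> \<le> (\<Sum>r\<in>(UNIV::'p set). (\<Sum>j\<in>(UNIV::'l set). ennreal (real CARD('l)) * ?R))"
    unfolding X by (intro sum_mono mult_left_mono nn_integral_mono mult_right_mono ennreal_leI le) auto
  also have "\<dots> = ennreal (real CARD('p) * (real CARD('l))\<^sup>2) * ?R"
    by (simp add: ennreal_mult power2_eq_square ennreal_of_nat_eq_real_of_nat mult_ac)
  finally show "mean_sq P (simple_ito_integral B \<phi> t) \<le>
      ennreal (real CARD('p) * (real CARD('l))\<^sup>2) * ?R" .
qed

text \<open>Here the noise is scalar, so the components decouple by Pythagoras and each satisfies
  the exact isometry; \<open>CARD('p)\<close> arises from bounding each component by the full
  norm.\<close>

lemma simple_jump_integral_bound: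
  fixes N :: "'w \<Rightarrow> (real \<times> (real^'p)) measure"
  assumes basis: "complete_filtered_prob_space P \<F>" and v: "intensity_measure v"
    and N: "poisson_random_measure P \<F> v N"
    and \<phi>: "simple_jump_process P \<F> v c \<phi>" and t: "0 \<le> t"
  shows "simple_jump_integral v N \<phi> t \<in> borel_measurable P"
    and "(\<lambda>(s, w, y). simple_jump_value \<phi> s w y) \<in>
      borel_measurable (time_space (P \<Otimes>\<^sub>M restrict_space v {y. norm y < c}) t)"
    and "mean_sq P (simple_jump_integral v N \<phi> t) \<le>
      ennreal (real CARD('p)) * (\<integral>\<^sup>+s\<in>{0..t}. (\<integral>\<^sup>+w. (\<integral>\<^sup>+y\<in>{y. norm y < c}.
        ennreal ((norm (simple_jump_value \<phi> s w y))\<^sup>2) \<partial>v) \<partial>P) \<partial>lborel)"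
proof -
  let ?V = "restrict_space v {y. norm y < c}"
  let ?A = "{A. A \<in> sets borel \<and> A \<subseteq> {y. y \<noteq> 0 \<and> norm y < c} \<and> emeasure v A < \<infinity>}"
  have sv: "sets v = sets borel" using v by (simp add: intensity_measure_def)
  interpret orthogonal_increments P \<F> ?V ?A "compensated v N"
    by (rule compensated_orthogonal_increments[OF basis v N])
  define n a b A \<xi> where "n = length \<phi>" and "a k = fst (\<phi> ! k)" and "b k = fst (snd (\<phi> ! k))"
    and "A k = fst (snd (snd (\<phi> ! k)))" and "\<xi> k = snd (snd (snd (\<phi> ! k)))" for k
  have ab: "0 \<le> a k" "a k \<le> b k" and \<xi>: "\<xi> k \<in> borel_measurable (\<F> (a k))" "bounded (\<xi> k ` space P)"
    and A: "A k \<in> ?A" if "k < n" for k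
    using nth_mem[of k \<phi>] \<phi> that unfolding simple_jump_process_def n_def a_def b_def \<xi>_def A_def
    by (fastforce split: prod.splits)+
  have list: "(\<Sum>(a, b, A, \<xi>)\<leftarrow>\<phi>. g a b A \<xi>) = (\<Sum>k<n. g (a k) (b k) (A k) (\<xi> k))"
    for g :: "real \<Rightarrow> real \<Rightarrow> (real^'p) set \<Rightarrow> ('w \<Rightarrow> real^'p) \<Rightarrow> 'z::comm_monoid_add"
    by (simp add: sum_list_sum_nth n_def a_def b_def \<xi>_def A_def split_beta atLeast0LessThan)
  have \<xi>m[measurable]: "\<xi> k \<in> borel_measurable P" if "k < n" for k
    using measurable_from_subalg[OF subalgebra_F[OF ab(1)[OF that]] \<xi>(1)[OF that]] .
  have Dm: "compensated v N (min (a k) t) (min (b k) t) (A k) \<in> borel_measurable P" if k: "k < n" for k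
  proof (rule measurable_from_subalg[OF subalgebra_F D_meas])
    show "A k \<in> ?A" by (rule A[OF k])
  qed (use ab[OF k] t in auto)
  show "simple_jump_integral v N \<phi> t \<in> borel_measurable P"
    unfolding simple_jump_integral_def[abs_def] list
    by (intro borel_measurable_sum borel_measurable_scaleR Dm \<xi>m) auto
  have Am: "(\<lambda>y. indicator (A k) y :: real) \<in> borel_measurable ?V" if "k < n" for k
    using \<A>_sets[OF A[OF that]] by simp
  have sm: "(\<lambda>s. indicator {a<..b} s :: real) \<in> borel_measurable (restrict_space lborel {0..t})" for a b :: real
    by (intro measurable_restrict_space1) simp
  show "(\<lambda>(s, w, y). simple_jump_value \<phi> s w y) \<in> borel_measurable (time_space (P \<Otimes>\<^sub>M ?V) t)"
    unfolding simple_jump_value_def[abs_def] list split_beta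
    by (intro borel_measurable_sum borel_measurable_scaleR borel_measurable_times
        measurable_compose[OF measurable_fst sm] measurable_compose[OF measurable_compose[OF measurable_snd measurable_fst] \<xi>m]
        measurable_compose[OF measurable_compose[OF measurable_snd measurable_snd] Am]) auto
  define X where "X r w = (\<Sum>k<n. \<xi> k w $ r * compensated v N (min (a k) t) (min (b k) t) (A k) w)" for r w
  have comp: "simple_jump_integral v N \<phi> t w $ r = X r w" for w r
    unfolding simple_jump_integral_def list X_def by (simp add: sum_component mult.commute)
  have Xm[measurable]: "X r \<in> borel_measurable P" for r
    unfolding X_def by (intro borel_measurable_sum borel_measurable_times borel_measurable_component Dm \<xi>m) auto
  have restr: "(\<integral>\<^sup>+y. h y \<partial>?V) = (\<integral>\<^sup>+y\<in>{y. norm y < c}. h y \<partial>v)" for h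
    by (subst nn_integral_restrict_space) (auto simp: sv)
  have X: "(\<integral>\<^sup>+w. ennreal ((X r w)\<^sup>2) \<partial>P) =
      (\<integral>\<^sup>+s\<in>{0..t}. (\<integral>\<^sup>+w. (\<integral>\<^sup>+y\<in>{y. norm y < c}. ennreal ((simple_jump_value \<phi> s w y $ r)\<^sup>2) \<partial>v) \<partial>P) \<partial>lborel)" for r
  proof -
    have "bounded ((\<lambda>w. \<xi> k w $ r) ` space P)" if k: "k < n" for k
    proof -
      obtain C where "\<And>w. w \<in> space P \<Longrightarrow> norm (\<xi> k w) \<le> C" using \<xi>(2)[OF k] by (auto simp: bounded_iff)
      then show ?thesis
        by (intro boundedI[of _ C]) (auto intro: order_trans[OF component_le_norm_cart])
    qed
    moreover have "(\<lambda>w. \<xi> k w $ r) \<in> borel_measurable (\<F> (a k))" if k: "k < n" for k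
      by (intro borel_measurable_component \<xi>(1) k)
    ultimately have "(\<integral>\<^sup>+w. ennreal ((X r w)\<^sup>2) \<partial>P) =
      (\<integral>\<^sup>+s\<in>{0..t}. (\<integral>\<^sup>+w. (\<integral>\<^sup>+y. ennreal ((\<Sum>k<n. indicator {a k<..b k} s *
          indicator (A k) y * (\<xi> k w $ r))\<^sup>2) \<partial>?V) \<partial>P) \<partial>lborel)"
      unfolding X_def by (intro isometry t ab A)
    then show ?thesis
      unfolding simple_jump_value_def list restr by (simp add: sum_component)
  qed
  have le: "(simple_jump_value \<phi> s w y $ r)\<^sup>2 \<le> (norm (simple_jump_value \<phi> s w y))\<^sup>2" for s w r y
    using power_mono[OF component_le_norm_cart[of "simple_jump_value \<phi> s w y" r], of 2] by simp
  let ?R = "\<integral>\<^sup>+s\<in>{0..t}. (\<integral>\<^sup>+w. (\<integral>\<^sup>+y\<in>{y. norm y < c}. ennreal ((norm (simple_jump_value \<phi> s w y))\<^sup>2) \<partial>v) \<partial>P) \<partial>lborel"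
  have "mean_sq P (simple_jump_integral v N \<phi> t) =
      (\<Sum>r\<in>UNIV. \<integral>\<^sup>+w. ennreal ((X r w)\<^sup>2) \<partial>P)"
    by (simp add: norm_vec_sq comp sum_ennreal[symmetric] nn_integral_sum del: sum_ennreal)
  also have "\<dots> \<le> (\<Sum>r\<in>(UNIV::'p set). ?R)"
    unfolding X by (intro sum_mono nn_integral_mono mult_right_mono ennreal_leI le) auto
  also have "\<dots> = ennreal (real CARD('p)) * ?R"
    by (simp add: ennreal_of_nat_eq_real_of_nat)
  finally show "mean_sq P (simple_jump_integral v N \<phi> t) \<le> ennreal (real CARD('p)) * ?R" .
qed

section \<open>Iterated integrals over time, samples and marks\<close>

lemma nn_integral_time_iterated:
  assumes "sigma_finite_measure Q" "h \<in> borel_measurable (time_space Q t)"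
  shows "(\<integral>\<^sup>+s\<in>{0..t}. (\<integral>\<^sup>+w. h (s, w) \<partial>Q) \<partial>lborel) = (\<integral>\<^sup>+z. h z \<partial>(time_space Q t))"
proof -
  interpret Q: sigma_finite_measure Q by fact
  have "(\<integral>\<^sup>+s\<in>{0..t}. (\<integral>\<^sup>+w. h (s, w) \<partial>Q) \<partial>lborel) = (\<integral>\<^sup>+s. (\<integral>\<^sup>+w. h (s, w) \<partial>Q) \<partial>restrict_space lborel {0..t})"
    by (subst nn_integral_restrict_space) auto
  then show ?thesis using Q.nn_integral_fst[OF assms(2)] by simp
qed

lemma nn_integral_time_iterated3:
  assumes Q: "sigma_finite_measure Q" and V: "sigma_finite_measure V"
    and h: "h \<in> borel_measurable (time_space (Q \<Otimes>\<^sub>M V) t)"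
  shows "(\<integral>\<^sup>+s\<in>{0..t}. (\<integral>\<^sup>+w. (\<integral>\<^sup>+y. h (s, w, y) \<partial>V) \<partial>Q) \<partial>lborel) =
    (\<integral>\<^sup>+z. h z \<partial>(time_space (Q \<Otimes>\<^sub>M V) t))"
proof -
  interpret Q: sigma_finite_measure Q by fact
  interpret V: sigma_finite_measure V by fact
  interpret pair_sigma_finite Q V ..
  have "(\<integral>\<^sup>+s\<in>{0..t}. (\<integral>\<^sup>+w. (\<integral>\<^sup>+y. h (s, w, y) \<partial>V) \<partial>Q) \<partial>lborel) =
      (\<integral>\<^sup>+s\<in>{0..t}. (\<integral>\<^sup>+z. h (s, z) \<partial>(Q \<Otimes>\<^sub>M V)) \<partial>lborel)"
  proof (rule nn_integral_cong)
    fix s :: real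
    have "(\<integral>\<^sup>+w. (\<integral>\<^sup>+y. h (s, w, y) \<partial>V) \<partial>Q) = (\<integral>\<^sup>+z. h (s, z) \<partial>(Q \<Otimes>\<^sub>M V))" if "s \<in> {0..t}"
    proof -
      have "(\<lambda>z. h (s, z)) \<in> borel_measurable (Q \<Otimes>\<^sub>M V)"
        by (rule measurable_Pair2[OF h]) (use that in \<open>simp add: space_restrict_space\<close>)
      from V.nn_integral_fst[OF this] show ?thesis by simp
    qed
    then show "(\<integral>\<^sup>+w. (\<integral>\<^sup>+y. h (s, w, y) \<partial>V) \<partial>Q) * indicator {0..t} s =
        (\<integral>\<^sup>+z. h (s, z) \<partial>(Q \<Otimes>\<^sub>M V)) * indicator {0..t} s"
      by (simp split: split_indicator)
  qed
  also have "\<dots> = (\<integral>\<^sup>+z. h z \<partial>(time_space (Q \<Otimes>\<^sub>M V) t))"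
    by (rule nn_integral_time_iterated[OF sigma_finite_measure_axioms h])
  finally show ?thesis .
qed

text \<open>Each integral comes with its own approximating sequence. Linearity is used only for
  simple integrands, where the isometry bounds the difference of the approximants;
  \<open>L2_limit_bound\<close> then passes to the limit.\<close>

lemma ito_integral_bound:
  fixes B :: "real \<Rightarrow> 'w \<Rightarrow> real^'l" and f f' :: "real \<Rightarrow> 'w \<Rightarrow> real^'l^'p"
  assumes basis: "complete_filtered_prob_space P \<F>" and B: "brownian_motion P \<F> B" and t: "0 \<le> t"
    and I: "has_ito_integral P \<F> B f t I" and I': "has_ito_integral P \<F> B f' t I'"
    and f: "(\<lambda>(s, w). f s w) \<in> borel_measurable (time_space P t)"
    and f': "(\<lambda>(s, w). f' s w) \<in> borel_measurable (time_space P t)"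
  shows "mean_sq P (\<lambda>w. I w - I' w) \<le>
    9 * ennreal (real CARD('p) * (real CARD('l))\<^sup>2) *
    (\<integral>\<^sup>+s\<in>{0..t}. mean_sq P (\<lambda>w. f s w - f' s w) \<partial>lborel)"
proof -
  interpret prob_space P using complete_filtered_prob_spaceD(1)[OF basis] .
  let ?M = "time_space P t"
  let ?C = "real CARD('p) * (real CARD('l))\<^sup>2"
  have iter: "(\<integral>\<^sup>+s\<in>{0..t}. mean_sq P (\<lambda>w. g s w - h s w) \<partial>lborel) =
      mean_sq ?M (\<lambda>z. (case z of (s, w) \<Rightarrow> g s w) - (case z of (s, w) \<Rightarrow> h s w))"
    if [measurable]: "(\<lambda>(s, w). g s w) \<in> borel_measurable ?M" "(\<lambda>(s, w). h s w) \<in> borel_measurable ?M"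
    for g h :: "real \<Rightarrow> 'w \<Rightarrow> real^'l^'p"
    using nn_integral_time_iterated[OF sigma_finite_measure_axioms,
        of "\<lambda>z. ennreal ((norm ((case z of (s, w) \<Rightarrow> g s w) - (case z of (s, w) \<Rightarrow> h s w)))\<^sup>2)" t]
    by simp
  obtain \<phi> where \<phi>: "\<And>k::nat. simple_process P \<F> (\<phi> k)"
    "(\<lambda>k. \<integral>\<^sup>+ s\<in>{0..t}. mean_sq P (\<lambda>w. f s w - simple_value (\<phi> k) s w) \<partial>lborel) \<longlonglongrightarrow> 0"
    "(\<lambda>k. \<integral>\<^sup>+ w. ennreal ((norm (I w - simple_ito_integral B (\<phi> k) t w))\<^sup>2) \<partial>P) \<longlonglongrightarrow> 0"
    using I unfolding has_ito_integral_def by blast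
  obtain \<psi> where \<psi>: "\<And>k::nat. simple_process P \<F> (\<psi> k)"
    "(\<lambda>k. \<integral>\<^sup>+ s\<in>{0..t}. mean_sq P (\<lambda>w. f' s w - simple_value (\<psi> k) s w) \<partial>lborel) \<longlonglongrightarrow> 0"
    "(\<lambda>k. \<integral>\<^sup>+ w. ennreal ((norm (I' w - simple_ito_integral B (\<psi> k) t w))\<^sup>2) \<partial>P) \<longlonglongrightarrow> 0"
    using I' unfolding has_ito_integral_def by blast
  \<comment> \<open>Appending the negated blocks of \<open>\<psi> k\<close> to those of
    \<open>\<phi> k\<close> represents the difference; since blocks may overlap, the result is again
    a simple process.\<close>
  define D where "D k = \<phi> k @ map (\<lambda>(a, b, \<xi>). (a, b, \<lambda>w. - \<xi> w)) (\<psi> k)" for k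
  have neg: "(\<Sum>(a, b, \<xi>)\<leftarrow>map (\<lambda>(a, b, \<xi>). (a, b, \<lambda>w. - \<xi> w)) L. h a b \<xi>) = - (\<Sum>(a, b, \<xi>)\<leftarrow>L. h a b \<xi>)"
    if "\<And>a b \<xi>. h a b (\<lambda>w. - \<xi> w) = - h a b \<xi>"
    for L and h :: "real \<Rightarrow> real \<Rightarrow> ('w \<Rightarrow> real^'l^'p) \<Rightarrow> 'c::ab_group_add"
    by (induction L) (auto simp: that)
  have D_simple: "simple_process P \<F> (D k)" for k
  proof -
    have "bounded ((\<lambda>w. - \<xi> w) ` space P)" if "bounded (\<xi> ` space P)" for \<xi> :: "'w \<Rightarrow> real^'l^'p"
      using that by (auto simp: bounded_iff)
    moreover have "(\<lambda>w. - \<xi> w) \<in> borel_measurable N" if "\<xi> \<in> borel_measurable N" for \<xi> :: "'w \<Rightarrow> real^'l^'p" and N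
      using that by simp
    ultimately show ?thesis using \<phi>(1)[of k] \<psi>(1)[of k]
      unfolding simple_process_def D_def by (auto simp: split_beta)
  qed
  have D_value: "simple_value (D k) s w = simple_value (\<phi> k) s w - simple_value (\<psi> k) s w" for k s w
    unfolding simple_value_def D_def map_append sum_list_append by (subst neg) auto
  have D_int: "simple_ito_integral B (D k) t w = simple_ito_integral B (\<phi> k) t w - simple_ito_integral B (\<psi> k) t w" for k w
    unfolding simple_ito_integral_def D_def map_append sum_list_append
    by (subst neg) (auto simp: matrix_vector_mult_def vec_eq_iff sum_negf)
  note S = simple_ito_integral_bound[OF basis B _ t]
  have "mean_sq P (\<lambda>w. I w - I' w) \<le>
    9 * ennreal ?C * mean_sq ?M (\<lambda>z. (case z of (s, w) \<Rightarrow> f s w) - (case z of (s, w) \<Rightarrow> f' s w))"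
  proof (rule L2_limit_bound)
    show "I \<in> borel_measurable P" "I' \<in> borel_measurable P"
      using I I' by (auto simp: has_ito_integral_def)
    show "(\<lambda>k. \<integral>\<^sup>+z. ennreal ((norm ((case z of (s, w) \<Rightarrow> f s w) - (case z of (s, w) \<Rightarrow> simple_value (\<phi> k) s w)))\<^sup>2) \<partial>?M) \<longlonglongrightarrow> 0"
      using \<phi>(2) by (subst iter[symmetric]) (auto intro: f S(2) \<phi>(1))
    show "(\<lambda>k. \<integral>\<^sup>+z. ennreal ((norm ((case z of (s, w) \<Rightarrow> f' s w) - (case z of (s, w) \<Rightarrow> simple_value (\<psi> k) s w)))\<^sup>2) \<partial>?M) \<longlonglongrightarrow> 0"
      using \<psi>(2) by (subst iter[symmetric]) (auto intro: f' S(2) \<psi>(1))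
    show "mean_sq P (\<lambda>x. simple_ito_integral B (\<phi> k) t x - simple_ito_integral B (\<psi> k) t x)
         \<le> ennreal ?C * mean_sq ?M (\<lambda>z. (case z of (s, w) \<Rightarrow> simple_value (\<phi> k) s w) -
             (case z of (s, w) \<Rightarrow> simple_value (\<psi> k) s w))" for k
      using S(3)[OF D_simple[of k]] unfolding D_value D_int
      by (subst iter[symmetric]) (auto intro: S(2) \<phi>(1) \<psi>(1))
  qed (use f f' S(1,2) \<phi> \<psi> in auto)
  then show ?thesis by (subst iter[OF f f'])
qed

lemma jump_integral_bound:
  fixes N :: "'w \<Rightarrow> (real \<times> (real^'p)) measure" and f f' :: "real \<Rightarrow> 'w \<Rightarrow> real^'p \<Rightarrow> real^'p"
  assumes basis: "complete_filtered_prob_space P \<F>" and v: "intensity_measure v"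
    and N: "poisson_random_measure P \<F> v N" and t: "0 \<le> t"
    and I: "has_jump_integral P \<F> v N c f t I" and I': "has_jump_integral P \<F> v N c f' t I'"
    and f: "(\<lambda>(s, w, y). f s w y) \<in>
      borel_measurable (time_space (P \<Otimes>\<^sub>M restrict_space v {y. norm y < c}) t)"
    and f': "(\<lambda>(s, w, y). f' s w y) \<in>
      borel_measurable (time_space (P \<Otimes>\<^sub>M restrict_space v {y. norm y < c}) t)"
  shows "mean_sq P (\<lambda>w. I w - I' w) \<le> 9 * ennreal (real CARD('p)) *
    (\<integral>\<^sup>+s\<in>{0..t}. (\<integral>\<^sup>+w. (\<integral>\<^sup>+y\<in>{y. norm y < c}. ennreal ((norm (f s w y - f' s w y))\<^sup>2) \<partial>v) \<partial>P) \<partial>lborel)"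
proof -
  interpret prob_space P using complete_filtered_prob_spaceD(1)[OF basis] .
  let ?V = "restrict_space v {y. norm y < c}"
  have sv: "sets v = sets borel" using v by (simp add: intensity_measure_def)
  \<comment> \<open>Tonelli over the marks requires this, as the restricted intensity may have
    infinite mass near the origin.\<close>
  have V: "sigma_finite_measure ?V"
    by (intro sigma_finite_measure_restrict_space intensity_measure_sigma_finite v) (simp add: sv)
  let ?M = "time_space (P \<Otimes>\<^sub>M ?V) t"
  let ?C = "real CARD('p)"
  have restr: "(\<integral>\<^sup>+y. h y \<partial>?V) = (\<integral>\<^sup>+y\<in>{y. norm y < c}. h y \<partial>v)" for h
    by (subst nn_integral_restrict_space) (auto simp: sv)
  have iter: "(\<integral>\<^sup>+s\<in>{0..t}. (\<integral>\<^sup>+w. (\<integral>\<^sup>+y\<in>{y. norm y < c}. ennreal ((norm (g s w y - h s w y))\<^sup>2) \<partial>v) \<partial>P) \<partial>lborel) =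
      mean_sq ?M (\<lambda>z. (case z of (s, w, y) \<Rightarrow> g s w y) - (case z of (s, w, y) \<Rightarrow> h s w y))"
    if "(\<lambda>(s, w, y). g s w y) \<in> borel_measurable ?M" "(\<lambda>(s, w, y). h s w y) \<in> borel_measurable ?M"
    for g h :: "real \<Rightarrow> 'w \<Rightarrow> real^'p \<Rightarrow> real^'p"
  proof -
    have "(\<lambda>z. ennreal ((norm ((case z of (s, w, y) \<Rightarrow> g s w y) - (case z of (s, w, y) \<Rightarrow> h s w y)))\<^sup>2)) \<in> borel_measurable ?M"
      by (rule measurable_compose[OF borel_measurable_diff[OF that], of "\<lambda>x. ennreal ((norm x)\<^sup>2)"]) measurable
    from nn_integral_time_iterated3[OF sigma_finite_measure_axioms V this] show ?thesis
      unfolding restr prod.case .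
  qed
  obtain \<phi> where \<phi>: "\<And>k::nat. simple_jump_process P \<F> v c (\<phi> k)"
    "(\<lambda>k. \<integral>\<^sup>+ s\<in>{0..t}. (\<integral>\<^sup>+ w. (\<integral>\<^sup>+y\<in>{y. norm y < c}. ennreal ((norm (f s w y - simple_jump_value (\<phi> k) s w y))\<^sup>2) \<partial>v) \<partial>P) \<partial>lborel) \<longlonglongrightarrow> 0"
    "(\<lambda>k. \<integral>\<^sup>+ w. ennreal ((norm (I w - simple_jump_integral v N (\<phi> k) t w))\<^sup>2) \<partial>P) \<longlonglongrightarrow> 0"
    using I unfolding has_jump_integral_def by blast
  obtain \<psi> where \<psi>: "\<And>k::nat. simple_jump_process P \<F> v c (\<psi> k)"
    "(\<lambda>k. \<integral>\<^sup>+ s\<in>{0..t}. (\<integral>\<^sup>+ w. (\<integral>\<^sup>+y\<in>{y. norm y < c}. ennreal ((norm (f' s w y - simple_jump_value (\<psi> k) s w y))\<^sup>2) \<partial>v) \<partial>P) \<partial>lborel) \<longlonglongrightarrow> 0"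
    "(\<lambda>k. \<integral>\<^sup>+ w. ennreal ((norm (I' w - simple_jump_integral v N (\<psi> k) t w))\<^sup>2) \<partial>P) \<longlonglongrightarrow> 0"
    using I' unfolding has_jump_integral_def by blast
  define D where "D k = \<phi> k @ map (\<lambda>(a, b, A, \<xi>). (a, b, A, \<lambda>w. - \<xi> w)) (\<psi> k)" for k
  have neg: "(\<Sum>(a, b, A, \<xi>)\<leftarrow>map (\<lambda>(a, b, A, \<xi>). (a, b, A, \<lambda>w. - \<xi> w)) L. h a b A \<xi>) = - (\<Sum>(a, b, A, \<xi>)\<leftarrow>L. h a b A \<xi>)"
    if "\<And>a b A \<xi>. h a b A (\<lambda>w. - \<xi> w) = - h a b A \<xi>"
    for L and h :: "real \<Rightarrow> real \<Rightarrow> (real^'p) set \<Rightarrow> ('w \<Rightarrow> real^'p) \<Rightarrow> 'c::ab_group_add"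
    by (induction L) (auto simp: that)
  have D_simple: "simple_jump_process P \<F> v c (D k)" for k
  proof -
    have "bounded ((\<lambda>w. - \<xi> w) ` space P)" if "bounded (\<xi> ` space P)" for \<xi> :: "'w \<Rightarrow> real^'p"
      using that by (auto simp: bounded_iff)
    moreover have "(\<lambda>w. - \<xi> w) \<in> borel_measurable N" if "\<xi> \<in> borel_measurable N" for \<xi> :: "'w \<Rightarrow> real^'p" and N
      using that by simp
    ultimately show ?thesis using \<phi>(1)[of k] \<psi>(1)[of k]
      unfolding simple_jump_process_def D_def by (fastforce simp: split_beta)
  qed
  have D_value: "simple_jump_value (D k) s w y = simple_jump_value (\<phi> k) s w y - simple_jump_value (\<psi> k) s w y" for k s w y
    unfolding simple_jump_value_def D_def map_append sum_list_append by (subst neg) auto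
  have D_int: "simple_jump_integral v N (D k) t w = simple_jump_integral v N (\<phi> k) t w - simple_jump_integral v N (\<psi> k) t w" for k w
    unfolding simple_jump_integral_def D_def map_append sum_list_append by (subst neg) auto
  note S = simple_jump_integral_bound[OF basis v N _ t]
  have "mean_sq P (\<lambda>w. I w - I' w) \<le>
    9 * ennreal ?C * mean_sq ?M (\<lambda>z. (case z of (s, w, y) \<Rightarrow> f s w y) - (case z of (s, w, y) \<Rightarrow> f' s w y))"
  proof (rule L2_limit_bound)
    show "I \<in> borel_measurable P" "I' \<in> borel_measurable P"
      using I I' by (auto simp: has_jump_integral_def)
    show "(\<lambda>k. \<integral>\<^sup>+z. ennreal ((norm ((case z of (s, w, y) \<Rightarrow> f s w y) - (case z of (s, w, y) \<Rightarrow> simple_jump_value (\<phi> k) s w y)))\<^sup>2) \<partial>?M) \<longlonglongrightarrow> 0"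
      using \<phi>(2) by (subst iter[symmetric]) (auto intro: f S(2) \<phi>(1))
    show "(\<lambda>k. \<integral>\<^sup>+z. ennreal ((norm ((case z of (s, w, y) \<Rightarrow> f' s w y) - (case z of (s, w, y) \<Rightarrow> simple_jump_value (\<psi> k) s w y)))\<^sup>2) \<partial>?M) \<longlonglongrightarrow> 0"
      using \<psi>(2) by (subst iter[symmetric]) (auto intro: f' S(2) \<psi>(1))
    show "mean_sq P (\<lambda>x. simple_jump_integral v N (\<phi> k) t x - simple_jump_integral v N (\<psi> k) t x)
         \<le> ennreal ?C * mean_sq ?M (\<lambda>z. (case z of (s, w, y) \<Rightarrow> simple_jump_value (\<phi> k) s w y) -
             (case z of (s, w, y) \<Rightarrow> simple_jump_value (\<psi> k) s w y))" for k
      using S(3)[OF D_simple[of k]] unfolding D_value D_int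
      by (subst iter[symmetric]) (auto intro: S(2) \<phi>(1) \<psi>(1))
  qed (use f f' S(1,2) \<phi> \<psi> in auto)
  then show ?thesis by (subst iter[OF f f'])
qed

section \<open>Square integrable processes\<close>

lemma borel_measurable_time_space:
  "borel_measurable (restrict_space borel A \<Otimes>\<^sub>M Q) = borel_measurable (restrict_space lborel A \<Otimes>\<^sub>M Q)"
  by (intro measurable_cong_sets sets_pair_measure_cong sets_restrict_space_cong) auto

text \<open>The squared Hilbert norm on [0, t], valued in \<open>ennreal\<close> and polymorphic in
  the value space: it covers the matrix-valued coefficient as well and can be estimated before
  integrability is known.\<close>

definition sq_integral :: "'w measure \<Rightarrow> real \<Rightarrow> (real \<Rightarrow> 'w \<Rightarrow> 'b::real_normed_vector) \<Rightarrow> ennreal" where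
  "sq_integral P t f = (\<integral>\<^sup>+s\<in>{0..t}. mean_sq P (f s) \<partial>lborel)"

text \<open>The switch happens at a deterministic time, so splicing two adapted processes gives an
  adapted one.\<close>

definition splice :: "real \<Rightarrow> (real \<Rightarrow> 'w \<Rightarrow> 'b) \<Rightarrow> (real \<Rightarrow> 'w \<Rightarrow> 'b) \<Rightarrow> real \<Rightarrow> 'w \<Rightarrow> 'b" where
  "splice t f g s w = (if s \<le> t then f s w else g s w)"

lemma sq_integral_eq:
  fixes f :: "real \<Rightarrow> 'w \<Rightarrow> 'b::{real_normed_vector, second_countable_topology}"
  assumes "sigma_finite_measure P" "(\<lambda>(s, w). f s w) \<in> borel_measurable (time_space P t)"
  shows "sq_integral P t f = mean_sq (time_space P t) (\<lambda>z. case z of (s, w) \<Rightarrow> f s w)"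
proof -
  have "(\<lambda>z. ennreal ((norm (case z of (s, w) \<Rightarrow> f s w))\<^sup>2)) \<in> borel_measurable (time_space P t)"
    by (rule measurable_compose[OF assms(2), of "\<lambda>x. ennreal ((norm x)\<^sup>2)"]) measurable
  from nn_integral_time_iterated[OF assms(1) this] show ?thesis
    unfolding sq_integral_def prod.case .
qed

lemma time_space_measurable_mono:
  assumes f: "(\<lambda>(s, w). f s w) \<in> borel_measurable (time_space P T)" and t: "t \<le> T"
  shows "(\<lambda>(s, w). f s w) \<in> borel_measurable (time_space P t)"
proof -
  have "(\<lambda>z. z) \<in> measurable (time_space P t) (time_space P T)"
    unfolding measurable_pair_iff
  proof
    have "fst \<in> measurable (time_space P t) (restrict_space lborel {0..t})" by (rule measurable_fst)
    moreover have "(\<lambda>s. s) \<in> measurable (restrict_space lborel {0..t}) (restrict_space lborel {0..T})"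
      using t by (intro measurable_restrict_space2 measurable_restrict_space1)
        (auto simp: space_restrict_space)
    ultimately show "fst \<circ> (\<lambda>z. z) \<in> measurable (time_space P t) (restrict_space lborel {0..T})"
      using measurable_compose by (auto simp: comp_def)
  qed (simp add: comp_def)
  from measurable_compose[OF this f] show ?thesis by simp
qed

lemma sq_integral_splice:
  assumes "t \<le> T"
  shows "sq_integral P T (splice t f (\<lambda>s w. 0)) = sq_integral P t f"
  unfolding sq_integral_def splice_def using assms
  by (intro nn_integral_cong) (auto split: split_indicator)

text \<open>The hypothesis is stated for iterated null sets, since this is how the almost-sure relations
  between processes are given.\<close>

lemma sq_integral_le:
  fixes g h k :: "real \<Rightarrow> 'w \<Rightarrow> 'b::{real_normed_vector, second_countable_topology}"
  assumes P: "sigma_finite_measure P"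
    and m: "(\<lambda>(s, w). g s w) \<in> borel_measurable (time_space P t)"
      "(\<lambda>(s, w). h s w) \<in> borel_measurable (time_space P t)"
      "(\<lambda>(s, w). k s w) \<in> borel_measurable (time_space P t)"
    and nn: "0 \<le> a" "0 \<le> b" "0 \<le> c"
    and le: "AE s in lborel. s \<in> {0..t} \<longrightarrow> (AE w in P. (norm (f s w))\<^sup>2 \<le>
      a * (norm (g s w))\<^sup>2 + b * (norm (h s w))\<^sup>2 + c * (norm (k s w))\<^sup>2)"
  shows "sq_integral P t f \<le>
    ennreal a * sq_integral P t g + ennreal b * sq_integral P t h + ennreal c * sq_integral P t k"
proof -
  let ?r = "\<lambda>z. ennreal a * ennreal ((norm (case z of (s, w) \<Rightarrow> g s w))\<^sup>2) +
    ennreal b * ennreal ((norm (case z of (s, w) \<Rightarrow> h s w))\<^sup>2) +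
    ennreal c * ennreal ((norm (case z of (s, w) \<Rightarrow> k s w))\<^sup>2)"
  have nm: "(\<lambda>z. ennreal ((norm (case z of (s, w) \<Rightarrow> f s w))\<^sup>2)) \<in> borel_measurable (time_space P t)"
    if "(\<lambda>(s, w). f s w) \<in> borel_measurable (time_space P t)" for f :: "real \<Rightarrow> 'w \<Rightarrow> 'b"
    by (rule measurable_compose[OF that, of "\<lambda>x. ennreal ((norm x)\<^sup>2)"]) measurable
  note nm' = m[THEN nm]
  have rm: "?r \<in> borel_measurable (time_space P t)"
    using nm' by simp
  \<comment> \<open>Tonelli is applied to the majorant only; \<open>f\<close> enters through
    monotonicity of the iterated integral.\<close>
  have "sq_integral P t f \<le> (\<integral>\<^sup>+s\<in>{0..t}. (\<integral>\<^sup>+w. ?r (s, w) \<partial>P) \<partial>lborel)"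
    unfolding sq_integral_def
  proof (rule nn_integral_mono_AE, use le in eventually_elim)
    case (elim s)
    have "mean_sq P (f s) \<le> (\<integral>\<^sup>+w. ?r (s, w) \<partial>P)" if "s \<in> {0..t}"
    proof (rule nn_integral_mono_AE, use elim[rule_format, OF that] in eventually_elim)
      case (elim w)
      then have "ennreal ((norm (f s w))\<^sup>2) \<le>
          ennreal (a * (norm (g s w))\<^sup>2 + b * (norm (h s w))\<^sup>2 + c * (norm (k s w))\<^sup>2)"
        by (rule ennreal_leI)
      then show ?case using nn by (simp add: ennreal_mult)
    qed
    then show ?case by (simp split: split_indicator)
  qed
  also have "\<dots> = (\<integral>\<^sup>+z. ?r z \<partial>time_space P t)"
    by (rule nn_integral_time_iterated[OF P rm])
  also have "\<dots> = ennreal a * sq_integral P t g + ennreal b * sq_integral P t h + ennreal c * sq_integral P t k"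
    unfolding sq_integral_eq[OF P m(1)] sq_integral_eq[OF P m(2)] sq_integral_eq[OF P m(3)]
    using nm' by (simp add: nn_integral_add nn_integral_cmult)
  finally show ?thesis .
qed

section \<open>Closure properties and inner product of the process space\<close>

lemma L2adD:
  assumes "f \<in> L2ad P \<F> T"
  shows "(\<lambda>(s, w). f s w) \<in> borel_measurable (time_space P T)" "sq_integral P T f < \<infinity>"
    "t \<in> {0..T} \<Longrightarrow> f t \<in> borel_measurable (\<F> t)"
  using assms unfolding L2ad_def sq_integral_def borel_measurable_time_space by auto

lemma L2adI:
  assumes "(\<lambda>(s, w). f s w) \<in> borel_measurable (time_space P T)" "sq_integral P T f < \<infinity>"
    "\<And>t. t \<in> {0..T} \<Longrightarrow> f t \<in> borel_measurable (\<F> t)"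
  shows "f \<in> L2ad P \<F> T"
  using assms unfolding L2ad_def sq_integral_def borel_measurable_time_space by auto

lemma L2ad_measurable_mono:
  "f \<in> L2ad P \<F> T \<Longrightarrow> t \<le> T \<Longrightarrow> (\<lambda>(s, w). f s w) \<in> borel_measurable (time_space P t)"
  using time_space_measurable_mono[OF L2adD(1)] .

lemma sq_integral_mono_time: "t \<le> T \<Longrightarrow> sq_integral P t f \<le> sq_integral P T f"
  unfolding sq_integral_def by (intro nn_integral_mono) (auto split: split_indicator)

lemma L2ad_lincomb:
  assumes P: "sigma_finite_measure P" and f: "f \<in> L2ad P \<F> T" "g \<in> L2ad P \<F> T"
  shows "(\<lambda>s w. a *\<^sub>R f s w + b *\<^sub>R g s w) \<in> L2ad P \<F> T"
proof (rule L2adI)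
  have "(\<lambda>z. a *\<^sub>R (case z of (s, w) \<Rightarrow> f s w) + b *\<^sub>R (case z of (s, w) \<Rightarrow> g s w)) \<in> borel_measurable (time_space P T)"
    by (intro borel_measurable_add borel_measurable_scaleR borel_measurable_const f[THEN L2adD(1)])
  then show m: "(\<lambda>(s, w). a *\<^sub>R f s w + b *\<^sub>R g s w) \<in> borel_measurable (time_space P T)"
    by (simp add: split_beta)
  show "(\<lambda>w. a *\<^sub>R f t w + b *\<^sub>R g t w) \<in> borel_measurable (\<F> t)" if "t \<in> {0..T}" for t
    using f[THEN L2adD(3), OF that] by (intro borel_measurable_add borel_measurable_scaleR borel_measurable_const)
  have "sq_integral P T (\<lambda>s w. a *\<^sub>R f s w + b *\<^sub>R g s w) \<le>
      ennreal (2 * a\<^sup>2) * sq_integral P T f + ennreal (2 * b\<^sup>2) * sq_integral P T g + ennreal 0 * sq_integral P T g"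
    by (rule sq_integral_le[OF P f(1)[THEN L2adD(1)] f(2)[THEN L2adD(1)] f(2)[THEN L2adD(1)]])
      (use norm_add_sq_le[where ?'a="real^'b"] in \<open>auto intro!: AE_I2 order_trans[OF norm_add_sq_le] simp: power_mult_distrib\<close>)
  also have "\<dots> < \<infinity>" using f[THEN L2adD(2)] by (simp add: ennreal_mult_less_top less_top)
  finally show "sq_integral P T (\<lambda>s w. a *\<^sub>R f s w + b *\<^sub>R g s w) < \<infinity>" .
qed

lemma L2ad_diff:
  assumes "sigma_finite_measure P" "f \<in> L2ad P \<F> T" "g \<in> L2ad P \<F> T"
  shows "(\<lambda>s w. f s w - g s w) \<in> L2ad P \<F> T"
  using L2ad_lincomb[OF assms, of 1 "-1"] by simp

lemma L2ad_splice:
  assumes P: "sigma_finite_measure P" and f: "f \<in> L2ad P \<F> T" "g \<in> L2ad P \<F> T"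
  shows "splice t f g \<in> L2ad P \<F> T"
proof (rule L2adI)
  have "Measurable.pred (restrict_space lborel {0..T}) (\<lambda>s. s \<le> t)"
    by (intro measurable_restrict_space1) measurable
  then have "Measurable.pred (time_space P T) (\<lambda>z. fst z \<le> t)"
    using measurable_compose[OF measurable_fst] by blast
  then have "(\<lambda>z. if fst z \<le> t then (case z of (s, w) \<Rightarrow> f s w) else (case z of (s, w) \<Rightarrow> g s w)) \<in> borel_measurable (time_space P T)"
    by (intro measurable_If f[THEN L2adD(1)]) (auto simp: pred_def)
  moreover have "(\<lambda>(s, w). splice t f g s w) =
      (\<lambda>z. if fst z \<le> t then (case z of (s, w) \<Rightarrow> f s w) else (case z of (s, w) \<Rightarrow> g s w))"
    by (auto simp: fun_eq_iff splice_def)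
  ultimately show "(\<lambda>(s, w). splice t f g s w) \<in> borel_measurable (time_space P T)"
    by simp
  show "splice t f g s \<in> borel_measurable (\<F> s)" if "s \<in> {0..T}" for s
    using f[THEN L2adD(3), OF that] by (cases "s \<le> t") (auto simp: splice_def[abs_def])
  have "sq_integral P T (splice t f g) \<le>
      ennreal 1 * sq_integral P T f + ennreal 1 * sq_integral P T g + ennreal 0 * sq_integral P T g"
    by (rule sq_integral_le[OF P f(1)[THEN L2adD(1)] f(2)[THEN L2adD(1)] f(2)[THEN L2adD(1)]])
      (auto simp: splice_def)
  also have "\<dots> < \<infinity>" using f[THEN L2adD(2)] by (simp add: less_top)
  finally show "sq_integral P T (splice t f g) < \<infinity>" .
qed

text \<open>\<open>H_inner\<close> is an iterated Bochner integral, which is linear only for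
  integrable arguments. On the product space the sum of the two squared norms dominates the inner
  product, so Fubini applies and algebra becomes available.\<close>

lemma H_inner_eq:
  fixes f g :: "real \<Rightarrow> 'w \<Rightarrow> real^'p"
  assumes "prob_space P" and f: "f \<in> L2ad P \<F> T" "g \<in> L2ad P \<F> T"
  shows "integrable (time_space P T) (\<lambda>z. (case z of (s, w) \<Rightarrow> f s w) \<bullet> (case z of (s, w) \<Rightarrow> g s w))"
    and "H_inner P T f g = (LINT z|time_space P T. (case z of (s, w) \<Rightarrow> f s w) \<bullet> (case z of (s, w) \<Rightarrow> g s w))"
proof -
  interpret prob_space P by fact
  have sf: "sigma_finite_measure P" ..
  interpret L: sigma_finite_measure "restrict_space lborel {0..T}"
    by (intro sigma_finite_measure_restrict_space sigma_finite_lborel) simp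
  interpret pair_sigma_finite "restrict_space lborel {0..T}" P ..
  note m = f[THEN L2adD(1)]
  have int: "integrable (time_space P T) (\<lambda>z. (norm (case z of (s, w) \<Rightarrow> h s w))\<^sup>2)" if "h \<in> L2ad P \<F> T" for h :: "real \<Rightarrow> 'w \<Rightarrow> real^'p"
  proof (rule integrableI_nonneg)
    show "(\<lambda>z. (norm (case z of (s, w) \<Rightarrow> h s w))\<^sup>2) \<in> borel_measurable (time_space P T)"
      by (rule measurable_compose[OF L2adD(1)[OF that], of "\<lambda>x. (norm x)\<^sup>2"]) measurable
    show "mean_sq (time_space P T) (\<lambda>z. case z of (s, w) \<Rightarrow> h s w) < \<infinity>"
      using L2adD(2)[OF that] sq_integral_eq[OF sf L2adD(1)[OF that]] by simp
  qed simp
  show i: "integrable (time_space P T) (\<lambda>z. (case z of (s, w) \<Rightarrow> f s w) \<bullet> (case z of (s, w) \<Rightarrow> g s w))"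
  proof (rule Bochner_Integration.integrable_bound)
    show "integrable (time_space P T) (\<lambda>z. (norm (case z of (s, w) \<Rightarrow> f s w))\<^sup>2 + (norm (case z of (s, w) \<Rightarrow> g s w))\<^sup>2)"
      by (intro Bochner_Integration.integrable_add int f)
    show "(\<lambda>z. (case z of (s, w) \<Rightarrow> f s w) \<bullet> (case z of (s, w) \<Rightarrow> g s w)) \<in> borel_measurable (time_space P T)"
      by (rule borel_measurable_inner[OF m])
    have "\<bar>x \<bullet> y\<bar> \<le> \<bar>(norm x)\<^sup>2 + (norm y)\<^sup>2\<bar>" for x y :: "real^'p"
    proof -
      have "\<bar>x \<bullet> y\<bar> \<le> norm x * norm y" by (rule Cauchy_Schwarz_ineq2)
      also have "\<dots> \<le> (norm x)\<^sup>2 + (norm y)\<^sup>2"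
        using sum_squares_bound[of "norm x" "norm y"] mult_nonneg_nonneg[OF norm_ge_zero[of x] norm_ge_zero[of y]] by linarith
      finally show ?thesis by simp
    qed
    then show "AE z in time_space P T. norm ((case z of (s, w) \<Rightarrow> f s w) \<bullet> (case z of (s, w) \<Rightarrow> g s w)) \<le>
      norm ((norm (case z of (s, w) \<Rightarrow> f s w))\<^sup>2 + (norm (case z of (s, w) \<Rightarrow> g s w))\<^sup>2)"
      by (intro AE_I2) simp
  qed
  show "H_inner P T f g = (LINT z|time_space P T. (case z of (s, w) \<Rightarrow> f s w) \<bullet> (case z of (s, w) \<Rightarrow> g s w))"
    unfolding integral_fst'[OF i, symmetric] H_inner_def
    by (subst integral_restrict_space) (auto simp: set_lebesgue_integral_def)
qed

lemma sq_integral_H_norm: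
  fixes f :: "real \<Rightarrow> 'w \<Rightarrow> real^'p"
  assumes P: "prob_space P" and f: "f \<in> L2ad P \<F> T"
  shows "sq_integral P T f = ennreal (H_inner P T f f)" "sq_integral P T f = ennreal ((H_norm P T f)\<^sup>2)"
    "0 \<le> H_norm P T f" "H_inner P T f f = (H_norm P T f)\<^sup>2"
proof -
  interpret prob_space P by fact
  show 1: "sq_integral P T f = ennreal (H_inner P T f f)"
    unfolding sq_integral_eq[OF sigma_finite_measure_axioms L2adD(1)[OF f]] H_inner_eq(2)[OF P f f]
    using H_inner_eq(1)[OF P f f]
    by (subst nn_integral_eq_integral) (auto simp: power2_norm_eq_inner split_beta)
  have "0 \<le> H_inner P T f f" unfolding H_inner_eq(2)[OF P f f]
    by (rule Bochner_Integration.integral_nonneg) simp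
  then show "0 \<le> H_norm P T f" "sq_integral P T f = ennreal ((H_norm P T f)\<^sup>2)" "H_inner P T f f = (H_norm P T f)\<^sup>2"
    using 1 by (auto simp: H_norm_def)
qed

text \<open>Applied with \<open>f\<close> a difference of controls and \<open>g\<close> the
  difference of the values of \<open>F\<close>: strong monotonicity bounds the cross term from
  below, the Lipschitz condition the last term from above.\<close>

lemma H_norm_sq_diff:
  fixes f g :: "real \<Rightarrow> 'w \<Rightarrow> real^'p"
  assumes P: "prob_space P" and f: "f \<in> L2ad P \<F> T" "g \<in> L2ad P \<F> T"
  shows "sq_integral P T (\<lambda>s w. f s w - r *\<^sub>R g s w) =
    ennreal ((H_norm P T f)\<^sup>2 - 2 * r * H_inner P T g f + r\<^sup>2 * (H_norm P T g)\<^sup>2)"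
proof -
  interpret prob_space P by fact
  have d: "(\<lambda>s w. f s w - r *\<^sub>R g s w) \<in> L2ad P \<F> T"
    using L2ad_lincomb[OF sigma_finite_measure_axioms f, of 1 "- r"] by simp
  let ?f = "\<lambda>z. case z of (s, w) \<Rightarrow> f s w" and ?g = "\<lambda>z. case z of (s, w) \<Rightarrow> g s w"
  have "H_inner P T (\<lambda>s w. f s w - r *\<^sub>R g s w) (\<lambda>s w. f s w - r *\<^sub>R g s w) =
      (LINT z|time_space P T. ?f z \<bullet> ?f z - 2 * r * (?g z \<bullet> ?f z) + r\<^sup>2 * (?g z \<bullet> ?g z))"
    unfolding H_inner_eq(2)[OF P d d]
    by (intro Bochner_Integration.integral_cong)
      (auto simp: inner_diff_left inner_diff_right inner_commute power2_eq_square algebra_simps)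
  also have "\<dots> = H_inner P T f f - 2 * r * H_inner P T g f + r\<^sup>2 * H_inner P T g g"
    unfolding H_inner_eq(2)[OF P f(1) f(1)] H_inner_eq(2)[OF P f(2) f(1)] H_inner_eq(2)[OF P f(2) f(2)]
    using H_inner_eq(1)[OF P f(1) f(1)] H_inner_eq(1)[OF P f(2) f(1)] H_inner_eq(1)[OF P f(2) f(2)]
    by (simp del: inner_real_def)
  finally show ?thesis
    using sq_integral_H_norm[OF P d] sq_integral_H_norm(4)[OF P f(1)] sq_integral_H_norm(4)[OF P f(2)] by simp
qed

section \<open>The variational inequality\<close>

text \<open>Expanding the squared distance from \<open>u - \<rho> f\<close> to \<open>w\<close>
  around \<open>u\<close>, the cross term is \<open>2 \<rho>\<close> times the left-hand side of the
  inequality, hence nonnegative, and \<open>u\<close> is a nearest point of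
  \<open>K\<close>.\<close>

lemma variational_inequality_closest_point:
  fixes K :: "'a::euclidean_space set"
  assumes "closed K" "convex K" "u \<in> K" "0 \<le> \<rho>" and vi: "\<forall>w\<in>K. f \<bullet> (w - u) \<ge> 0"
  shows "u = closest_point K (u - \<rho> *\<^sub>R f)"
proof (rule closest_point_unique[OF assms(2,1,3)], rule ballI)
  fix w assume "w \<in> K"
  have "(dist (u - \<rho> *\<^sub>R f) u)\<^sup>2 \<le> (norm (w - u))\<^sup>2 + 2 * \<rho> * (f \<bullet> (w - u)) + (dist (u - \<rho> *\<^sub>R f) u)\<^sup>2"
    using vi \<open>w \<in> K\<close> \<open>0 \<le> \<rho>\<close> by simp
  also have "\<dots> = (dist (u - \<rho> *\<^sub>R f) w)\<^sup>2"
    by (simp add: dist_norm power2_norm_eq_inner inner_diff_left inner_diff_right inner_commute algebra_simps)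
      (simp add: power2_eq_square)
  finally show "dist (u - \<rho> *\<^sub>R f) u \<le> dist (u - \<rho> *\<^sub>R f) w"
    by (rule power2_le_imp_le) simp
qed

text \<open>The projection is nonexpansive and fixes \<open>0\<close>.\<close>

lemma norm_closest_point_le:
  fixes K :: "'a::euclidean_space set"
  assumes "closed K" "convex K" "0 \<in> K"
  shows "norm (closest_point K z) \<le> norm z"
  using closest_point_lipschitz[OF assms(2,1), of z 0] closest_point_self[OF assms(3)] assms(3) by auto

text \<open>If the projections stayed away from \<open>?q\<close> along a subsequence, the bound by
  \<open>norm z\<close> and compactness of balls would give a limit point \<open>l\<close>. Strong
  convergence is weak convergence, so the second Mosco condition puts \<open>l\<close> into
  \<open>C0\<close>; a recovery sequence for \<open>?q\<close> shows that \<open>l\<close> is no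
  farther from \<open>z\<close> than \<open>?q\<close>, and uniqueness of the nearest point gives
  \<open>l = ?q\<close>.\<close>

lemma mosco_closest_point_tendsto:
  fixes C :: "nat \<Rightarrow> 'a::euclidean_space set"
  assumes C: "\<And>n. closed (C n)" "\<And>n. convex (C n)" "\<And>n. 0 \<in> C n"
    and C0: "closed C0" "convex C0" "0 \<in> C0" and mosco: "mosco_converges C C0"
  shows "(\<lambda>n. closest_point (C n) z) \<longlonglongrightarrow> closest_point C0 z"
proof (rule ccontr)
  let ?p = "\<lambda>n. closest_point (C n) z" and ?q = "closest_point C0 z"
  assume "\<not> ?p \<longlonglongrightarrow> ?q"
  then obtain e where e: "0 < e" "\<not> (\<exists>N. \<forall>n\<ge>N. dist (?p n) ?q < e)"
    unfolding lim_sequentially by blast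
  then have "infinite {n. dist (?p n) ?q \<ge> e}"
    unfolding infinite_nat_iff_unbounded_le by (metis linorder_not_less mem_Collect_eq)
  from infinite_enumerate[OF this] obtain r :: "nat \<Rightarrow> nat" where r: "strict_mono r" "\<forall>n. dist (?p (r n)) ?q \<ge> e" by auto
  have "\<forall>n. ?p (r n) \<in> cball 0 (norm z)"
    using norm_closest_point_le[OF C] by simp
  then obtain l r' where l: "strict_mono r'" "((\<lambda>n. ?p (r n)) \<circ> r') \<longlonglongrightarrow> l"
    using compact_imp_seq_compact[OF compact_cball] unfolding seq_compact_def by metis
  define s where "s = r \<circ> r'"
  have s: "strict_mono s" unfolding s_def using r(1) l(1) by (rule strict_mono_o)
  have lim: "(\<lambda>i. ?p (s i)) \<longlonglongrightarrow> l" using l(2) by (simp add: s_def comp_def)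
  have "?p n \<in> C n" for n using closest_point_in_set[OF C(1)] C(3) by blast
  moreover have "weakly_converges (\<lambda>i. ?p (s i)) l"
    unfolding weakly_converges_def using lim by (auto intro: tendsto_intros)
  ultimately have "l \<in> C0"
    using mosco s unfolding mosco_converges_def
    by (elim conjE allE[of _ s] allE[of _ "\<lambda>i. ?p (s i)"] allE[of _ l]) auto
  have "?q \<in> C0" using closest_point_in_set[OF C0(1)] C0(3) by blast
  then obtain w where w: "\<And>n. w n \<in> C n" "w \<longlonglongrightarrow> ?q"
    using mosco unfolding mosco_converges_def by blast
  have "dist z l \<le> dist z ?q"
  proof (rule LIMSEQ_le)
    show "(\<lambda>i. dist z (?p (s i))) \<longlonglongrightarrow> dist z l" by (intro tendsto_intros lim)
    show "(\<lambda>i. dist z (w (s i))) \<longlonglongrightarrow> dist z ?q"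
      using LIMSEQ_subseq_LIMSEQ[OF w(2) s] by (intro tendsto_intros) (simp add: comp_def)
    show "\<exists>N. \<forall>n\<ge>N. dist z (?p (s n)) \<le> dist z (w (s n))"
      using closest_point_le[OF C(1) w(1)] by blast
  qed
  then have "\<forall>y\<in>C0. dist z l \<le> dist z y"
    using closest_point_le[OF C0(1)] by (meson order_trans)
  then have "l = ?q" using closest_point_unique[OF C0(2,1) \<open>l \<in> C0\<close>] by blast
  moreover have "e \<le> dist l ?q"
    by (rule LIMSEQ_le_const[OF tendsto_dist[OF lim tendsto_const]]) (use r in \<open>auto simp: s_def\<close>)
  ultimately show False using e(1) by simp
qed

lemma sq_integral_bounded:
  assumes P: "prob_space P" and t: "0 \<le> t" and b: "\<And>s w. s \<in> {0..t} \<Longrightarrow> w \<in> space P \<Longrightarrow> norm (f s w) \<le> \<epsilon>"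
  shows "sq_integral P t f \<le> ennreal (\<epsilon>\<^sup>2 * t)"
proof -
  interpret prob_space P by fact
  have "sq_integral P t f \<le> (\<integral>\<^sup>+s. ennreal (\<epsilon>\<^sup>2) * indicator {0..t} s \<partial>lborel)"
    unfolding sq_integral_def
  proof (rule nn_integral_mono)
    fix s
    have "mean_sq P (f s) \<le> ennreal (\<epsilon>\<^sup>2)" if "s \<in> {0..t}"
    proof -
      have "mean_sq P (f s) \<le> (\<integral>\<^sup>+w. ennreal (\<epsilon>\<^sup>2) \<partial>P)"
        using b[OF that] by (intro nn_integral_mono ennreal_leI power_mono) auto
      then show ?thesis by (simp add: emeasure_space_1)
    qed
    then show "mean_sq P (f s) * indicator {0..t} s \<le> ennreal (\<epsilon>\<^sup>2) * indicator {0..t} s"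
      by (simp split: split_indicator)
  qed
  also have "\<dots> = ennreal (\<epsilon>\<^sup>2 * t)"
    using t by (subst nn_integral_cmult_indicator) (auto simp: ennreal_mult)
  finally show ?thesis .
qed

text \<open>Young's inequality. The weight is needed because the plain factor 2 on the square of the
  contracted term could destroy the contraction.\<close>

lemma sq_add_le_weighted:
  fixes a b s :: real
  assumes "0 < s"
  shows "(a + b)\<^sup>2 \<le> (1 + s) * a\<^sup>2 + (1 + 1 / s) * b\<^sup>2"
proof -
  have "2 * a * b \<le> s * a\<^sup>2 + b\<^sup>2 / s"
  proof -
    have "0 \<le> (s * a - b)\<^sup>2 / s" using assms by simp
    also have "\<dots> = s * a\<^sup>2 - 2 * a * b + b\<^sup>2 / s"
      using assms by (simp add: power2_eq_square field_simps)
    finally show ?thesis by simp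
  qed
  then show ?thesis by (simp add: power2_sum algebra_simps)
qed

text \<open>For \<open>\<rho> = c / L\<^sup>2\<close> and \<open>s = c\<^sup>2 / L\<^sup>2\<close> the contraction has squared factor \<open>1 - s\<close>; the constant
  arises by absorbing \<open>(1 + s) (1 - s) = 1 - s\<^sup>2\<close> into the left-hand side.\<close>

definition vi_constant :: "real \<Rightarrow> real \<Rightarrow> real" where
  "vi_constant c L = (let s = c\<^sup>2 / L\<^sup>2; \<rho> = c / L\<^sup>2 in
     2 * (1 + 1 / s) * (2 * \<rho>\<^sup>2 + 2 * \<rho>\<^sup>2 * L\<^sup>2 + 1) / s\<^sup>2)"

lemma vi_constant_pos: "0 < c \<Longrightarrow> 0 < L \<Longrightarrow> 0 < vi_constant c L"
  by (auto simp: vi_constant_def Let_def intro!: divide_pos_pos mult_pos_pos add_pos_pos)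

text \<open>Since \<open>F\<close> acts pointwise in time, splicing processes at time \<open>t\<close> transfers the Lipschitz and
  monotonicity conditions from \<open>[0, T]\<close> to \<open>[0, t]\<close>.\<close>

lemma variational_inequality_stability:
  fixes F F' :: "real \<Rightarrow> 'w \<Rightarrow> real^'p \<Rightarrow> real^'p \<Rightarrow> real^'p"
  assumes P: "prob_space P" and t: "0 \<le> t" "t \<le> T"
    and F_L2: "\<And>f g. f \<in> L2ad P \<F> T \<Longrightarrow> g \<in> L2ad P \<F> T \<Longrightarrow>
          (\<lambda>s w. F s w (f s w) (g s w)) \<in> L2ad P \<F> T"
    and F'_L2: "(\<lambda>s w. F' s w (x' s w) (u' s w)) \<in> L2ad P \<F> T"
    and F_lipschitz: "\<And>f1 f2 g1 g2.
          f1 \<in> L2ad P \<F> T \<Longrightarrow> f2 \<in> L2ad P \<F> T \<Longrightarrow> g1 \<in> L2ad P \<F> T \<Longrightarrow> g2 \<in> L2ad P \<F> T \<Longrightarrow>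
          H_dist P T (\<lambda>s w. F s w (f1 s w) (g1 s w)) (\<lambda>s w. F s w (f2 s w) (g2 s w))
            \<le> L * (H_dist P T f1 f2 + H_dist P T g1 g2)"
    and F_monotone: "\<And>f g1 g2.
          f \<in> L2ad P \<F> T \<Longrightarrow> g1 \<in> L2ad P \<F> T \<Longrightarrow> g2 \<in> L2ad P \<F> T \<Longrightarrow>
          H_inner P T
            (\<lambda>s w. F s w (f s w) (g1 s w) - F s w (f s w) (g2 s w))
            (\<lambda>s w. g1 s w - g2 s w)
            \<ge> c * (H_dist P T g1 g2)\<^sup>2"
    and cL: "0 < c" "c < L"
    and close: "\<And>s w x u. s \<in> {0..T} \<Longrightarrow> w \<in> space P \<Longrightarrow> norm (F' s w x u - F s w x u) \<le> \<epsilon>"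
    and K: "closed K" "convex K" "K \<noteq> {}" and K': "closed K'" "convex K'" "K' \<noteq> {}"
    and xu: "x \<in> L2ad P \<F> T" "u \<in> L2ad P \<F> T" "x' \<in> L2ad P \<F> T" "u' \<in> L2ad P \<F> T"
    and \<rho>: "\<rho> = c / L\<^sup>2"
    and u: "AE s in lborel. s \<in> {0..T} \<longrightarrow> (AE w in P.
        u s w = closest_point K (u s w - \<rho> *\<^sub>R F s w (x s w) (u s w)))"
    and u': "AE s in lborel. s \<in> {0..T} \<longrightarrow> (AE w in P.
        u' s w = closest_point K' (u' s w - \<rho> *\<^sub>R F' s w (x' s w) (u' s w)))"
  defines "z \<equiv> \<lambda>s w. u s w - \<rho> *\<^sub>R F s w (x s w) (u s w)"
  shows "sq_integral P t (\<lambda>s w. u' s w - u s w) \<le> ennreal (vi_constant c L) *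
    (sq_integral P t (\<lambda>s w. x' s w - x s w) + ennreal (\<epsilon>\<^sup>2 * T) +
     sq_integral P T (\<lambda>s w. closest_point K' (z s w) - closest_point K (z s w)))"
proof -
  interpret prob_space P by fact
  have sf: "sigma_finite_measure P" ..
  define s0 where "s0 = c\<^sup>2 / L\<^sup>2"
  have L0: "0 < L" using cL by simp
  have "c\<^sup>2 < L\<^sup>2" using cL by (intro power_strict_mono) auto
  then have s0: "0 < s0" "s0 < 1" using cL L0 by (auto simp: s0_def)
  have \<rho>0: "0 < \<rho>" using cL L0 by (simp add: \<rho>)
  \<comment> \<open>With \<open>z'\<close> for the perturbed analogue of \<open>z\<close>,
    \<open>z' - z = V - \<rho> W\<close>. \<open>V\<close> changes only the control inside the limit
    operator, and the contraction acts there; \<open>W\<close> collects the change of state and of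
    operator at the control \<open>u'\<close>. Almost everywhere \<open>U\<close> is the difference
    of the projections of \<open>z'\<close> and \<open>z\<close> onto the same set
    \<open>K'\<close>, plus the projection error \<open>q\<close>.\<close>
  define U X V W q where
    "U s w = u' s w - u s w" and
    "X s w = x' s w - x s w" and
    "V s w = (u' s w - u s w) - \<rho> *\<^sub>R (F s w (x s w) (u' s w) - F s w (x s w) (u s w))" and
    "W s w = F' s w (x' s w) (u' s w) - F s w (x s w) (u' s w)" and
    "q s w = closest_point K' (z s w) - closest_point K (z s w)" for s w
  note diff = L2ad_diff[OF sf]
  have U: "U \<in> L2ad P \<F> T" and X: "X \<in> L2ad P \<F> T" and W: "W \<in> L2ad P \<F> T"
    unfolding U_def X_def W_def by (intro diff F_L2 F'_L2 xu)+
  have V: "V \<in> L2ad P \<F> T"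
    using L2ad_lincomb[OF sf diff[OF xu(4,2)] diff[OF F_L2[OF xu(1,4)] F_L2[OF xu(1,2)]], of 1 "- \<rho>"]
    by (simp add: V_def[abs_def])
  have z: "z \<in> L2ad P \<F> T"
    using L2ad_lincomb[OF sf xu(2) F_L2[OF xu(1,2)], of 1 "- \<rho>"] by (simp add: z_def)
  have q: "(\<lambda>(s, w). q s w) \<in> borel_measurable (time_space P T)"
  proof -
    have cp: "closest_point S \<in> borel_measurable borel" if "closed S" "convex S" "S \<noteq> {}" for S :: "(real^'p) set"
      using that by (intro borel_measurable_continuous_onI continuous_on_closest_point)
    have "(\<lambda>y. closest_point K' y - closest_point K y) \<in> borel_measurable borel"
      by (intro borel_measurable_diff cp K K')
    from measurable_compose[OF L2adD(1)[OF z] this] show ?thesis by (simp add: q_def split_beta)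
  qed
  have fin: "sq_integral P t U < \<infinity>" "sq_integral P t X < \<infinity>"
    using L2adD(2)[OF U] L2adD(2)[OF X] sq_integral_mono_time[OF t(2)] by (metis order_le_less_trans)+
  \<comment> \<open>Used when only one argument of \<open>F\<close> changes: the other distance in
    the Lipschitz bound drops out.\<close>
  have zero: "H_dist P T f f = 0" for f :: "real \<Rightarrow> 'w \<Rightarrow> real^'p"
    by (simp add: H_norm_def H_inner_def)

  have sqV: "sq_integral P t V \<le> ennreal (1 - s0) * sq_integral P t U"
  proof -
    define g where "g = splice t u' u"
    have g: "g \<in> L2ad P \<F> T" unfolding g_def by (rule L2ad_splice[OF sf xu(4,2)])
    define dF where "dF s w = F s w (x s w) (g s w) - F s w (x s w) (u s w)" for s w
    have dF: "dF \<in> L2ad P \<F> T" unfolding dF_def by (intro diff F_L2 xu g)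
    have dg: "(\<lambda>s w. g s w - u s w) \<in> L2ad P \<F> T" by (intro diff xu g)
    have gU: "(\<lambda>s w. g s w - u s w) = splice t U (\<lambda>s w. 0)"
      by (auto simp: fun_eq_iff g_def splice_def U_def)
    have gV: "(\<lambda>s w. (g s w - u s w) - \<rho> *\<^sub>R dF s w) = splice t V (\<lambda>s w. 0)"
      by (auto simp: fun_eq_iff g_def splice_def V_def dF_def)
    let ?a = "H_dist P T g u"
    have "H_norm P T dF \<le> L * ?a"
      using F_lipschitz[OF xu(1) xu(1) g xu(2)] zero[of x] by (simp add: dF_def[abs_def])
    then have n: "(H_norm P T dF)\<^sup>2 \<le> L\<^sup>2 * ?a\<^sup>2"
      using power_mono[OF _ sq_integral_H_norm(3)[OF P dF], of _ 2] by (fastforce simp: power_mult_distrib)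
    have i: "c * ?a\<^sup>2 \<le> H_inner P T dF (\<lambda>s w. g s w - u s w)"
      using F_monotone[OF xu(1) g xu(2)] by (simp add: dF_def[abs_def])
    have "?a\<^sup>2 - 2 * \<rho> * H_inner P T dF (\<lambda>s w. g s w - u s w) + \<rho>\<^sup>2 * (H_norm P T dF)\<^sup>2 \<le>
        ?a\<^sup>2 - 2 * \<rho> * (c * ?a\<^sup>2) + \<rho>\<^sup>2 * (L\<^sup>2 * ?a\<^sup>2)"
      using \<rho>0 by (intro add_mono diff_mono mult_left_mono n i) auto
    also have "\<dots> = (1 - s0) * ?a\<^sup>2"
      using L0 by (simp add: \<rho> s0_def power2_eq_square field_simps)
    finally have "sq_integral P T (splice t V (\<lambda>s w. 0)) \<le> ennreal ((1 - s0) * ?a\<^sup>2)"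
      unfolding gV[symmetric] H_norm_sq_diff[OF P dg dF] by (rule ennreal_leI)
    also have "\<dots> = ennreal (1 - s0) * sq_integral P T (splice t U (\<lambda>s w. 0))"
      using sq_integral_H_norm(2)[OF P dg] s0 unfolding gU[symmetric] by (simp add: ennreal_mult)
    finally show ?thesis unfolding sq_integral_splice[OF t(2)] .
  qed

  have sqW: "sq_integral P t W \<le> ennreal 2 * ennreal (\<epsilon>\<^sup>2 * T) + ennreal (2 * L\<^sup>2) * sq_integral P t X"
  proof -
    \<comment> \<open>The operators are compared at the perturbed state, so that the remaining
      change of state is measured with the limit operator, to which \<open>F_lipschitz\<close>
      applies.\<close>
    define W1 W2 where "W1 s w = F' s w (x' s w) (u' s w) - F s w (x' s w) (u' s w)"
      and "W2 s w = F s w (x' s w) (u' s w) - F s w (x s w) (u' s w)" for s w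
    have W12: "W1 \<in> L2ad P \<F> T" "W2 \<in> L2ad P \<F> T"
      unfolding W1_def W2_def by (intro diff F_L2 F'_L2 xu)+
    have "sq_integral P t W \<le> ennreal 2 * sq_integral P t W1 + ennreal 2 * sq_integral P t W2 + ennreal 0 * sq_integral P t W2"
    proof (rule sq_integral_le[OF sf])
      have "W s w = W1 s w + W2 s w" for s w by (simp add: W_def W1_def W2_def)
      then show "AE s in lborel. s \<in> {0..t} \<longrightarrow> (AE w in P. (norm (W s w))\<^sup>2 \<le>
          2 * (norm (W1 s w))\<^sup>2 + 2 * (norm (W2 s w))\<^sup>2 + 0 * (norm (W2 s w))\<^sup>2)"
        by (auto intro!: AE_I2 norm_add_sq_le)
    qed (use L2ad_measurable_mono[OF W12(1) t(2)] L2ad_measurable_mono[OF W12(2) t(2)] in auto)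
    also have "\<dots> = ennreal 2 * sq_integral P t W1 + ennreal 2 * sq_integral P t W2" by simp
    also have "sq_integral P t W1 \<le> ennreal (\<epsilon>\<^sup>2 * T)"
    proof -
      have "sq_integral P t W1 \<le> ennreal (\<epsilon>\<^sup>2 * t)"
        using close t unfolding W1_def by (intro sq_integral_bounded P) auto
      also have "\<dots> \<le> ennreal (\<epsilon>\<^sup>2 * T)" using t by (intro ennreal_leI mult_left_mono) auto
      finally show ?thesis .
    qed
    also have "sq_integral P t W2 \<le> ennreal (L\<^sup>2) * sq_integral P t X"
    proof -
      define y where "y = splice t x' x"
      have y: "y \<in> L2ad P \<F> T" unfolding y_def by (rule L2ad_splice[OF sf xu(3,1)])
      have yX: "(\<lambda>s w. y s w - x s w) = splice t X (\<lambda>s w. 0)"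
        by (auto simp: fun_eq_iff y_def splice_def X_def)
      have yW: "(\<lambda>s w. F s w (y s w) (u' s w) - F s w (x s w) (u' s w)) = splice t W2 (\<lambda>s w. 0)"
        by (auto simp: fun_eq_iff y_def splice_def W2_def)
      have d1: "(\<lambda>s w. y s w - x s w) \<in> L2ad P \<F> T" by (intro diff y xu)
      have d2: "(\<lambda>s w. F s w (y s w) (u' s w) - F s w (x s w) (u' s w)) \<in> L2ad P \<F> T"
        by (intro diff y xu F_L2)
      have "sq_integral P T (splice t W2 (\<lambda>s w. 0)) \<le> ennreal ((L * H_dist P T y x)\<^sup>2)"
        unfolding yW[symmetric] sq_integral_H_norm(2)[OF P d2]
        using F_lipschitz[OF y xu(1) xu(4) xu(4)] zero[of u'] sq_integral_H_norm(3)[OF P d2]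
        by (intro ennreal_leI power_mono) auto
      also have "\<dots> = ennreal (L\<^sup>2) * sq_integral P T (splice t X (\<lambda>s w. 0))"
        using sq_integral_H_norm(2)[OF P d1] unfolding yX[symmetric]
        by (simp add: ennreal_mult power_mult_distrib)
      finally show ?thesis unfolding sq_integral_splice[OF t(2)] .
    qed
    finally show ?thesis
      by (simp add: mult_left_mono add_left_mono ennreal_mult mult.assoc)
  qed

  \<comment> \<open>The weight \<open>s0\<close> on \<open>V\<close> matches the contraction factor
    \<open>1 - s0\<close>; the factor 2 in the last two coefficients comes from separating
    \<open>\<rho> W\<close> and \<open>q\<close>.\<close>
  have sqU: "sq_integral P t U \<le> ennreal (1 + s0) * sq_integral P t V +
      ennreal (2 * (1 + 1 / s0) * \<rho>\<^sup>2) * sq_integral P t W + ennreal (2 * (1 + 1 / s0)) * sq_integral P t q"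
  proof (rule sq_integral_le[OF sf])
    show "AE s in lborel. s \<in> {0..t} \<longrightarrow> (AE w in P. (norm (U s w))\<^sup>2 \<le> (1 + s0) * (norm (V s w))\<^sup>2 +
        2 * (1 + 1 / s0) * \<rho>\<^sup>2 * (norm (W s w))\<^sup>2 + 2 * (1 + 1 / s0) * (norm (q s w))\<^sup>2)"
      using u u'
    proof eventually_elim
      case (elim s)
      show ?case
      proof
        assume s: "s \<in> {0..t}"
        then have "AE w in P. u s w = closest_point K (u s w - \<rho> *\<^sub>R F s w (x s w) (u s w))"
          "AE w in P. u' s w = closest_point K' (u' s w - \<rho> *\<^sub>R F' s w (x' s w) (u' s w))"
          using elim t by auto
        then show "AE w in P. (norm (U s w))\<^sup>2 \<le> (1 + s0) * (norm (V s w))\<^sup>2 +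
          2 * (1 + 1 / s0) * \<rho>\<^sup>2 * (norm (W s w))\<^sup>2 + 2 * (1 + 1 / s0) * (norm (q s w))\<^sup>2"
        proof eventually_elim
          case (elim w)
          let ?z' = "u' s w - \<rho> *\<^sub>R F' s w (x' s w) (u' s w)"
          have "?z' - z s w = V s w - \<rho> *\<^sub>R W s w"
            by (simp add: z_def V_def W_def algebra_simps)
          then have "norm (?z' - z s w) \<le> norm (V s w) + \<rho> * norm (W s w)"
            using norm_triangle_ineq4[of "V s w" "\<rho> *\<^sub>R W s w"] \<rho>0 by simp
          moreover have "norm (closest_point K' ?z' - closest_point K' (z s w)) \<le> norm (?z' - z s w)"
            using closest_point_lipschitz[OF K'(2,1,3)] by (simp add: dist_norm)
          moreover have "U s w = (closest_point K' ?z' - closest_point K' (z s w)) + q s w"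
            using elim by (simp add: U_def q_def z_def)
          then have "norm (U s w) \<le> norm (closest_point K' ?z' - closest_point K' (z s w)) + norm (q s w)"
            using norm_triangle_ineq by metis
          ultimately have "norm (U s w) \<le> norm (V s w) + (\<rho> * norm (W s w) + norm (q s w))" by simp
          then have "(norm (U s w))\<^sup>2 \<le> (norm (V s w) + (\<rho> * norm (W s w) + norm (q s w)))\<^sup>2"
            by (intro power_mono) auto
          also have "\<dots> \<le> (1 + s0) * (norm (V s w))\<^sup>2 + (1 + 1 / s0) * (\<rho> * norm (W s w) + norm (q s w))\<^sup>2"
            by (rule sq_add_le_weighted[OF s0(1)])
          also have "(1 + 1 / s0) * (\<rho> * norm (W s w) + norm (q s w))\<^sup>2 \<le>
              (1 + 1 / s0) * (2 * (\<rho> * norm (W s w))\<^sup>2 + 2 * (norm (q s w))\<^sup>2)"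
            using sum_squares_bound[of "\<rho> * norm (W s w)" "norm (q s w)"] s0
            by (intro mult_left_mono) (simp_all add: power2_sum)
          finally show ?case
            by (simp add: power_mult_distrib algebra_simps)
        qed
      qed
    qed
  qed (use L2ad_measurable_mono[OF V t(2)] L2ad_measurable_mono[OF W t(2)] time_space_measurable_mono[OF q t(2)] s0 in auto)

  show ?thesis
  \<comment> \<open>Absorbing a multiple of the left-hand side is a subtraction and takes place in
    the reals. \<open>U\<close> and \<open>X\<close> are finite by membership in
    \<open>L2ad\<close>; if the projection error is infinite, so is the right-hand side.\<close>
  proof (cases "sq_integral P T q = \<top>")
    case True
    then show ?thesis
      using vi_constant_pos[OF cL(1) L0] unfolding q_def by (simp add: ennreal_mult_top)
  next
    case False
    obtain U' where U': "sq_integral P t U = ennreal U'" "0 \<le> U'" using fin by (cases "sq_integral P t U") auto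
    obtain X' where X': "sq_integral P t X = ennreal X'" "0 \<le> X'" using fin by (cases "sq_integral P t X") auto
    obtain q' where q': "sq_integral P T q = ennreal q'" "0 \<le> q'" using False by (cases "sq_integral P T q") auto
    have e: "0 \<le> \<epsilon>\<^sup>2 * T" using t by simp
    have "sq_integral P t U \<le> ennreal (1 + s0) * (ennreal (1 - s0) * ennreal U') +
      ennreal (2 * (1 + 1 / s0) * \<rho>\<^sup>2) * (ennreal 2 * ennreal (\<epsilon>\<^sup>2 * T) + ennreal (2 * L\<^sup>2) * ennreal X') +
      ennreal (2 * (1 + 1 / s0)) * ennreal q'"
      unfolding U'(1)[symmetric] X'(1)[symmetric] q'(1)[symmetric]
      using sqV sqW sq_integral_mono_time[OF t(2), of P q]
      by (intro order_trans[OF sqU] add_mono mult_left_mono) auto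
    also have "\<dots> = ennreal ((1 + s0) * ((1 - s0) * U') +
       (2 * (1 + 1 / s0) * \<rho>\<^sup>2) * (2 * (\<epsilon>\<^sup>2 * T) + 2 * L\<^sup>2 * X') + 2 * (1 + 1 / s0) * q')"
      using s0 U' X' q' e by (simp add: ennreal_mult ennreal_plus del: ennreal_numeral)
    finally have "U' \<le> (1 + s0) * ((1 - s0) * U') +
       (2 * (1 + 1 / s0) * \<rho>\<^sup>2) * (2 * (\<epsilon>\<^sup>2 * T) + 2 * L\<^sup>2 * X') + 2 * (1 + 1 / s0) * q'"
      unfolding U' using s0 U' X' q' e by (subst (asm) ennreal_le_iff) auto
    then have "s0\<^sup>2 * U' \<le> 2 * (1 + 1 / s0) * (2 * \<rho>\<^sup>2 * (\<epsilon>\<^sup>2 * T) + 2 * \<rho>\<^sup>2 * L\<^sup>2 * X' + q')"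
      by (simp add: power2_eq_square algebra_simps)
    also have "\<dots> \<le> 2 * (1 + 1 / s0) * ((2 * \<rho>\<^sup>2 + 2 * \<rho>\<^sup>2 * L\<^sup>2 + 1) * (X' + \<epsilon>\<^sup>2 * T + q'))"
    proof (rule mult_left_mono)
      have "0 \<le> 2 * \<rho>\<^sup>2 * L\<^sup>2 * (\<epsilon>\<^sup>2 * T)" "0 \<le> 2 * \<rho>\<^sup>2 * L\<^sup>2 * q'" "0 \<le> 2 * \<rho>\<^sup>2 * X'" "0 \<le> 2 * \<rho>\<^sup>2 * q'"
        using e X' q' by auto
      then show "2 * \<rho>\<^sup>2 * (\<epsilon>\<^sup>2 * T) + 2 * \<rho>\<^sup>2 * L\<^sup>2 * X' + q' \<le> (2 * \<rho>\<^sup>2 + 2 * \<rho>\<^sup>2 * L\<^sup>2 + 1) * (X' + \<epsilon>\<^sup>2 * T + q')"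
        using e X' q' unfolding distrib_right distrib_left by linarith
    qed (use s0 in auto)
    finally have "U' \<le> vi_constant c L * (X' + \<epsilon>\<^sup>2 * T + q')"
      using s0 unfolding vi_constant_def Let_def s0_def[symmetric] \<rho>[symmetric]
      by (simp add: field_simps)
    then have "ennreal U' \<le> ennreal (vi_constant c L) * (ennreal X' + ennreal (\<epsilon>\<^sup>2 * T) + ennreal q')"
      using vi_constant_pos[OF cL(1) L0] X' q' e
      by (simp add: ennreal_mult[symmetric] ennreal_plus[symmetric] ennreal_leI del: ennreal_plus)
    then show ?thesis
      using U' X' q' unfolding U_def[abs_def] X_def[abs_def] q_def[abs_def] by simp
  qed
qed

section \<open>The state equation\<close>

text \<open>Iterating the inequality \<open>n\<close> times bounds the integral up to
  \<open>t\<close> by \<open>r t exp (C t)\<close> plus a remainder \<open>m (C t)^n / n!\<close>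
  that tends to zero. Finiteness of the total mass \<open>m\<close> starts the iteration; without it
  the constant function infinity would be a counterexample whenever \<open>C\<close> and
  \<open>T\<close> are positive.\<close>

lemma nn_integral_gronwall:
  fixes a :: "real \<Rightarrow> ennreal"
  assumes T: "0 \<le> T" and C: "0 \<le> C" "0 \<le> r"
    and a: "\<And>t. t \<in> {0..T} \<Longrightarrow> a t \<le> ennreal C * (\<integral>\<^sup>+s\<in>{0..t}. a s \<partial>lborel) + ennreal r"
    and fin: "(\<integral>\<^sup>+s\<in>{0..T}. a s \<partial>lborel) < \<infinity>"
  shows "(\<integral>\<^sup>+s\<in>{0..T}. a s \<partial>lborel) \<le> ennreal (r * T * exp (C * T))"
proof -
  define A where "A t = (\<integral>\<^sup>+s\<in>{0..t}. a s \<partial>lborel)" for t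
  obtain m where m: "A T = ennreal m" "0 \<le> m" using fin unfolding A_def[symmetric] by (cases "A T") auto
  have AT: "A t \<le> ennreal m" if "t \<le> T" for t
    unfolding m(1)[symmetric] A_def using that by (intro nn_integral_mono) (auto split: split_indicator)
  have step: "A t \<le> ennreal (r * t * exp (C * t) + m * (C * t) ^ n / fact n)" if "t \<in> {0..T}" for n t
    using that
  proof (induction n arbitrary: t)
    case 0
    have "m \<le> r * t * exp (C * t) + m" using 0 C by simp
    then show ?case using AT[of t] 0 by (auto intro: order_trans[OF _ ennreal_leI])
  next
    case (Suc n)
    \<comment> \<open>\<open>f\<close> is the derivative of \<open>F\<close>. It differs from
      \<open>C\<close> times the previous bound plus \<open>r\<close> only by having
      \<open>r exp (C s)\<close> in place of \<open>r\<close>, which makes the term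
      \<open>r s exp (C s)\<close> reproduce itself under one iteration.\<close>
    define f where "f s = r * exp (C * s) + r * s * (C * exp (C * s)) + m * (C * (C * s) ^ n / fact n)" for s
    define F where "F s = r * s * exp (C * s) + m * ((C * s) ^ Suc n / fact (Suc n))" for s
    have "A t \<le> (\<integral>\<^sup>+s. ennreal (f s) * indicator {0..t} s \<partial>lborel)"
      unfolding A_def
    proof (rule nn_integral_mono)
      fix s
      have "a s \<le> ennreal (f s)" if s: "s \<in> {0..t}"
      proof -
        have sT: "s \<in> {0..T}" using s Suc.prems by auto
        have "a s \<le> ennreal C * A s + ennreal r" using a[OF sT] by (simp add: A_def)
        also have "\<dots> \<le> ennreal C * ennreal (r * s * exp (C * s) + m * (C * s) ^ n / fact n) + ennreal r"
          by (intro add_right_mono mult_left_mono Suc.IH sT) simp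
        also have "\<dots> = ennreal (C * (r * s * exp (C * s) + m * (C * s) ^ n / fact n) + r)"
          using C m s by (simp add: ennreal_mult ennreal_plus)
        also have "\<dots> \<le> ennreal (f s)"
        proof (rule ennreal_leI)
          have "r * 1 \<le> r * exp (C * s)" using C s by (intro mult_left_mono) auto
          then show "C * (r * s * exp (C * s) + m * (C * s) ^ n / fact n) + r \<le> f s"
            by (simp add: f_def algebra_simps)
        qed
        finally show ?thesis .
      qed
      then show "a s * indicator {0..t} s \<le> ennreal (f s) * indicator {0..t} s"
        by (simp split: split_indicator)
    qed
    also have "\<dots> = ennreal (F t - F 0)"
    proof (rule nn_integral_FTC_Icc)
      show "f \<in> borel_measurable borel" unfolding f_def by measurable
      show "(F has_real_derivative f s) (at s)" for s
      proof -
        have "((\<lambda>s. (C * s) ^ Suc n / fact (Suc n)) has_real_derivative C * (C * s) ^ n / fact n) (at s)"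
        proof -
          have "((\<lambda>s. (C * s) ^ Suc n / fact (Suc n)) has_real_derivative
              ((1 + real n) * (C * (C * s) ^ n)) / fact (Suc n)) (at s)"
            by (intro DERIV_cdivide DERIV_power_Suc) (auto intro!: derivative_eq_intros)
          also have "((1 + real n) * (C * (C * s) ^ n)) / fact (Suc n) = C * (C * s) ^ n / fact n"
            by (simp add: add_divide_distrib[symmetric] field_simps flip: of_nat_Suc)
          finally show ?thesis .
        qed
        moreover have "((\<lambda>s. r * s * exp (C * s)) has_real_derivative r * exp (C * s) + r * s * (C * exp (C * s))) (at s)"
          by (auto intro!: derivative_eq_intros)
        ultimately show ?thesis
          unfolding F_def[abs_def] f_def by (intro DERIV_add DERIV_cmult)
      qed
      show "0 \<le> f s" if "s \<in> {0..t}" for s using that C m by (simp add: f_def)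
      show "0 \<le> t" using Suc.prems by simp
    qed
    also have "F t - F 0 = r * t * exp (C * t) + m * (C * t) ^ Suc n / fact (Suc n)"
      by (simp add: F_def)
    finally show ?case .
  qed
  have "(\<lambda>n. (C * T) ^ n / fact n) \<longlonglongrightarrow> 0"
    using summable_LIMSEQ_zero[OF summable_exp[of "C * T"]] by (simp add: divide_inverse mult.commute)
  from tendsto_mult_left[OF this, of m]
  have lim: "(\<lambda>n. r * T * exp (C * T) + m * ((C * T) ^ n / fact n)) \<longlonglongrightarrow> r * T * exp (C * T) + m * 0"
    by (intro tendsto_add tendsto_const) simp
  have "m \<le> r * T * exp (C * T) + m * ((C * T) ^ n / fact n)" for n
  proof -
    have "ennreal m \<le> ennreal (r * T * exp (C * T) + m * (C * T) ^ n / fact n)"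
      unfolding m(1)[symmetric] by (rule step) (use T in simp)
    then show ?thesis by (subst (asm) ennreal_le_iff) (use T C m in auto)
  qed
  then have "m \<le> r * T * exp (C * T) + m * 0"
    by (intro LIMSEQ_le_const[OF lim]) auto
  then show ?thesis using m by (simp add: A_def[symmetric] ennreal_leI)
qed

lemma fractional_kernel_bound:
  assumes \<alpha>: "1 / 2 < \<alpha>" and t: "0 \<le> t" "t \<le> T"
  shows "(\<integral>\<^sup>+s\<in>{0..t}. ennreal (((t - s) powr (\<alpha> - 1))\<^sup>2) \<partial>lborel) \<le> ennreal (T powr (2 * \<alpha> - 1) / (2 * \<alpha> - 1))"
proof -
  \<comment> \<open>Cutting off outside [0, t] makes the reflection of \<open>s\<close> into
    \<open>t - s\<close> a substitution on the whole line. The singularity at \<open>0\<close> is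
    integrable because \<open>2 * \<alpha> - 2 > -1\<close>.\<close>
  define h where "h s = (if s \<in> {0..t} then s powr (2 * \<alpha> - 2) else 0)" for s
  have hm: "h \<in> borel_measurable borel" unfolding h_def by measurable
  have sq: "(s powr (\<alpha> - 1))\<^sup>2 = s powr (2 * \<alpha> - 2)" for s :: real
    by (simp add: power2_eq_square powr_add[symmetric])
  have "(\<integral>\<^sup>+s\<in>{0..t}. ennreal (((t - s) powr (\<alpha> - 1))\<^sup>2) \<partial>lborel) = (\<integral>\<^sup>+s. ennreal (h (t + (- 1) * s)) \<partial>lborel)"
    unfolding sq h_def by (intro nn_integral_cong) (auto split: split_indicator)
  also have "\<dots> = (\<integral>\<^sup>+s. ennreal (h s) \<partial>lborel)"
    using nn_integral_real_affine[of "\<lambda>s. ennreal (h s)" "- 1" t] hm by simp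
  also have "\<dots> = ennreal (t powr (2 * \<alpha> - 2 + 1) / (2 * \<alpha> - 2 + 1))"
  proof (rule nn_integral_has_integral_lborel[OF hm])
    show "0 \<le> h s" for s by (simp add: h_def)
    show "(h has_integral t powr (2 * \<alpha> - 2 + 1) / (2 * \<alpha> - 2 + 1)) UNIV"
      unfolding h_def has_integral_restrict_UNIV using \<alpha> t by (intro has_integral_powr_from_0) auto
  qed
  also have "\<dots> \<le> ennreal (T powr (2 * \<alpha> - 1) / (2 * \<alpha> - 1))"
    using \<alpha> t by (intro ennreal_leI) (auto intro!: divide_right_mono powr_mono2)
  finally show ?thesis .
qed

text \<open>Pathwise estimates of time integrals leave the expectation outside, the opposite order
  to that of \<open>sq_integral\<close>.\<close>

lemma sq_integral_swap:
  fixes f :: "real \<Rightarrow> 'w \<Rightarrow> 'b::{real_normed_vector, second_countable_topology}"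
  assumes P: "prob_space P" and f: "(\<lambda>(s, w). f s w) \<in> borel_measurable (time_space P t)"
  shows "(\<integral>\<^sup>+w. (\<integral>\<^sup>+s\<in>{0..t}. ennreal ((norm (f s w))\<^sup>2) \<partial>lborel) \<partial>P) = sq_integral P t f"
    and "(\<lambda>w. \<integral>\<^sup>+s\<in>{0..t}. ennreal ((norm (f s w))\<^sup>2) \<partial>lborel) \<in> borel_measurable P"
proof -
  interpret prob_space P by fact
  have sf: "sigma_finite_measure P" ..
  interpret L: sigma_finite_measure "restrict_space lborel {0..t}"
    by (intro sigma_finite_measure_restrict_space sigma_finite_lborel) simp
  interpret pair_sigma_finite "restrict_space lborel {0..t}" P ..
  have m: "(\<lambda>z. ennreal ((norm (case z of (s, w) \<Rightarrow> f s w))\<^sup>2)) \<in> borel_measurable (time_space P t)"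
    by (rule measurable_compose[OF f, of "\<lambda>x. ennreal ((norm x)\<^sup>2)"]) measurable
  have restr: "(\<integral>\<^sup>+s\<in>{0..t}. h s \<partial>lborel) = (\<integral>\<^sup>+s. h s \<partial>restrict_space lborel {0..t})" for h
    by (subst nn_integral_restrict_space) auto
  show "(\<integral>\<^sup>+w. (\<integral>\<^sup>+s\<in>{0..t}. ennreal ((norm (f s w))\<^sup>2) \<partial>lborel) \<partial>P) = sq_integral P t f"
    unfolding restr sq_integral_eq[OF sf f] using nn_integral_snd[OF m] by simp
  have "(\<lambda>(w, s). ennreal ((norm (f s w))\<^sup>2)) \<in> borel_measurable (P \<Otimes>\<^sub>M restrict_space lborel {0..t})"
    using measurable_pair_swap[OF m] by (simp add: split_beta)
  then show "(\<lambda>w. \<integral>\<^sup>+s\<in>{0..t}. ennreal ((norm (f s w))\<^sup>2) \<partial>lborel) \<in> borel_measurable P"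
    unfolding restr by (rule L.borel_measurable_nn_integral)
qed

text \<open>Cauchy-Schwarz on almost every path. The kernel \<open>k = 1\<close> gives the drift,
  \<open>k s = (t - s) powr (\<alpha> - 1)\<close> the fractional integral.\<close>

lemma weighted_time_integral_bound:
  fixes f f' :: "real \<Rightarrow> 'w \<Rightarrow> 'b::{banach, second_countable_topology}"
  assumes P: "prob_space P"
    and f: "(\<lambda>(s, w). f s w) \<in> borel_measurable (time_space P t)" "sq_integral P t f < \<infinity>"
    and f': "(\<lambda>(s, w). f' s w) \<in> borel_measurable (time_space P t)" "sq_integral P t f' < \<infinity>"
    and k: "k \<in> borel_measurable borel" "(\<integral>\<^sup>+s\<in>{0..t}. ennreal ((k s)\<^sup>2) \<partial>lborel) \<le> ennreal \<kappa>"
  shows "AE w in P. ennreal ((norm ((LINT s:{0..t}|lborel. k s *\<^sub>R f' s w) - (LINT s:{0..t}|lborel. k s *\<^sub>R f s w)))\<^sup>2)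
    \<le> ennreal \<kappa> * (\<integral>\<^sup>+s\<in>{0..t}. ennreal ((norm (f' s w - f s w))\<^sup>2) \<partial>lborel)"
proof -
  let ?Q = "restrict_space lborel {0..t}"
  have restr: "(\<integral>\<^sup>+s\<in>{0..t}. h s \<partial>lborel) = (\<integral>\<^sup>+s. h s \<partial>?Q)" for h
    by (subst nn_integral_restrict_space) auto
  have restr': "(LINT s:{0..t}|lborel. h s) = (LINT s|?Q. h s)" for h :: "real \<Rightarrow> 'b"
    by (subst integral_restrict_space) (auto simp: set_lebesgue_integral_def)
  have km: "k \<in> borel_measurable ?Q" using k(1) by (intro measurable_restrict_space1) simp
  have fin: "AE w in P. mean_sq ?Q (\<lambda>s. g s w) < \<infinity>"
    if "(\<lambda>(s, w). g s w) \<in> borel_measurable (time_space P t)" "sq_integral P t g < \<infinity>" for g :: "real \<Rightarrow> 'w \<Rightarrow> 'b"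
    using nn_integral_PInf_AE[OF sq_integral_swap(2)[OF P that(1)]] sq_integral_swap(1)[OF P that(1)] that(2)
    unfolding restr by (auto simp: less_top)
  have CS: "(\<integral>\<^sup>+s. ennreal (norm (k s *\<^sub>R g s)) \<partial>?Q)\<^sup>2 \<le> ennreal \<kappa> * mean_sq ?Q g"
    if [measurable]: "g \<in> borel_measurable ?Q" for g :: "real \<Rightarrow> 'b"
  proof -
    have "(\<integral>\<^sup>+s. ennreal (norm (k s *\<^sub>R g s)) \<partial>?Q)\<^sup>2 = (\<integral>\<^sup>+s. ennreal \<bar>k s\<bar> * ennreal (norm (g s)) \<partial>?Q)\<^sup>2"
      by (simp add: ennreal_mult)
    also have "\<dots> \<le> (\<integral>\<^sup>+s. (ennreal \<bar>k s\<bar>)\<^sup>2 \<partial>?Q) * (\<integral>\<^sup>+s. (ennreal (norm (g s)))\<^sup>2 \<partial>?Q)"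
      by (intro Cauchy_Schwarz_nn_integral measurable_compose[OF km, of "\<lambda>x. ennreal \<bar>x\<bar>"]
          measurable_compose[OF that, of "\<lambda>x. ennreal (norm x)"]) measurable
    also have "\<dots> = (\<integral>\<^sup>+s. ennreal ((k s)\<^sup>2) \<partial>?Q) * mean_sq ?Q g"
      by (simp add: ennreal_power)
    also have "\<dots> \<le> ennreal \<kappa> * mean_sq ?Q g"
      using k(2) unfolding restr by (rule mult_right_mono) simp
    finally show ?thesis .
  qed
  have int: "integrable ?Q (\<lambda>s. k s *\<^sub>R g s)"
    if [measurable]: "g \<in> borel_measurable ?Q" and "mean_sq ?Q g < \<infinity>" for g :: "real \<Rightarrow> 'b"
  proof (rule integrableI_bounded)
    show "(\<lambda>s. k s *\<^sub>R g s) \<in> borel_measurable ?Q" by (rule borel_measurable_scaleR[OF km that(1)])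
    have "(\<integral>\<^sup>+s. ennreal (norm (k s *\<^sub>R g s)) \<partial>?Q)\<^sup>2 < \<infinity>"
      using CS[OF that(1)] that(2) by (auto simp: ennreal_mult_less_top elim: le_less_trans)
    then show "(\<integral>\<^sup>+s. ennreal (norm (k s *\<^sub>R g s)) \<partial>?Q) < \<infinity>"
      by (auto simp: power2_eq_square ennreal_mult_less_top)
  qed
  have sec: "(\<lambda>s. g s w) \<in> borel_measurable ?Q"
    if "(\<lambda>(s, w). g s w) \<in> borel_measurable (time_space P t)" "w \<in> space P" for g :: "real \<Rightarrow> 'w \<Rightarrow> 'b" and w
    using measurable_Pair1[OF that] by simp
  show ?thesis
    using fin[OF f] fin[OF f'] AE_space
  proof eventually_elim
    case (elim w)
    note fm = sec[OF f(1) elim(3)] and fm' = sec[OF f'(1) elim(3)]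
    note i = int[OF fm elim(1)] and i' = int[OF fm' elim(2)]
    \<comment> \<open>A Bochner integral of a non-integrable function is \<open>0\<close>, so
      merging the two integrals relies on the integrability of both integrands just
      obtained.\<close>
    have eq: "(LINT s|?Q. k s *\<^sub>R f' s w) - (LINT s|?Q. k s *\<^sub>R f s w) = (LINT s|?Q. k s *\<^sub>R (f' s w - f s w))"
      using i i' by (simp add: scaleR_diff_right)
    have "integrable ?Q (\<lambda>s. k s *\<^sub>R (f' s w - f s w))"
      using Bochner_Integration.integrable_diff[OF i' i] by (simp add: scaleR_diff_right)
    from integral_norm_bound_ennreal[OF this]
    have "(ennreal (norm (LINT s|?Q. k s *\<^sub>R (f' s w - f s w))))\<^sup>2 \<le>
        (\<integral>\<^sup>+s. ennreal (norm (k s *\<^sub>R (f' s w - f s w))) \<partial>?Q)\<^sup>2"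
      by (rule power_mono) simp
    also have "\<dots> \<le> ennreal \<kappa> * mean_sq ?Q (\<lambda>s. f' s w - f s w)"
      by (rule CS) (intro borel_measurable_diff fm fm')
    finally show ?case unfolding restr restr' eq by (simp add: ennreal_power)
  qed
qed

lemma norm_add4_sq_le:
  fixes a b c d :: "'a::real_normed_vector"
  shows "(norm (a + b + c + d))\<^sup>2 \<le> 4 * ((norm a)\<^sup>2 + (norm b)\<^sup>2 + (norm c)\<^sup>2 + (norm d)\<^sup>2)"
proof -
  have "(norm (a + b + (c + d)))\<^sup>2 \<le> 2 * (norm (a + b))\<^sup>2 + 2 * (norm (c + d))\<^sup>2" by (rule norm_add_sq_le)
  also have "\<dots> \<le> 2 * (2 * (norm a)\<^sup>2 + 2 * (norm b)\<^sup>2) + 2 * (2 * (norm c)\<^sup>2 + 2 * (norm d)\<^sup>2)"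
    by (intro add_mono mult_left_mono norm_add_sq_le) auto
  finally show ?thesis by (simp add: add.assoc)
qed

section \<open>Coefficients evaluated along processes\<close>

lemma coefficient_measurable:
  fixes h :: "real \<Rightarrow> real^'p \<Rightarrow> real^'p \<Rightarrow> 'b::topological_space" and x u :: "real \<Rightarrow> 'w \<Rightarrow> real^'p"
  assumes h: "(\<lambda>(t, x, u). h t x u) \<in> borel_measurable (restrict_space borel {0..T} \<Otimes>\<^sub>M borel \<Otimes>\<^sub>M borel)"
    and xu: "(\<lambda>(s, w). x s w) \<in> borel_measurable (time_space P T)"
      "(\<lambda>(s, w). u s w) \<in> borel_measurable (time_space P T)"
  shows "(\<lambda>(s, w). h s (x s w) (u s w)) \<in> borel_measurable (time_space P T)"
proof -
  have "measurable (time_space P T) (restrict_space lborel {0..T}) = measurable (time_space P T) (restrict_space borel {0..T})"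
    by (intro measurable_cong_sets sets_restrict_space_cong) auto
  from measurable_fst[of "restrict_space lborel {0..T}" P, unfolded this]
  have "fst \<in> measurable (time_space P T) (restrict_space borel {0..T})" .
  then have "(\<lambda>z. (fst z, (case z of (s, w) \<Rightarrow> x s w), (case z of (s, w) \<Rightarrow> u s w))) \<in>
      measurable (time_space P T) (restrict_space borel {0..T} \<Otimes>\<^sub>M borel \<Otimes>\<^sub>M borel)"
    by (intro measurable_Pair xu)
  from measurable_compose[OF this h] show ?thesis by (simp add: split_beta)
qed

lemma jump_coefficient_measurable:
  fixes h :: "real \<Rightarrow> real^'p \<Rightarrow> real^'p \<Rightarrow> real^'p \<Rightarrow> 'b::topological_space" and x u :: "real \<Rightarrow> 'w \<Rightarrow> real^'p"
  assumes h: "(\<lambda>(t, x, u, y). h t x u y) \<in> borel_measurable (restrict_space borel {0..T} \<Otimes>\<^sub>M borel \<Otimes>\<^sub>M borel \<Otimes>\<^sub>M borel)"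
    and sv: "sets v = sets borel" and t: "t \<le> T"
    and xu: "(\<lambda>(s, w). x s w) \<in> borel_measurable (time_space P t)"
      "(\<lambda>(s, w). u s w) \<in> borel_measurable (time_space P t)"
  shows "(\<lambda>(s, w, y). h s (x s w) (u s w) y) \<in>
    borel_measurable (time_space (P \<Otimes>\<^sub>M restrict_space v {y. norm y < c}) t)"
proof -
  let ?M = "time_space (P \<Otimes>\<^sub>M restrict_space v {y. norm y < c}) t"
  have "(\<lambda>s. s) \<in> measurable (restrict_space lborel {0..t}) (restrict_space borel {0..T})"
    using t by (intro measurable_restrict_space2 measurable_restrict_space1) (auto simp: space_restrict_space)
  then have 1: "fst \<in> measurable ?M (restrict_space borel {0..T})"
    using measurable_compose[OF measurable_fst] by fast
  have 2: "(\<lambda>z. (fst z, fst (snd z))) \<in> measurable ?M (time_space P t)"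
    by (intro measurable_Pair measurable_fst measurable_compose[OF measurable_snd measurable_fst])
  have "(\<lambda>y. y) \<in> measurable (restrict_space v {y. norm y < c}) borel"
    by (intro measurable_restrict_space1 measurable_ident_sets sv)
  then have 3: "(\<lambda>z. snd (snd z)) \<in> measurable ?M borel"
    by (intro measurable_compose[OF measurable_compose[OF measurable_snd measurable_snd]])
  have "(\<lambda>z. (fst z, (case (fst z, fst (snd z)) of (s, w) \<Rightarrow> x s w), (case (fst z, fst (snd z)) of (s, w) \<Rightarrow> u s w), snd (snd z))) \<in>
      measurable ?M (restrict_space borel {0..T} \<Otimes>\<^sub>M borel \<Otimes>\<^sub>M borel \<Otimes>\<^sub>M borel)"
    by (intro measurable_Pair 1 3 measurable_compose[OF 2 xu(1)] measurable_compose[OF 2 xu(2)])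
  from measurable_compose[OF this h] show ?thesis by (simp add: split_beta)
qed

lemma sq_integral_growth:
  fixes h :: "real \<Rightarrow> real^'p \<Rightarrow> real^'p \<Rightarrow> 'b::real_normed_vector" and x u :: "real \<Rightarrow> 'w \<Rightarrow> real^'p"
  assumes P: "prob_space P" and t: "0 \<le> t" "t \<le> T" and xu: "x \<in> L2ad P \<F> T" "u \<in> L2ad P \<F> T"
    and K: "0 \<le> K" "\<And>t x u. t \<in> {0..T} \<Longrightarrow> (norm (h t x u))\<^sup>2 \<le> K * (1 + (norm x)\<^sup>2 + (norm u)\<^sup>2)"
  shows "sq_integral P t (\<lambda>s w. h s (x s w) (u s w)) < \<infinity>"
proof -
  interpret prob_space P by fact
  have sf: "sigma_finite_measure P" ..
  \<comment> \<open>\<open>sq_integral_le\<close> compares processes with values in one space. The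
    unit vector \<open>e\<close> turns the constant \<open>1\<close> and the norm of
    \<open>h\<close> into processes with the same value space as \<open>x\<close> and
    \<open>u\<close>.\<close>
  define e :: "real^'p" where "e = axis undefined 1"
  have e: "norm e = 1" by (simp add: e_def)
  have bound: "sq_integral P T (\<lambda>s w. h s (x s w) (u s w)) \<le>
      ennreal K * sq_integral P T (\<lambda>s w. e) + ennreal K * sq_integral P T x + ennreal K * sq_integral P T u"
  proof -
    define g where "g s w = (norm (h s (x s w) (u s w))) *\<^sub>R e" for s w
    have "sq_integral P T g \<le> ennreal K * sq_integral P T (\<lambda>s w. e) + ennreal K * sq_integral P T x + ennreal K * sq_integral P T u"
      using K(2) by (intro sq_integral_le[OF sf] L2adD(1)[OF xu(1)] L2adD(1)[OF xu(2)] K(1))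
        (auto simp: g_def e distrib_left intro!: AE_I2)
    moreover have "sq_integral P T g = sq_integral P T (\<lambda>s w. h s (x s w) (u s w))"
      by (simp add: sq_integral_def g_def e)
    ultimately show ?thesis by simp
  qed
  have "sq_integral P T (\<lambda>s w. e) \<le> ennreal (1\<^sup>2 * T)"
    using t e by (intro sq_integral_bounded P) auto
  then have "sq_integral P T (\<lambda>s w. e) < \<infinity>" by (rule le_less_trans) simp
  then have "sq_integral P T (\<lambda>s w. h s (x s w) (u s w)) < \<infinity>"
    using L2adD(2)[OF xu(1)] L2adD(2)[OF xu(2)]
    by (intro le_less_trans[OF bound]) (simp add: ennreal_mult_less_top)
  then show ?thesis by (rule le_less_trans[OF sq_integral_mono_time[OF t(2)]])
qed

text \<open>The 4 squares a sum of four differences. Inside the bracket stand the drift, the squared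
  norm of the fractional kernel, and the Brownian and jump integrals with their limit factor 9.
  \<open>2 + 2 * \<Lambda>\<close> turns the common majorant of the coefficient differences into
  distances of states and controls plus the coefficient error.\<close>

definition state_constant :: "real \<Rightarrow> real \<Rightarrow> real \<Rightarrow> nat \<Rightarrow> nat \<Rightarrow> real" where
  "state_constant T \<alpha> \<Lambda> p l =
     4 * (T + T powr (2 * \<alpha> - 1) / (2 * \<alpha> - 1) + 9 * (real p * (real l)\<^sup>2) + 9 * real p) * (2 + 2 * \<Lambda>)"

text \<open>The intermediate value is the unperturbed coefficient at the perturbed arguments, so the
  Lipschitz bound involved is that of \<open>h\<close>, not of \<open>h'\<close>.\<close>

lemma norm_sq_diff_perturbed:
  fixes h h' :: "'a \<Rightarrow> 'b \<Rightarrow> 'c::real_normed_vector"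
  assumes "norm (h' x' u' - h x' u') \<le> \<epsilon>" "(norm (h x' u' - h x u))\<^sup>2 \<le> d"
  shows "(norm (h' x' u' - h x u))\<^sup>2 \<le> 2 * \<epsilon>\<^sup>2 + 2 * d"
proof -
  have "(norm (h' x' u' - h x u))\<^sup>2 \<le> 2 * (norm (h' x' u' - h x' u'))\<^sup>2 + 2 * (norm (h x' u' - h x u))\<^sup>2"
    using norm_add_sq_le[of "h' x' u' - h x' u'" "h x' u' - h x u"] by simp
  also have "\<dots> \<le> 2 * \<epsilon>\<^sup>2 + 2 * d"
    using assms by (intro add_mono mult_left_mono power_mono) auto
  finally show ?thesis .
qed

text \<open>The initial value cancels, and one majorant \<open>r\<close> serves all four coefficient
  differences, so each difference of integrals is bounded by a constant times the same quantity
  \<open>E\<close>.\<close>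

lemma state_stability:
  fixes B :: "real \<Rightarrow> 'w \<Rightarrow> real^'l" and N :: "'w \<Rightarrow> (real \<times> (real^'p)) measure"
    and b b' \<sigma>1 \<sigma>1' :: "real \<Rightarrow> real^'p \<Rightarrow> real^'p \<Rightarrow> real^'p"
    and \<sigma> \<sigma>' :: "real \<Rightarrow> real^'p \<Rightarrow> real^'p \<Rightarrow> real^'l^'p"
    and G G' :: "real \<Rightarrow> real^'p \<Rightarrow> real^'p \<Rightarrow> real^'p \<Rightarrow> real^'p"
    and x u x' u' :: "real \<Rightarrow> 'w \<Rightarrow> real^'p"
  assumes basis: "complete_filtered_prob_space P \<F>" and B: "brownian_motion P \<F> B"
    and v: "intensity_measure v" and N: "poisson_random_measure P \<F> v N"
    and t: "0 \<le> t" "t \<le> T" and \<alpha>: "1 / 2 < \<alpha>" "\<alpha> < 1"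
    and xu: "x \<in> L2ad P \<F> T" "u \<in> L2ad P \<F> T" and xu': "x' \<in> L2ad P \<F> T" "u' \<in> L2ad P \<F> T"
    and meas: "(\<lambda>(t, x, u). b t x u) \<in> borel_measurable (restrict_space borel {0..T} \<Otimes>\<^sub>M borel \<Otimes>\<^sub>M borel)"
      "(\<lambda>(t, x, u). \<sigma>1 t x u) \<in> borel_measurable (restrict_space borel {0..T} \<Otimes>\<^sub>M borel \<Otimes>\<^sub>M borel)"
      "(\<lambda>(t, x, u). \<sigma> t x u) \<in> borel_measurable (restrict_space borel {0..T} \<Otimes>\<^sub>M borel \<Otimes>\<^sub>M borel)"
      "(\<lambda>(t, x, u, y). G t x u y) \<in> borel_measurable (restrict_space borel {0..T} \<Otimes>\<^sub>M borel \<Otimes>\<^sub>M borel \<Otimes>\<^sub>M borel)"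
    and meas': "(\<lambda>(t, x, u). b' t x u) \<in> borel_measurable (restrict_space borel {0..T} \<Otimes>\<^sub>M borel \<Otimes>\<^sub>M borel)"
      "(\<lambda>(t, x, u). \<sigma>1' t x u) \<in> borel_measurable (restrict_space borel {0..T} \<Otimes>\<^sub>M borel \<Otimes>\<^sub>M borel)"
      "(\<lambda>(t, x, u). \<sigma>' t x u) \<in> borel_measurable (restrict_space borel {0..T} \<Otimes>\<^sub>M borel \<Otimes>\<^sub>M borel)"
      "(\<lambda>(t, x, u, y). G' t x u y) \<in> borel_measurable (restrict_space borel {0..T} \<Otimes>\<^sub>M borel \<Otimes>\<^sub>M borel \<Otimes>\<^sub>M borel)"
    and fin: "sq_integral P t (\<lambda>s w. b s (x s w) (u s w)) < \<infinity>" "sq_integral P t (\<lambda>s w. \<sigma>1 s (x s w) (u s w)) < \<infinity>"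
    and fin': "sq_integral P t (\<lambda>s w. b' s (x' s w) (u' s w)) < \<infinity>" "sq_integral P t (\<lambda>s w. \<sigma>1' s (x' s w) (u' s w)) < \<infinity>"
    and \<Lambda>: "0 \<le> \<Lambda>"
    and lipschitz:
      "\<And>t x1 x2 u1 u2. t \<in> {0..T} \<Longrightarrow> (norm (b t x1 u1 - b t x2 u2))\<^sup>2 \<le> \<Lambda> * ((norm (x1 - x2))\<^sup>2 + (norm (u1 - u2))\<^sup>2)"
      "\<And>t x1 x2 u1 u2. t \<in> {0..T} \<Longrightarrow> (norm (\<sigma>1 t x1 u1 - \<sigma>1 t x2 u2))\<^sup>2 \<le> \<Lambda> * ((norm (x1 - x2))\<^sup>2 + (norm (u1 - u2))\<^sup>2)"
      "\<And>t x1 x2 u1 u2. t \<in> {0..T} \<Longrightarrow> (norm (\<sigma> t x1 u1 - \<sigma> t x2 u2))\<^sup>2 \<le> \<Lambda> * ((norm (x1 - x2))\<^sup>2 + (norm (u1 - u2))\<^sup>2)"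
      "\<And>t x1 x2 u1 u2. t \<in> {0..T} \<Longrightarrow> (\<integral>\<^sup>+ y\<in>{y. norm y < c}. ennreal ((norm (G t x1 u1 y - G t x2 u2 y))\<^sup>2) \<partial>v)
         \<le> ennreal (\<Lambda> * ((norm (x1 - x2))\<^sup>2 + (norm (u1 - u2))\<^sup>2))"
    and close:
      "\<And>t x u. t \<in> {0..T} \<Longrightarrow> norm (b' t x u - b t x u) \<le> \<epsilon>"
      "\<And>t x u. t \<in> {0..T} \<Longrightarrow> norm (\<sigma>1' t x u - \<sigma>1 t x u) \<le> \<epsilon>"
      "\<And>t x u. t \<in> {0..T} \<Longrightarrow> norm (\<sigma>' t x u - \<sigma> t x u) \<le> \<epsilon>"
      "\<And>t x u. t \<in> {0..T} \<Longrightarrow> (\<integral>\<^sup>+ y\<in>{y. norm y < c}. ennreal ((norm (G' t x u y - G t x u y))\<^sup>2) \<partial>v) \<le> ennreal (\<epsilon>\<^sup>2)"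
    and I: "has_ito_integral P \<F> B (\<lambda>s w. \<sigma> s (x s w) (u s w)) t I"
    and J: "has_jump_integral P \<F> v N c (\<lambda>s w y. G s (x s w) (u s w) y) t J"
    and eq: "AE w in P. x t w = p0 w + (LINT s:{0..t}|lborel. b s (x s w) (u s w))
           + fractional_integral \<alpha> (\<lambda>s. \<sigma>1 s (x s w) (u s w)) t + I w + J w"
    and I': "has_ito_integral P \<F> B (\<lambda>s w. \<sigma>' s (x' s w) (u' s w)) t I'"
    and J': "has_jump_integral P \<F> v N c (\<lambda>s w y. G' s (x' s w) (u' s w) y) t J'"
    and eq': "AE w in P. x' t w = p0 w + (LINT s:{0..t}|lborel. b' s (x' s w) (u' s w))
           + fractional_integral \<alpha> (\<lambda>s. \<sigma>1' s (x' s w) (u' s w)) t + I' w + J' w"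
  shows "mean_sq P (\<lambda>w. x' t w - x t w) \<le> ennreal (state_constant T \<alpha> \<Lambda> CARD('p) CARD('l)) *
    (sq_integral P t (\<lambda>s w. x' s w - x s w) + sq_integral P t (\<lambda>s w. u' s w - u s w) + ennreal (\<epsilon>\<^sup>2 * T))"
proof -
  have P: "prob_space P" using complete_filtered_prob_spaceD(1)[OF basis] .
  interpret prob_space P by fact
  have sf: "sigma_finite_measure P" ..
  have sv: "sets v = sets borel" using v by (simp add: intensity_measure_def)
  note ms = L2adD(1)[OF xu(1)] L2adD(1)[OF xu(2)] and ms' = L2adD(1)[OF xu'(1)] L2adD(1)[OF xu'(2)]
  note mt = L2ad_measurable_mono[OF xu(1) t(2)] L2ad_measurable_mono[OF xu(2) t(2)]
  note mt' = L2ad_measurable_mono[OF xu'(1) t(2)] L2ad_measurable_mono[OF xu'(2) t(2)]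
  note mono = time_space_measurable_mono[OF coefficient_measurable t(2)]
  note m = mono[OF meas(1) ms] mono[OF meas(2) ms] mono[OF meas(3) ms]
  note m' = mono[OF meas'(1) ms'] mono[OF meas'(2) ms'] mono[OF meas'(3) ms']
  note mG = jump_coefficient_measurable[OF meas(4) sv t(2) mt]
  note mG' = jump_coefficient_measurable[OF meas'(4) sv t(2) mt']

  define e1 :: "real^'p" where "e1 = axis undefined 1"
  have e1: "norm e1 = 1" by (simp add: e1_def)
  define r where "r s w = 2 * \<epsilon>\<^sup>2 + 2 * (\<Lambda> * ((norm (x' s w - x s w))\<^sup>2 + (norm (u' s w - u s w))\<^sup>2))" for s w
  have r0: "0 \<le> r s w" for s w using \<Lambda> by (simp add: r_def)
  \<comment> \<open>\<open>r\<close> is realised as the squared norm of a vector process along a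
    fixed unit vector, so that \<open>sq_integral_le\<close> applies in
    \<open>E_bound\<close>.\<close>
  define E where "E = sq_integral P t (\<lambda>s w. sqrt (r s w) *\<^sub>R e1)"
  have E_def': "E = (\<integral>\<^sup>+s\<in>{0..t}. (\<integral>\<^sup>+w. ennreal (r s w) \<partial>P) \<partial>lborel)"
    using r0 by (simp add: E_def sq_integral_def e1)
  have le_E: "sq_integral P t (\<lambda>s w. h s w) \<le> E"
    if "\<And>s w. s \<in> {0..t} \<Longrightarrow> (norm (h s w))\<^sup>2 \<le> r s w" for h :: "real \<Rightarrow> 'w \<Rightarrow> 'z::real_normed_vector"
    unfolding E_def' sq_integral_def using that
    by (intro nn_integral_mono) (auto split: split_indicator intro!: nn_integral_mono ennreal_leI)
  have tT: "s \<in> {0..T}" if "s \<in> {0..t}" for s using that t by auto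
  have Eb: "sq_integral P t (\<lambda>s w. b' s (x' s w) (u' s w) - b s (x s w) (u s w)) \<le> E"
    unfolding r_def by (rule le_E, unfold r_def, rule norm_sq_diff_perturbed) (auto intro!: close lipschitz tT)
  have E\<sigma>1: "sq_integral P t (\<lambda>s w. \<sigma>1' s (x' s w) (u' s w) - \<sigma>1 s (x s w) (u s w)) \<le> E"
    by (rule le_E, unfold r_def, rule norm_sq_diff_perturbed) (auto intro!: close lipschitz tT)
  have E\<sigma>: "sq_integral P t (\<lambda>s w. \<sigma>' s (x' s w) (u' s w) - \<sigma> s (x s w) (u s w)) \<le> E"
    by (rule le_E, unfold r_def, rule norm_sq_diff_perturbed) (auto intro!: close lipschitz tT)
  \<comment> \<open>For \<open>G\<close>, closeness and the Lipschitz bound are available only after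
    integration over the marks, so the intermediate value is inserted under the mark
    integral.\<close>
  have EG: "(\<integral>\<^sup>+s\<in>{0..t}. (\<integral>\<^sup>+w. (\<integral>\<^sup>+y\<in>{y. norm y < c}.
      ennreal ((norm (G' s (x' s w) (u' s w) y - G s (x s w) (u s w) y))\<^sup>2) \<partial>v) \<partial>P) \<partial>lborel) \<le> E"
  proof -
    let ?S = "{y :: real^'p. norm y < c}"
    have "(\<integral>\<^sup>+y\<in>?S. ennreal ((norm (G' s (x' s w) (u' s w) y - G s (x s w) (u s w) y))\<^sup>2) \<partial>v) \<le> ennreal (r s w)"
      if s: "s \<in> {0..t}" for s w
    proof -
      have Gm: "H s a d \<in> borel_measurable v"
        if "(\<lambda>(t, x, u, y). H t x u y) \<in> borel_measurable (restrict_space borel {0..T} \<Otimes>\<^sub>M borel \<Otimes>\<^sub>M borel \<Otimes>\<^sub>M borel)"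
        for H :: "real \<Rightarrow> real^'p \<Rightarrow> real^'p \<Rightarrow> real^'p \<Rightarrow> real^'p" and a d
      proof -
        have "(\<lambda>y. (s, a, d, y)) \<in> measurable v (restrict_space borel {0..T} \<Otimes>\<^sub>M borel \<Otimes>\<^sub>M borel \<Otimes>\<^sub>M borel)"
          using tT[OF s] by (intro measurable_Pair measurable_const measurable_ident_sets sv) (auto simp: space_restrict_space)
        from measurable_compose[OF this that] show ?thesis by simp
      qed
      let ?A = "G' s (x' s w) (u' s w)" and ?B = "G s (x' s w) (u' s w)" and ?C = "G s (x s w) (u s w)"
      have mm: "(\<lambda>y. ennreal ((norm (f y - g y))\<^sup>2) * indicator ?S y) \<in> borel_measurable v"
        if "f \<in> borel_measurable v" "g \<in> borel_measurable v" for f g :: "real^'p \<Rightarrow> real^'p"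
      proof -
        have "?S \<in> sets v" by (simp add: sv)
        then show ?thesis using that by measurable
      qed
      have "(\<integral>\<^sup>+y\<in>?S. ennreal ((norm (?A y - ?C y))\<^sup>2) \<partial>v) \<le>
          (\<integral>\<^sup>+y. 2 * (ennreal ((norm (?A y - ?B y))\<^sup>2) * indicator ?S y) + 2 * (ennreal ((norm (?B y - ?C y))\<^sup>2) * indicator ?S y) \<partial>v)"
      proof (rule nn_integral_mono)
        fix y
        have "ennreal ((norm (?A y - ?C y))\<^sup>2) \<le> ennreal (2 * (norm (?A y - ?B y))\<^sup>2 + 2 * (norm (?B y - ?C y))\<^sup>2)"
          using norm_add_sq_le[of "?A y - ?B y" "?B y - ?C y"] by (intro ennreal_leI) simp
        then show "ennreal ((norm (?A y - ?C y))\<^sup>2) * indicator ?S y \<le>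
            2 * (ennreal ((norm (?A y - ?B y))\<^sup>2) * indicator ?S y) + 2 * (ennreal ((norm (?B y - ?C y))\<^sup>2) * indicator ?S y)"
          by (simp add: ennreal_mult split: split_indicator)
      qed
      also have "\<dots> = 2 * (\<integral>\<^sup>+y\<in>?S. ennreal ((norm (?A y - ?B y))\<^sup>2) \<partial>v) + 2 * (\<integral>\<^sup>+y\<in>?S. ennreal ((norm (?B y - ?C y))\<^sup>2) \<partial>v)"
        using mm[OF Gm[OF meas'(4)] Gm[OF meas(4)]] mm[OF Gm[OF meas(4)] Gm[OF meas(4)]]
        by (simp add: nn_integral_add nn_integral_cmult)
      also have "\<dots> \<le> 2 * ennreal (\<epsilon>\<^sup>2) + 2 * ennreal (\<Lambda> * ((norm (x' s w - x s w))\<^sup>2 + (norm (u' s w - u s w))\<^sup>2))"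
        by (intro add_mono mult_left_mono close lipschitz tT s) auto
      also have "\<dots> = ennreal (r s w)"
        using \<Lambda> by (simp add: r_def ennreal_mult)
      finally show ?thesis .
    qed
    then show ?thesis unfolding E_def'
      by (intro nn_integral_mono) (auto split: split_indicator intro!: nn_integral_mono)
  qed

  have E_bound: "E \<le> ennreal (2 + 2 * \<Lambda>) * (sq_integral P t (\<lambda>s w. x' s w - x s w) +
      sq_integral P t (\<lambda>s w. u' s w - u s w) + ennreal (\<epsilon>\<^sup>2 * T))" (is "_ \<le> _ * (?X + ?U + _)")
  proof -
    have "E \<le> ennreal 2 * sq_integral P t (\<lambda>s w. \<bar>\<epsilon>\<bar> *\<^sub>R e1) + ennreal (2 * \<Lambda>) * ?X + ennreal (2 * \<Lambda>) * ?U"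
      unfolding E_def
    proof (rule sq_integral_le[OF sf])
      show "AE s in lborel. s \<in> {0..t} \<longrightarrow> (AE w in P. (norm (sqrt (r s w) *\<^sub>R e1))\<^sup>2 \<le> 2 * (norm (\<bar>\<epsilon>\<bar> *\<^sub>R e1))\<^sup>2 +
          2 * \<Lambda> * (norm (x' s w - x s w))\<^sup>2 + 2 * \<Lambda> * (norm (u' s w - u s w))\<^sup>2)"
        using r0 by (auto simp: e1 r_def algebra_simps intro!: AE_I2)
    qed (use \<Lambda> L2ad_measurable_mono[OF L2ad_diff[OF sf xu'(1) xu(1)] t(2)]
        L2ad_measurable_mono[OF L2ad_diff[OF sf xu'(2) xu(2)] t(2)] in auto)
    also have "sq_integral P t (\<lambda>s w. \<bar>\<epsilon>\<bar> *\<^sub>R e1) \<le> ennreal (\<bar>\<epsilon>\<bar>\<^sup>2 * t)"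
      using t by (intro sq_integral_bounded P) (auto simp: e1)
    also have "ennreal (\<bar>\<epsilon>\<bar>\<^sup>2 * t) \<le> ennreal (\<epsilon>\<^sup>2 * T)"
      using t by (intro ennreal_leI) (auto intro: mult_left_mono)
    finally have "E \<le> ennreal 2 * ennreal (\<epsilon>\<^sup>2 * T) + ennreal (2 * \<Lambda>) * ?X + ennreal (2 * \<Lambda>) * ?U"
      by (simp add: mult_left_mono add_right_mono)
    also have "\<dots> \<le> ennreal (2 + 2 * \<Lambda>) * ennreal (\<epsilon>\<^sup>2 * T) + ennreal (2 + 2 * \<Lambda>) * ?X + ennreal (2 + 2 * \<Lambda>) * ?U"
      using \<Lambda> by (intro add_mono mult_right_mono ennreal_leI) auto
    also have "\<dots> = ennreal (2 + 2 * \<Lambda>) * (?X + ?U + ennreal (\<epsilon>\<^sup>2 * T))"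
      by (simp add: distrib_left add_ac)
    finally show ?thesis .
  qed

  define \<kappa> where "\<kappa> = T powr (2 * \<alpha> - 1) / (2 * \<alpha> - 1)"
  have \<kappa>0: "0 \<le> \<kappa>" using \<alpha> by (simp add: \<kappa>_def)
  \<comment> \<open>The Cauchy-Schwarz bounds of the two time integrals are pathwise and are kept as
    random variables until the expectation is taken.\<close>
  define db d\<sigma> where "db w = (\<integral>\<^sup>+s\<in>{0..t}. ennreal ((norm (b' s (x' s w) (u' s w) - b s (x s w) (u s w)))\<^sup>2) \<partial>lborel)"
    and "d\<sigma> w = (\<integral>\<^sup>+s\<in>{0..t}. ennreal ((norm (\<sigma>1' s (x' s w) (u' s w) - \<sigma>1 s (x s w) (u s w)))\<^sup>2) \<partial>lborel)" for w
  have db: "AE w in P. ennreal ((norm ((LINT s:{0..t}|lborel. b' s (x' s w) (u' s w)) -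
      (LINT s:{0..t}|lborel. b s (x s w) (u s w))))\<^sup>2) \<le> ennreal T * db w"
  proof -
    have "(\<integral>\<^sup>+s\<in>{0..t}. ennreal (1\<^sup>2) \<partial>lborel) \<le> ennreal T" using t by (simp add: ennreal_leI)
    from weighted_time_integral_bound[OF P m(1) fin(1) m'(1) fin'(1) borel_measurable_const[of 1] this]
    show ?thesis unfolding db_def by simp
  qed
  have d\<sigma>: "AE w in P. ennreal ((norm (fractional_integral \<alpha> (\<lambda>s. \<sigma>1' s (x' s w) (u' s w)) t -
      fractional_integral \<alpha> (\<lambda>s. \<sigma>1 s (x s w) (u s w)) t))\<^sup>2) \<le> ennreal \<kappa> * d\<sigma> w"
  proof -
    have "(\<lambda>s. (t - s) powr (\<alpha> - 1)) \<in> borel_measurable borel" by measurable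
    from weighted_time_integral_bound[OF P m(2) fin(2) m'(2) fin'(2) this fractional_kernel_bound[OF \<alpha>(1) t]]
    show ?thesis unfolding d\<sigma>_def \<kappa>_def[symmetric]
    proof eventually_elim
      case (elim w)
      \<comment> \<open>The prefactor of the fractional integral is below \<open>1\<close> and is
        discarded.\<close>
      have "(norm (\<alpha> *\<^sub>R y - \<alpha> *\<^sub>R z))\<^sup>2 \<le> (norm (y - z))\<^sup>2" for y z :: "real^'p"
      proof -
        have "norm (\<alpha> *\<^sub>R y - \<alpha> *\<^sub>R z) = \<alpha> * norm (y - z)" using \<alpha> by (simp add: scaleR_diff_right[symmetric])
        also have "\<dots> \<le> 1 * norm (y - z)" using \<alpha> by (intro mult_right_mono) auto
        finally show ?thesis by (intro power_mono) auto
      qed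
      from order_trans[OF ennreal_leI[OF this] elim] show ?case unfolding fractional_integral_def .
    qed
  qed
  have dm: "db \<in> borel_measurable P" "d\<sigma> \<in> borel_measurable P"
    and di: "(\<integral>\<^sup>+w. db w \<partial>P) \<le> E" "(\<integral>\<^sup>+w. d\<sigma> w \<partial>P) \<le> E"
  proof -
    have 1: "(\<lambda>(s, w). b' s (x' s w) (u' s w) - b s (x s w) (u s w)) \<in> borel_measurable (time_space P t)"
      using borel_measurable_diff[OF m'(1) m(1)] by (simp add: split_beta)
    have 2: "(\<lambda>(s, w). \<sigma>1' s (x' s w) (u' s w) - \<sigma>1 s (x s w) (u s w)) \<in> borel_measurable (time_space P t)"
      using borel_measurable_diff[OF m'(2) m(2)] by (simp add: split_beta)
    show "db \<in> borel_measurable P" "(\<integral>\<^sup>+w. db w \<partial>P) \<le> E"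
      unfolding db_def using sq_integral_swap[OF P 1] Eb by auto
    show "d\<sigma> \<in> borel_measurable P" "(\<integral>\<^sup>+w. d\<sigma> w \<partial>P) \<le> E"
      unfolding d\<sigma>_def using sq_integral_swap[OF P 2] E\<sigma>1 by auto
  qed
  have IJm: "I \<in> borel_measurable P" "I' \<in> borel_measurable P" "J \<in> borel_measurable P" "J' \<in> borel_measurable P"
    using I I' J J' by (auto simp: has_ito_integral_def has_jump_integral_def)
  let ?CI = "real CARD('p) * (real CARD('l))\<^sup>2" and ?CJ = "real CARD('p)"
  have dI: "mean_sq P (\<lambda>w. I' w - I w) \<le> 9 * ennreal ?CI * E"
    by (rule order_trans[OF ito_integral_bound[OF basis B t(1) I' I m'(3) m(3)]])
      (intro mult_left_mono E\<sigma>[unfolded sq_integral_def], simp)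
  have dJ: "mean_sq P (\<lambda>w. J' w - J w) \<le> 9 * ennreal ?CJ * E"
    by (rule order_trans[OF jump_integral_bound[OF basis v N t(1) J' J mG' mG]])
      (intro mult_left_mono EG, simp)

  have "mean_sq P (\<lambda>w. x' t w - x t w) \<le>
      (\<integral>\<^sup>+w. 4 * (ennreal T * db w + ennreal \<kappa> * d\<sigma> w + ennreal ((norm (I' w - I w))\<^sup>2) + ennreal ((norm (J' w - J w))\<^sup>2)) \<partial>P)"
  proof (rule nn_integral_mono_AE, use eq eq' db d\<sigma> in eventually_elim)
    case (elim w)
    let ?a = "(LINT s:{0..t}|lborel. b' s (x' s w) (u' s w)) - (LINT s:{0..t}|lborel. b s (x s w) (u s w))"
    let ?b = "fractional_integral \<alpha> (\<lambda>s. \<sigma>1' s (x' s w) (u' s w)) t - fractional_integral \<alpha> (\<lambda>s. \<sigma>1 s (x s w) (u s w)) t"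
    have "x' t w - x t w = ?a + ?b + (I' w - I w) + (J' w - J w)"
      unfolding elim(1,2) by simp
    then have "ennreal ((norm (x' t w - x t w))\<^sup>2) \<le>
        ennreal (4 * ((norm ?a)\<^sup>2 + (norm ?b)\<^sup>2 + (norm (I' w - I w))\<^sup>2 + (norm (J' w - J w))\<^sup>2))"
      by (simp only:) (intro ennreal_leI norm_add4_sq_le)
    also have "\<dots> = 4 * (ennreal ((norm ?a)\<^sup>2) + ennreal ((norm ?b)\<^sup>2) + ennreal ((norm (I' w - I w))\<^sup>2) + ennreal ((norm (J' w - J w))\<^sup>2))"
      by (simp add: ennreal_mult')
    also have "\<dots> \<le> 4 * (ennreal T * db w + ennreal \<kappa> * d\<sigma> w + ennreal ((norm (I' w - I w))\<^sup>2) + ennreal ((norm (J' w - J w))\<^sup>2))"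
      by (intro mult_left_mono add_mono elim(3,4) order_refl) simp
    finally show ?case .
  qed
  also have "\<dots> = 4 * (ennreal T * (\<integral>\<^sup>+w. db w \<partial>P) + ennreal \<kappa> * (\<integral>\<^sup>+w. d\<sigma> w \<partial>P) +
      mean_sq P (\<lambda>w. I' w - I w) + mean_sq P (\<lambda>w. J' w - J w))"
    using dm IJm by (simp add: nn_integral_cmult nn_integral_add)
  also have "\<dots> \<le> 4 * (ennreal T * E + ennreal \<kappa> * E + 9 * ennreal ?CI * E + 9 * ennreal ?CJ * E)"
    by (intro mult_left_mono add_mono di dI dJ) auto
  also have "\<dots> = ennreal (4 * (T + \<kappa> + 9 * ?CI + 9 * ?CJ)) * E"
    using t \<kappa>0 by (simp add: ennreal_mult ennreal_plus distrib_right mult.assoc)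
  also have "\<dots> \<le> ennreal (4 * (T + \<kappa> + 9 * ?CI + 9 * ?CJ)) *
      (ennreal (2 + 2 * \<Lambda>) * (?X + ?U + ennreal (\<epsilon>\<^sup>2 * T)))"
    by (intro mult_left_mono E_bound) simp
  also have "\<dots> = ennreal (state_constant T \<alpha> \<Lambda> CARD('p) CARD('l)) * (?X + ?U + ennreal (\<epsilon>\<^sup>2 * T))"
    using t \<kappa>0 \<Lambda> unfolding state_constant_def \<kappa>_def[symmetric]
    by (subst ennreal_mult) (auto simp: mult.assoc)
  finally show ?thesis .
qed

section \<open>Stability of the system\<close>

theorem theorem5p4:
  fixes P :: "'w measure" and \<F> :: "real \<Rightarrow> 'w measure" and T \<alpha> c :: real
    and B :: "real \<Rightarrow> 'w \<Rightarrow> real^'l" and v :: "(real^'p) measure"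
    and N :: "'w \<Rightarrow> (real \<times> (real^'p)) measure" and p0 :: "'w \<Rightarrow> real^'p"
    and K :: "'m::complete_space \<Rightarrow> (real^'p) set"
    and b \<sigma>1 :: "'m \<Rightarrow> real \<Rightarrow> real^'p \<Rightarrow> real^'p \<Rightarrow> real^'p"
    and \<sigma> :: "'m \<Rightarrow> real \<Rightarrow> real^'p \<Rightarrow> real^'p \<Rightarrow> real^'l^'p"
    and G :: "'m \<Rightarrow> real \<Rightarrow> real^'p \<Rightarrow> real^'p \<Rightarrow> real^'p \<Rightarrow> real^'p"
    and F :: "'m \<Rightarrow> real \<Rightarrow> 'w \<Rightarrow> real^'p \<Rightarrow> real^'p \<Rightarrow> real^'p"
    and lam mu :: 'm and lams mus :: "nat \<Rightarrow> 'm"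
    and C_bar L_F :: real
    and K_b K_\<sigma> K_\<sigma>1 K_G L_b L_\<sigma> L_\<sigma>1 L_G :: "'m \<Rightarrow> real"
    and x u :: "real \<Rightarrow> 'w \<Rightarrow> real^'p"
    and xs us :: "nat \<Rightarrow> nat \<Rightarrow> real \<Rightarrow> 'w \<Rightarrow> real^'p"
  assumes basis: "complete_filtered_prob_space P \<F>"
    and T_pos: "T > 0" and \<alpha>: "1 / 2 < \<alpha>" "\<alpha> < 1" and c_nonneg: "c \<ge> 0"
    and B: "brownian_motion P \<F> B"
    and v: "intensity_measure v"
    and N: "poisson_random_measure P \<F> v N"
    and B_N_indep: "independent_noises P B N"
    and p0: "p0 \<in> borel_measurable P" "(\<integral>\<^sup>+ \<omega>. ennreal ((norm (p0 \<omega>))\<^sup>2) \<partial>P) < \<infinity>"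
    and K: "\<And>m. closed (K m)" "\<And>m. convex (K m)" "\<And>m. 0 \<in> K m"
    and b_meas: "\<And>l. (\<lambda>(t, x, u). b l t x u) \<in>
          borel_measurable (restrict_space borel {0..T} \<Otimes>\<^sub>M borel \<Otimes>\<^sub>M borel)"
    and \<sigma>1_meas: "\<And>l. (\<lambda>(t, x, u). \<sigma>1 l t x u) \<in>
          borel_measurable (restrict_space borel {0..T} \<Otimes>\<^sub>M borel \<Otimes>\<^sub>M borel)"
    and \<sigma>_meas: "\<And>l. (\<lambda>(t, x, u). \<sigma> l t x u) \<in>
          borel_measurable (restrict_space borel {0..T} \<Otimes>\<^sub>M borel \<Otimes>\<^sub>M borel)"
    and G_meas: "\<And>l. (\<lambda>(t, x, u, y). G l t x u y) \<in>
          borel_measurable (restrict_space borel {0..T} \<Otimes>\<^sub>M borel \<Otimes>\<^sub>M borel \<Otimes>\<^sub>M borel)"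
    and F_meas: "\<And>l. (\<lambda>(t, \<omega>, x, u). F l t \<omega> x u) \<in>
          borel_measurable (restrict_space borel {0..T} \<Otimes>\<^sub>M P \<Otimes>\<^sub>M borel \<Otimes>\<^sub>M borel)"
    and F_adapted: "\<And>l t. t \<in> {0..T} \<Longrightarrow>
          (\<lambda>(\<omega>, x, u). F l t \<omega> x u) \<in> borel_measurable (\<F> t \<Otimes>\<^sub>M borel \<Otimes>\<^sub>M borel)"
    and \<sigma>1_cont: "\<And>l x u. continuous_on {0..T} (\<lambda>t. \<sigma>1 l t x u)"
    and jump_martingale: "\<And>l f g. f \<in> L2ad P \<F> T \<Longrightarrow> g \<in> L2ad P \<F> T \<Longrightarrow>
          \<exists>J. (\<forall>t\<in>{0..T}.
                 has_jump_integral P \<F> v N c (\<lambda>s \<omega> y. G l s (f s \<omega>) (g s \<omega>) y) t (J t)) \<and>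
              square_integrable_martingale P \<F> T J"
    and F_L2: "\<And>l f g. f \<in> L2ad P \<F> T \<Longrightarrow> g \<in> L2ad P \<F> T \<Longrightarrow>
          (\<lambda>s \<omega>. F l s \<omega> (f s \<omega>) (g s \<omega>)) \<in> L2ad P \<F> T"
    and lams: "lams \<longlonglongrightarrow> lam" and mus: "mus \<longlonglongrightarrow> mu"
    and C_bar_pos: "C_bar > 0" and L_F_pos: "L_F > 0" and L_F_gt: "L_F > C_bar"
    and const_pos: "\<And>l. K_b l > 0 \<and> K_\<sigma> l > 0 \<and> K_\<sigma>1 l > 0 \<and> K_G l > 0 \<and>
          L_b l > 0 \<and> L_\<sigma> l > 0 \<and> L_\<sigma>1 l > 0 \<and> L_G l > 0"
    and growth:
      "\<And>l t x u. t \<in> {0..T} \<Longrightarrow> (norm (b l t x u))\<^sup>2 \<le> K_b l * (1 + (norm x)\<^sup>2 + (norm u)\<^sup>2)"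
      "\<And>l t x u. t \<in> {0..T} \<Longrightarrow> (norm (\<sigma> l t x u))\<^sup>2 \<le> K_\<sigma> l * (1 + (norm x)\<^sup>2 + (norm u)\<^sup>2)"
      "\<And>l t x u. t \<in> {0..T} \<Longrightarrow> (norm (\<sigma>1 l t x u))\<^sup>2 \<le> K_\<sigma>1 l * (1 + (norm x)\<^sup>2 + (norm u)\<^sup>2)"
      "\<And>l t x u. t \<in> {0..T} \<Longrightarrow>
         (\<integral>\<^sup>+ y\<in>{y. norm y < c}. ennreal ((norm (G l t x u y))\<^sup>2) \<partial>v)
           \<le> ennreal (K_G l * (1 + (norm x)\<^sup>2 + (norm u)\<^sup>2))"
    and lipschitz:
      "\<And>l t x1 x2 u1 u2. t \<in> {0..T} \<Longrightarrow> (norm (b l t x1 u1 - b l t x2 u2))\<^sup>2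
         \<le> L_b l * ((norm (x1 - x2))\<^sup>2 + (norm (u1 - u2))\<^sup>2)"
      "\<And>l t x1 x2 u1 u2. t \<in> {0..T} \<Longrightarrow> (norm (\<sigma> l t x1 u1 - \<sigma> l t x2 u2))\<^sup>2
         \<le> L_\<sigma> l * ((norm (x1 - x2))\<^sup>2 + (norm (u1 - u2))\<^sup>2)"
      "\<And>l t x1 x2 u1 u2. t \<in> {0..T} \<Longrightarrow> (norm (\<sigma>1 l t x1 u1 - \<sigma>1 l t x2 u2))\<^sup>2
         \<le> L_\<sigma>1 l * ((norm (x1 - x2))\<^sup>2 + (norm (u1 - u2))\<^sup>2)"
      "\<And>l t x1 x2 u1 u2. t \<in> {0..T} \<Longrightarrow>
         (\<integral>\<^sup>+ y\<in>{y. norm y < c}. ennreal ((norm (G l t x1 u1 y - G l t x2 u2 y))\<^sup>2) \<partial>v)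
           \<le> ennreal (L_G l * ((norm (x1 - x2))\<^sup>2 + (norm (u1 - u2))\<^sup>2))"
    and F_lipschitz: "\<And>l f1 f2 g1 g2.
          f1 \<in> L2ad P \<F> T \<Longrightarrow> f2 \<in> L2ad P \<F> T \<Longrightarrow> g1 \<in> L2ad P \<F> T \<Longrightarrow> g2 \<in> L2ad P \<F> T \<Longrightarrow>
          H_dist P T (\<lambda>s \<omega>. F l s \<omega> (f1 s \<omega>) (g1 s \<omega>)) (\<lambda>s \<omega>. F l s \<omega> (f2 s \<omega>) (g2 s \<omega>))
            \<le> L_F * (H_dist P T f1 f2 + H_dist P T g1 g2)"
    and F_monotone: "\<And>l f g1 g2.
          f \<in> L2ad P \<F> T \<Longrightarrow> g1 \<in> L2ad P \<F> T \<Longrightarrow> g2 \<in> L2ad P \<F> T \<Longrightarrow>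
          H_inner P T
            (\<lambda>s \<omega>. F l s \<omega> (f s \<omega>) (g1 s \<omega>) - F l s \<omega> (f s \<omega>) (g2 s \<omega>))
            (\<lambda>s \<omega>. g1 s \<omega> - g2 s \<omega>)
            \<ge> C_bar * (H_dist P T g1 g2)\<^sup>2"
    and unif_cont:
      "\<And>\<epsilon>. \<epsilon> > 0 \<Longrightarrow> \<exists>\<delta>>0. \<forall>l1 l2. dist l1 l2 < \<delta> \<longrightarrow>
         (\<forall>t\<in>{0..T}. \<forall>x u. norm (b l1 t x u - b l2 t x u) < \<epsilon>)"
      "\<And>\<epsilon>. \<epsilon> > 0 \<Longrightarrow> \<exists>\<delta>>0. \<forall>l1 l2. dist l1 l2 < \<delta> \<longrightarrow>
         (\<forall>t\<in>{0..T}. \<forall>x u. norm (\<sigma> l1 t x u - \<sigma> l2 t x u) < \<epsilon>)"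
      "\<And>\<epsilon>. \<epsilon> > 0 \<Longrightarrow> \<exists>\<delta>>0. \<forall>l1 l2. dist l1 l2 < \<delta> \<longrightarrow>
         (\<forall>t\<in>{0..T}. \<forall>x u. norm (\<sigma>1 l1 t x u - \<sigma>1 l2 t x u) < \<epsilon>)"
      "\<And>\<epsilon>. \<epsilon> > 0 \<Longrightarrow> \<exists>\<delta>>0. \<forall>l1 l2. dist l1 l2 < \<delta> \<longrightarrow>
         (\<forall>t\<in>{0..T}. \<forall>x u.
            (\<integral>\<^sup>+ y\<in>{y. norm y < c}. ennreal ((norm (G l1 t x u y - G l2 t x u y))\<^sup>2) \<partial>v)
              < ennreal (\<epsilon>\<^sup>2))"
      "\<And>\<epsilon>. \<epsilon> > 0 \<Longrightarrow> \<exists>\<delta>>0. \<forall>l1 l2. dist l1 l2 < \<delta> \<longrightarrow>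
         (\<forall>t\<in>{0..T}. \<forall>\<omega>\<in>space P. \<forall>x u. norm (F l1 t \<omega> x u - F l2 t \<omega> x u) < \<epsilon>)"
    and mosco: "mosco_converges (\<lambda>n. K (mus n)) (K mu)"
    and sol: "mas_unique_solution P \<F> T \<alpha> c B v N p0
                (b lam) (\<sigma>1 lam) (\<sigma> lam) (G lam) (F lam) (K mu) x u"
    and sols: "\<And>m n. mas_unique_solution P \<F> T \<alpha> c B v N p0
                (b (lams m)) (\<sigma>1 (lams m)) (\<sigma> (lams m)) (G (lams m)) (F (lams m)) (K (mus n))
                (xs m n) (us m n)"
  shows "((\<lambda>(m, n). H_dist P T (xs m n) x) \<longlongrightarrow> 0) (sequentially \<times>\<^sub>F sequentially) \<and>
         ((\<lambda>(m, n). H_dist P T (us m n) u) \<longlongrightarrow> 0) (sequentially \<times>\<^sub>F sequentially)"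
proof -
  have P: "prob_space P" using complete_filtered_prob_spaceD(1)[OF basis] .
  interpret prob_space P by fact
  have sf: "sigma_finite_measure P" ..
  have T0: "0 \<le> T" using T_pos by simp
  define \<rho> where "\<rho> = C_bar / L_F\<^sup>2"
  have \<rho>0: "0 \<le> \<rho>" using C_bar_pos by (simp add: \<rho>_def)
  have Kne: "K m \<noteq> {}" for m using K(3)[of m] by auto
  have solD: "x' \<in> L2ad P \<F> T" "u' \<in> L2ad P \<F> T"
      "AE s in lborel. s \<in> {0..T} \<longrightarrow> (AE w in P.
        u' s w = closest_point (K \<mu>) (u' s w - \<rho> *\<^sub>R F l s w (x' s w) (u' s w)))"
      "mas_solution P \<F> T \<alpha> c B v N p0 (b l) (\<sigma>1 l) (\<sigma> l) (G l) (F l) (K \<mu>) x' u'"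
    if "mas_unique_solution P \<F> T \<alpha> c B v N p0 (b l) (\<sigma>1 l) (\<sigma> l) (G l) (F l) (K \<mu>) x' u'"
    for l \<mu> x' u'
  proof -
    show s: "mas_solution P \<F> T \<alpha> c B v N p0 (b l) (\<sigma>1 l) (\<sigma> l) (G l) (F l) (K \<mu>) x' u'"
      using that unfolding mas_unique_solution_def by (rule conjunct1)
    have con: "u' \<in> constrained_L2ad P \<F> T (K \<mu>)" and
      vi: "AE t in lborel. t \<in> {0..T} \<longrightarrow> (AE w in P. \<forall>y\<in>K \<mu>. F l t w (x' t w) (u' t w) \<bullet> (y - u' t w) \<ge> 0)"
      using s unfolding mas_solution_def by blast+
    show "x' \<in> L2ad P \<F> T" using s unfolding mas_solution_def by (elim conjE)
    show "u' \<in> L2ad P \<F> T" using con by (simp add: constrained_L2ad_def)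
    have inK: "AE t in lborel. t \<in> {0..T} \<longrightarrow> (AE w in P. u' t w \<in> K \<mu>)"
      using con by (simp add: constrained_L2ad_def)
    show "AE s in lborel. s \<in> {0..T} \<longrightarrow> (AE w in P.
        u' s w = closest_point (K \<mu>) (u' s w - \<rho> *\<^sub>R F l s w (x' s w) (u' s w)))"
      using inK vi
    proof eventually_elim
      case (elim s)
      show ?case
      proof
        assume "s \<in> {0..T}"
        from elim[rule_format, OF this]
        show "AE w in P. u' s w = closest_point (K \<mu>) (u' s w - \<rho> *\<^sub>R F l s w (x' s w) (u' s w))"
          by eventually_elim (rule variational_inequality_closest_point[OF K(1,2) _ \<rho>0])
      qed
    qed
  qed
  note S = solD[OF sol] and Sn = solD[OF sols]
  have fin: "sq_integral P t (\<lambda>s w. b l s (f s w) (g s w)) < \<infinity>" "sq_integral P t (\<lambda>s w. \<sigma>1 l s (f s w) (g s w)) < \<infinity>"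
    if "0 \<le> t" "t \<le> T" "f \<in> L2ad P \<F> T" "g \<in> L2ad P \<F> T" for l t f g
  proof -
    have K0: "0 \<le> K_b l" "0 \<le> K_\<sigma>1 l" using const_pos[of l] by auto
    show "sq_integral P t (\<lambda>s w. b l s (f s w) (g s w)) < \<infinity>"
      by (rule sq_integral_growth[OF P that K0(1)]) (rule growth(1))
    show "sq_integral P t (\<lambda>s w. \<sigma>1 l s (f s w) (g s w)) < \<infinity>"
      by (rule sq_integral_growth[OF P that K0(2)]) (rule growth(3))
  qed

  define \<Lambda> where "\<Lambda> = L_b lam + L_\<sigma> lam + L_\<sigma>1 lam + L_G lam"
  have \<Lambda>: "0 \<le> \<Lambda>" "L_b lam \<le> \<Lambda>" "L_\<sigma> lam \<le> \<Lambda>" "L_\<sigma>1 lam \<le> \<Lambda>" "L_G lam \<le> \<Lambda>"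
    using const_pos[of lam] by (auto simp: \<Lambda>_def)
  have lip\<Lambda>: "L * ((norm (a :: real^'p))\<^sup>2 + (norm (d :: real^'p))\<^sup>2) \<le> \<Lambda> * ((norm a)\<^sup>2 + (norm d)\<^sup>2)" if "L \<le> \<Lambda>" for L a d
    using that by (intro mult_right_mono) auto
  define z where "z s w = u s w - \<rho> *\<^sub>R F lam s w (x s w) (u s w)" for s w
  define \<delta> where "\<delta> n = sq_integral P T (\<lambda>s w. closest_point (K (mus n)) (z s w) - closest_point (K mu) (z s w))" for n
  define Cv where "Cv = vi_constant C_bar L_F"
  define Cs where "Cs = state_constant T \<alpha> \<Lambda> CARD('p) CARD('l)"
  have Cv: "0 < Cv" unfolding Cv_def by (rule vi_constant_pos[OF C_bar_pos L_F_pos])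
  have Cs: "0 < Cs" unfolding Cs_def state_constant_def
    using T_pos \<alpha> \<Lambda> by (intro mult_pos_pos add_pos_nonneg) auto

  text \<open>The dominating function is \<open>(2 * norm z)\<^sup>2\<close>, because \<open>0\<close> lies in every constraint set.\<close>
  have \<delta>_lim: "\<delta> \<longlonglongrightarrow> 0"
  proof -
    have z: "z \<in> L2ad P \<F> T"
      using L2ad_lincomb[OF sf S(2) F_L2[OF S(1,2)], of 1 "- \<rho>" lam] by (simp add: z_def[abs_def])
    let ?z = "\<lambda>p. case p of (s, w) \<Rightarrow> z s w"
    let ?q = "\<lambda>n p. closest_point (K (mus n)) (?z p) - closest_point (K mu) (?z p)"
    have cp: "closest_point (K m) \<in> borel_measurable borel" for m
      using K Kne by (intro borel_measurable_continuous_onI continuous_on_closest_point)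
    have qm: "?q n \<in> borel_measurable (time_space P T)" for n
      by (intro borel_measurable_diff measurable_compose[OF L2adD(1)[OF z] cp])
    have \<delta>_eq: "\<delta> n = mean_sq (time_space P T) (?q n)" for n
      unfolding \<delta>_def using qm[of n] by (subst sq_integral_eq[OF sf]) (auto simp: split_beta)
    have "(\<lambda>n. \<integral>\<^sup>+p. ennreal ((norm (?q n p))\<^sup>2) \<partial>time_space P T) \<longlonglongrightarrow> (\<integral>\<^sup>+p. 0 \<partial>time_space P T)"
    proof (rule nn_integral_dominated_convergence)
      show "(\<lambda>p. ennreal ((norm (?q n p))\<^sup>2)) \<in> borel_measurable (time_space P T)" for n
        by (rule measurable_compose[OF qm, of "\<lambda>x. ennreal ((norm x)\<^sup>2)"]) measurable
      show wm: "(\<lambda>p. 4 * ennreal ((norm (?z p))\<^sup>2)) \<in> borel_measurable (time_space P T)"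
        by (rule measurable_compose[OF L2adD(1)[OF z], of "\<lambda>x. 4 * ennreal ((norm x)\<^sup>2)"]) measurable
      have nm: "(\<lambda>p. ennreal ((norm (?z p))\<^sup>2)) \<in> borel_measurable (time_space P T)"
        by (rule measurable_compose[OF L2adD(1)[OF z], of "\<lambda>x. ennreal ((norm x)\<^sup>2)"]) measurable
      show "(\<integral>\<^sup>+p. 4 * ennreal ((norm (?z p))\<^sup>2) \<partial>time_space P T) < \<infinity>"
        using L2adD(2)[OF z] unfolding nn_integral_cmult[OF nm] sq_integral_eq[OF sf L2adD(1)[OF z]]
        by (simp add: ennreal_mult_less_top)
      show "AE p in time_space P T. ennreal ((norm (?q n p))\<^sup>2) \<le> 4 * ennreal ((norm (?z p))\<^sup>2)" for n
      proof (rule AE_I2)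
        fix p
        have "norm (?q n p) \<le> norm (closest_point (K (mus n)) (?z p)) + norm (closest_point (K mu) (?z p))"
          by (rule norm_triangle_ineq4)
        also have "\<dots> \<le> 2 * norm (?z p)"
          using norm_closest_point_le[OF K, of "mus n" "?z p"] norm_closest_point_le[OF K, of mu "?z p"] by simp
        finally have "(norm (?q n p))\<^sup>2 \<le> (2 * norm (?z p))\<^sup>2" by (intro power_mono) auto
        then have "ennreal ((norm (?q n p))\<^sup>2) \<le> ennreal (4 * (norm (?z p))\<^sup>2)"
          by (intro ennreal_leI) (simp add: power_mult_distrib)
        then show "ennreal ((norm (?q n p))\<^sup>2) \<le> 4 * ennreal ((norm (?z p))\<^sup>2)" by (simp add: ennreal_mult)
      qed
      show "AE p in time_space P T. (\<lambda>n. ennreal ((norm (?q n p))\<^sup>2)) \<longlonglongrightarrow> 0"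
      proof (rule AE_I2)
        fix p
        have "(\<lambda>n. closest_point (K (mus n)) (?z p)) \<longlonglongrightarrow> closest_point (K mu) (?z p)"
          by (rule mosco_closest_point_tendsto[OF K K mosco])
        then have "(\<lambda>n. (norm (?q n p))\<^sup>2) \<longlonglongrightarrow> (norm (closest_point (K mu) (?z p) - closest_point (K mu) (?z p)))\<^sup>2"
          by (intro tendsto_intros)
        then show "(\<lambda>n. ennreal ((norm (?q n p))\<^sup>2)) \<longlonglongrightarrow> 0"
          using tendsto_ennrealI by fastforce
      qed
    qed simp
    then show ?thesis by (simp add: \<delta>_eq[abs_def])
  qed

  \<comment> \<open>\<open>Q\<close> stands for any of the five uniform closeness statements for the
    coefficients.\<close>
  have lam_close: "eventually (\<lambda>m. Q (lams m) lam) sequentially"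
    if ex: "\<exists>\<delta>>0. \<forall>l1 l2. dist l1 l2 < \<delta> \<longrightarrow> Q l1 l2" for Q :: "'m \<Rightarrow> 'm \<Rightarrow> bool"
  proof -
    obtain d where d: "d > 0" and Q: "\<forall>l1 l2. dist l1 l2 < d \<longrightarrow> Q l1 l2"
      using ex by blast
    from tendstoD[OF lams d] show ?thesis
      by (rule eventually_mono) (rule Q[rule_format])
  qed

  \<comment> \<open>\<open>C1\<close> results from inserting the control estimate with constant
    \<open>Cv\<close> into the state estimate with constant \<open>Cs\<close>; \<open>Cx\<close>
    adds the Gronwall factor on [0, T]; \<open>C2\<close> dominates the factor \<open>Cx\<close> of
    the state and the factor \<open>Cv * (Cx + 1)\<close> of the control.\<close>
  define C1 where "C1 = Cs * (1 + Cv)"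
  have C1: "0 < C1" using Cs Cv by (simp add: C1_def)
  define Cx where "Cx = C1 * T * exp (C1 * T)"
  have Cx: "0 < Cx" using C1 T_pos by (simp add: Cx_def)
  define C2 where "C2 = Cx + Cv * (Cx + 1)"
  have "0 < Cv * (Cx + 1)" using Cx Cv by (intro mult_pos_pos) linarith+
  then have C2: "0 < C2" "Cx \<le> C2" "Cv * (Cx + 1) \<le> C2" using Cx unfolding C2_def by linarith+

  \<comment> \<open>The constant \<open>C2\<close> depends on neither index: \<open>m\<close> enters
    through the coefficient error \<open>\<epsilon>\<close>, \<open>n\<close> through the projection
    error \<open>d\<close>.\<close>
  have main: "(H_dist P T (xs m n) x)\<^sup>2 \<le> C2 * (\<epsilon>\<^sup>2 * T + d) \<and> (H_dist P T (us m n) u)\<^sup>2 \<le> C2 * (\<epsilon>\<^sup>2 * T + d)"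
    if eps: "0 < \<epsilon>" and d: "\<delta> n \<le> ennreal d" "0 \<le> d"
      and close: "\<forall>t\<in>{0..T}. \<forall>x u. norm (b (lams m) t x u - b lam t x u) < \<epsilon>"
        "\<forall>t\<in>{0..T}. \<forall>x u. norm (\<sigma> (lams m) t x u - \<sigma> lam t x u) < \<epsilon>"
        "\<forall>t\<in>{0..T}. \<forall>x u. norm (\<sigma>1 (lams m) t x u - \<sigma>1 lam t x u) < \<epsilon>"
        "\<forall>t\<in>{0..T}. \<forall>x u. (\<integral>\<^sup>+ y\<in>{y. norm y < c}. ennreal ((norm (G (lams m) t x u y - G lam t x u y))\<^sup>2) \<partial>v) < ennreal (\<epsilon>\<^sup>2)"
        "\<forall>t\<in>{0..T}. \<forall>w\<in>space P. \<forall>x u. norm (F (lams m) t w x u - F lam t w x u) < \<epsilon>"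
    for \<epsilon> d m n
  proof -
    define e where "e = \<epsilon>\<^sup>2 * T"
    have e: "0 \<le> e" using T0 by (simp add: e_def)
    let ?X = "\<lambda>t. sq_integral P t (\<lambda>s w. xs m n s w - x s w)" and ?U = "\<lambda>t. sq_integral P t (\<lambda>s w. us m n s w - u s w)"
    have U: "?U t \<le> ennreal Cv * (?X t + ennreal e + ennreal d)" if t: "0 \<le> t" "t \<le> T" for t
    proof -
      have "?U t \<le> ennreal Cv * (?X t + ennreal (\<epsilon>\<^sup>2 * T) + \<delta> n)"
        unfolding Cv_def \<delta>_def z_def
        by (rule variational_inequality_stability[where F = "F lam" and F' = "F (lams m)" and x = x and u = u
            and x' = "xs m n" and u' = "us m n" and K = "K mu" and K' = "K (mus n)" and \<F> = \<F>, OF P t])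
          (assumption | rule F_L2 F_lipschitz F_monotone C_bar_pos L_F_gt K(1,2) Kne S(1-3) Sn(1-3) \<rho>_def
            | use close(5) in \<open>simp add: less_imp_le\<close>)+
      also have "\<dots> \<le> ennreal Cv * (?X t + ennreal e + ennreal d)"
        unfolding e_def by (intro mult_left_mono add_left_mono d) simp
      finally show ?thesis .
    qed
    have X: "mean_sq P (\<lambda>w. xs m n t w - x t w) \<le> ennreal C1 * ?X t + ennreal (C1 * (e + d))"
      if t: "t \<in> {0..T}" for t
    proof -
      have t': "0 \<le> t" "t \<le> T" using t by auto
      obtain I J where IJ: "has_ito_integral P \<F> B (\<lambda>s w. \<sigma> lam s (x s w) (u s w)) t (I t)"
        "has_jump_integral P \<F> v N c (\<lambda>s w y. G lam s (x s w) (u s w) y) t (J t)"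
        "AE w in P. x t w = p0 w + (LINT s:{0..t}|lborel. b lam s (x s w) (u s w))
           + fractional_integral \<alpha> (\<lambda>s. \<sigma>1 lam s (x s w) (u s w)) t + I t w + J t w"
        using S(4) t unfolding mas_solution_def by blast
      obtain I' J' where IJ': "has_ito_integral P \<F> B (\<lambda>s w. \<sigma> (lams m) s (xs m n s w) (us m n s w)) t (I' t)"
        "has_jump_integral P \<F> v N c (\<lambda>s w y. G (lams m) s (xs m n s w) (us m n s w) y) t (J' t)"
        "AE w in P. xs m n t w = p0 w + (LINT s:{0..t}|lborel. b (lams m) s (xs m n s w) (us m n s w))
           + fractional_integral \<alpha> (\<lambda>s. \<sigma>1 (lams m) s (xs m n s w) (us m n s w)) t + I' t w + J' t w"
        using Sn(4)[of m n] t unfolding mas_solution_def by blast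
      have "mean_sq P (\<lambda>w. xs m n t w - x t w) \<le> ennreal Cs * (?X t + ?U t + ennreal (\<epsilon>\<^sup>2 * T))"
        unfolding Cs_def
        by (rule state_stability[OF basis B v N t' \<alpha> S(1,2) Sn(1,2) b_meas \<sigma>1_meas \<sigma>_meas G_meas
            b_meas \<sigma>1_meas \<sigma>_meas G_meas fin[OF t' S(1,2)] fin[OF t' Sn(1,2)] \<Lambda>(1)])
          (rule order_trans[OF lipschitz(1) lip\<Lambda>[OF \<Lambda>(2)]] order_trans[OF lipschitz(2) lip\<Lambda>[OF \<Lambda>(3)]]
            order_trans[OF lipschitz(3) lip\<Lambda>[OF \<Lambda>(4)]] order_trans[OF lipschitz(4) ennreal_leI[OF lip\<Lambda>[OF \<Lambda>(5)]]]
            close(1-4)[THEN bspec, THEN spec, THEN spec, THEN less_imp_le] IJ IJ' | assumption)+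
      also have "\<dots> \<le> ennreal Cs * (?X t + ennreal Cv * (?X t + ennreal e + ennreal d) + (ennreal e + ennreal d))"
        unfolding e_def[symmetric] by (intro mult_left_mono add_mono U t') auto
      also have "\<dots> = ennreal Cs * ((1 + ennreal Cv) * (?X t + (ennreal e + ennreal d)))"
        by (simp add: distrib_left distrib_right add_ac)
      also have "\<dots> = ennreal C1 * (?X t + (ennreal e + ennreal d))"
        using Cs Cv by (simp add: C1_def ennreal_mult ennreal_plus mult.assoc)
      also have "\<dots> = ennreal C1 * ?X t + ennreal (C1 * (e + d))"
        using C1 e d(2) by (simp add: distrib_left ennreal_mult ennreal_plus)
      finally show ?thesis .
    qed
    have dx: "(\<lambda>s w. xs m n s w - x s w) \<in> L2ad P \<F> T" and du: "(\<lambda>s w. us m n s w - u s w) \<in> L2ad P \<F> T"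
      by (intro L2ad_diff[OF sf] S(1,2) Sn(1,2))+
    have "?X T \<le> ennreal (C1 * (e + d) * T * exp (C1 * T))"
      unfolding sq_integral_def
    proof (rule nn_integral_gronwall[OF T0])
      show "mean_sq P (\<lambda>w. xs m n t w - x t w) \<le> ennreal C1 *
          (\<integral>\<^sup>+s\<in>{0..t}. mean_sq P (\<lambda>w. xs m n s w - x s w) \<partial>lborel) + ennreal (C1 * (e + d))"
        if "t \<in> {0..T}" for t
        using X[OF that] unfolding sq_integral_def .
      show "(\<integral>\<^sup>+s\<in>{0..T}. mean_sq P (\<lambda>w. xs m n s w - x s w) \<partial>lborel) < \<infinity>"
        using L2adD(2)[OF dx] unfolding sq_integral_def .
    qed (use C1 e d in auto)
    then have XT: "?X T \<le> ennreal (Cx * (e + d))" by (simp add: Cx_def mult_ac)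
    have ed: "0 \<le> e + d" using e d by simp
    have "?U T \<le> ennreal Cv * (ennreal (Cx * (e + d)) + ennreal e + ennreal d)"
      by (rule order_trans[OF U[OF T0 order_refl]]) (intro mult_left_mono add_right_mono XT, simp)
    also have "\<dots> = ennreal Cv * ennreal (Cx * (e + d) + (e + d))"
      using e d(2) Cx by (simp add: ennreal_plus add.assoc)
    also have "\<dots> = ennreal (Cv * (Cx + 1) * (e + d))"
    proof -
      have "Cx * (e + d) + (e + d) = (Cx + 1) * (e + d)" by (simp add: distrib_right)
      moreover have "0 \<le> (Cx + 1) * (e + d)" using Cx ed by (intro mult_nonneg_nonneg) auto
      ultimately show ?thesis using Cv by (simp only: ennreal_mult mult.assoc less_imp_le)
    qed
    finally have UT: "?U T \<le> ennreal (Cv * (Cx + 1) * (e + d))" .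
    have "(H_dist P T (xs m n) x)\<^sup>2 \<le> Cx * (e + d)"
      using XT Cx ed unfolding sq_integral_H_norm(2)[OF P dx] by (subst (asm) ennreal_le_iff) auto
    moreover have "(H_dist P T (us m n) u)\<^sup>2 \<le> Cv * (Cx + 1) * (e + d)"
      using UT Cx Cv ed unfolding sq_integral_H_norm(2)[OF P du] by (subst (asm) ennreal_le_iff) auto
    moreover have "Cx * (e + d) \<le> C2 * (e + d)" "Cv * (Cx + 1) * (e + d) \<le> C2 * (e + d)"
      using C2 ed by (auto intro: mult_right_mono)
    ultimately show ?thesis unfolding e_def by linarith
  qed

  have ev: "eventually (\<lambda>(m, n). H_dist P T (xs m n) x < r \<and> H_dist P T (us m n) u < r) (sequentially \<times>\<^sub>F sequentially)"
    if r: "0 < r" for r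
  proof -
    \<comment> \<open>Chosen so that \<open>main\<close>, with coefficient error
      \<open>sqrt \<eta>\<close> and projection error \<open>\<eta>\<close>, gives
      \<open>r^2 / 2\<close>, strictly below \<open>r^2\<close>.\<close>
    define \<eta> where "\<eta> = r\<^sup>2 / (2 * C2 * (T + 1))"
    have \<eta>: "0 < \<eta>" using r C2 T_pos by (simp add: \<eta>_def)
    have "C2 * ((sqrt \<eta>)\<^sup>2 * T + \<eta>) = r\<^sup>2 / 2"
    proof -
      have "\<eta> * (2 * C2 * (T + 1)) = r\<^sup>2" using C2 T_pos by (simp add: \<eta>_def)
      then have "C2 * (\<eta> * T + \<eta>) = r\<^sup>2 / 2" by (simp add: algebra_simps)
      then show ?thesis using \<eta> by simp
    qed
    moreover have "0 < r\<^sup>2" using r by simp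
    ultimately have small: "C2 * ((sqrt \<eta>)\<^sup>2 * T + \<eta>) < r\<^sup>2" by linarith
    have "0 < sqrt \<eta>" using \<eta> by simp
    note uc = unif_cont[OF this, THEN lam_close]
    have "eventually (\<lambda>n. \<delta> n < ennreal \<eta>) sequentially"
      using order_tendstoD(2)[OF \<delta>_lim] \<eta> by simp
    \<comment> \<open>The threshold for \<open>m\<close> must be uniform in \<open>n\<close>, as the
      product filter asks for one condition on each index.\<close>
    moreover have "eventually (\<lambda>m. \<forall>n. \<delta> n < ennreal \<eta> \<longrightarrow>
        H_dist P T (xs m n) x < r \<and> H_dist P T (us m n) u < r) sequentially"
      using uc
    proof eventually_elim
      case (elim m)
      show ?case
      proof (intro allI impI)
        fix n assume "\<delta> n < ennreal \<eta>"
        then have "(H_dist P T (xs m n) x)\<^sup>2 < r\<^sup>2 \<and> (H_dist P T (us m n) u)\<^sup>2 < r\<^sup>2"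
          using main[OF \<open>0 < sqrt \<eta>\<close> less_imp_le less_imp_le[OF \<eta>] elim] small by fastforce
        then show "H_dist P T (xs m n) x < r \<and> H_dist P T (us m n) u < r"
          using r by (auto intro: power2_less_imp_less)
      qed
    qed
    ultimately show ?thesis unfolding eventually_prod_filter by fast
  qed
  have nn: "0 \<le> H_dist P T (xs m n) x" "0 \<le> H_dist P T (us m n) u" for m n
    using sq_integral_H_norm(3)[OF P L2ad_diff[OF sf Sn(1) S(1)]] sq_integral_H_norm(3)[OF P L2ad_diff[OF sf Sn(2) S(2)]] by auto
  show ?thesis
  proof (intro conjI tendstoI)
    fix r :: real assume "0 < r"
    from ev[OF this] show "eventually (\<lambda>p. dist (case p of (m, n) \<Rightarrow> H_dist P T (xs m n) x) 0 < r) (sequentially \<times>\<^sub>F sequentially)"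
      by (rule eventually_mono) (use nn in auto)
    from ev[OF \<open>0 < r\<close>] show "eventually (\<lambda>p. dist (case p of (m, n) \<Rightarrow> H_dist P T (us m n) u) 0 < r) (sequentially \<times>\<^sub>F sequentially)"
      by (rule eventually_mono) (use nn in auto)
  qed
qed

end
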